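(* Let $\mathcal M$ be a Green 2-functor for $(\mathbb G;\mathbb J)$. Then: (1) Suppose $\{X_G,Y_G,\lambda_u,\rho_u\}_{G,u}$ is a coherent family of pairs in $\mathcal M$ such that each $X_G$ is a comonoid in $\mathcal M(G)$, each $Y_G$ a monoid, each $\lambda_u$ a comonoid map and each $\rho_u$ a monoid map. Then its Hom-decategorification $M$ is an ordinary Green functor for $(\mathbb G;\mathbb J)$ where the multiplication on $M(G)=\mathrm{Hom}_{\mathcal M(G)}(X_G,Y_G)$ is the associated convolution product. (2) The Mackey functor induced by a coherent family whose objects are left (resp. right) modules and comodules over the monoids and comonoids of part (1) and whose coherence maps are morphisms of such, is a left (resp. right) module over the Green functor of (1).
   Context: Fix a commutative ring $\Bbbk$. $\mathbb A$ denotes either $\mathsf{ADD}_\Bbbk$, the 2-category of (possibly large) additive $\Bbbk$-linear categories, $\Bbbk$-linear functors and natural transformations, or its full 2-subcategory of idempotent complete ones. A spannable pair $(\mathbb G;\mathbb J)$ consists of: (1) an essentially small $(2,1)$-category $\mathbb G$ (Hom categories are small groupoids; up to equivalence only a small set of objects), which (2) is extensive (it has finite coproducts and for all $G,H$ the pseudofunctor $\mathbb G/G\times\mathbb G/H\to\mathbb G/(G\sqcup H)$, $(u,v)\mapsto u\sqcup v$, is a biequivalence); (3) a 2-full 2-subcategory $\mathbb J\subseteq\mathbb G$ containing all equivalences and closed under isomorphic 1-cells, such that (4) for $i\colon H\to G$ in $\mathbb J$ and any $u\colon K\to G$ there is a pseudopullback ("Mackey square") $p\colon P\to H$, $q\colon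 P\to K$, $\gamma\colon ip\overset{\sim}{\Rightarrow}uq$, with $q\in\mathbb J$; and (5) for every finite family $u_\ell\colon H_\ell\to G$, the induced $\sqcup_\ell H_\ell\to G$ is in $\mathbb J$ iff every $u_\ell$ is. A Mackey 2-functor for $(\mathbb G;\mathbb J)$ is a 2-functor $\mathcal M\colon\mathbb G^{op}\to\mathbb A$ (write $u^*=\mathcal M(u)$) such that: (1) it sends finite coproducts to direct sums; (2) for $i\in\mathbb J$, $i^*$ has a left adjoint $i_!$ and a right adjoint $i_*$; (3) for every Mackey square with $i,q\in\mathbb J$ the mates $\gamma_!\colon q_!p^*\Rightarrow u^*i_!$ and $(\gamma^{-1})_*\colon u^*i_*\Rightarrow q_*p^*$ are invertible; (4) $i_!\simeq i_*$ for $i\in\mathbb J$. Standing assumption: all Mackey 2-functors are rectified, i.e. come with chosen adjunctions $(i_!\dashv i^*,{}^\ell\eta,{}^\ell\varepsilon)$ and $(i^*\dashv i_*,{}^r\eta,{}^r\varepsilon)$ for $i\in\mathbb J$ with $i_!=i_*$ as functors, the pseudofunctors $i\mapsto i_!$ and $i\mapsto i_*$ on $\mathbb J$ equal, $(\gamma_!)^{-1}=(\gamma^{-1})_*$ for all Mackey squares, and ${}^r\varepsilon\circ{}^\ell\eta=\mathrm{id}$. A Green 2-functor for $(\mathbb G;\mathbb J)$ is a Mackey 2-functor $\mathcal M$ together with a lift of $\mathcal M$ to a 2-functor into monoidal categories in $\mathbb A$ (tensor product $\otimes$ $\Bbbk$-bilinear, unit $\mathbf 1_G$), $\Bbbk$-linear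 strong monoidal functors $u^*$ (write $\otimes_u\colon u^*(X\otimes X')\xrightarrow{\sim}u^*X\otimes u^*X'$) and monoidal transformations, satisfying the projection formulas: for all $i\in\mathbb J$, the maps $\mathrm{Rp}^1_{X,Y}=i_*(i^*X\otimes{}^r\varepsilon)\circ i_*(\otimes_i)\circ{}^r\eta\colon X\otimes i_*Y\to i_*(i^*X\otimes Y)$ and $\mathrm{Rp}^2_{Y,X}=i_*({}^r\varepsilon\otimes i^*X)\circ i_*(\otimes_i)\circ{}^r\eta\colon i_*Y\otimes X\to i_*(Y\otimes i^*X)$ are inverse to $\mathrm{Lp}^1_{X,Y}={}^\ell\varepsilon\circ i_!(\otimes_i^{-1})\circ i_!(i^*X\otimes{}^\ell\eta)$ and $\mathrm{Lp}^2_{Y,X}={}^\ell\varepsilon\circ i_!(\otimes_i^{-1})\circ i_!({}^\ell\eta\otimes i^*X)$ respectively. An ordinary Mackey functor $M$ for $(\mathbb G;\mathbb J)$: $\Bbbk$-modules $M(G)$, $\Bbbk$-linear maps $u^\bullet\colon M(G)\to M(H)$ for $u\colon H\to G$ in $\mathbb G$ and $u_\bullet\colon M(H)\to M(G)$ if $u\in\mathbb J$, functorial, depending only on isomorphism classes of 1-cells, with $(i^\bullet,j^\bullet)\colon M(G\sqcup H)\cong M(G)\oplus M(H)$ inverse to $(i_\bullet,j_\bullet)$ for coproduct inclusions $i,j$, and $u^\bullet i_\bullet=q_\bullet p^\bullet$ for Mackey squares. An ordinary Green functor is a Mackey functor with an associative unital $\Bbbk$-algebra structure on each $M(G)$ such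 that $u^\bullet(xy)=u^\bullet(x)u^\bullet(y)$ for all $u$ and, for $u\in\mathbb J$, $x\cdot u_\bullet(y)=u_\bullet(u^\bullet(x)\cdot y)$ and $u_\bullet(y)\cdot x=u_\bullet(y\cdot u^\bullet(x))$. A left (right) module over $M$ is a Mackey functor $N$ with left (right) $M(G)$-module structures on $N(G)$ satisfying the analogous formulas (compatibility with $u^\bullet$, and both Frobenius formulas for $u\in\mathbb J$). A coherent family of pairs $\{X_G,Y_G,\lambda_u,\rho_u\}$ in $\mathcal M$: objects $X_G,Y_G\in\mathcal M(G)$ for all $G$, and isomorphisms $\lambda_u\colon X_H\xrightarrow{\sim}u^*X_G$, $\rho_u\colon u^*Y_G\xrightarrow{\sim}Y_H$ for all $u\colon H\to G$, with $\lambda_{\mathrm{Id}}=\mathrm{id}$, $\rho_{\mathrm{Id}}=\mathrm{id}$, $\lambda_{uv}=v^*(\lambda_u)\lambda_v$, $\rho_{uv}=\rho_v\,v^*(\rho_u)$, and $\alpha^*_{X_G}\lambda_u=\lambda_v$, $\rho_v\alpha^*_{Y_G}=\rho_u$ for each 2-cell $\alpha\colon u\Rightarrow v$ (with $\alpha^*=\mathcal M(\alpha)\colon u^*\Rightarrow v^*$). Its Hom-decategorification is the ordinary Mackey functor with $M(G)=\mathrm{Hom}_{\mathcal M(G)}(X_G,Y_G)$, $u^\bullet(\varphi)=\rho_u\circ u^*(\varphi)\circ\lambda_u$, and $u_\bullet(\psi)={}^\ell\varepsilon\circ u_*(\rho_u^{-1}\psi\lambda_u^{-1})\circ{}^r\eta$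 for $u\in\mathbb J$. The (co)monoid structures on $u^*X_G$ and $u^*Y_G$ are those transported by the strong monoidal functor $u^*$. With $(X_G,\delta_G,\epsilon_G)$ the comonoids and $(Y_G,\mu_G,\iota_G)$ the monoids, the convolution product is $x\cdot y=\mu_G\circ(x\otimes y)\circ\delta_G$, with unit $\iota_G\epsilon_G$. In (2), for the left case, the family $\{X'_G,Y'_G,\lambda'_u,\rho'_u\}$ has each $X'_G$ a left $X_G$-comodule and each $Y'_G$ a left $Y_G$-module, with $\lambda'_u$, $\rho'_u$ compatible with the (co)actions along $\lambda_u$, $\rho_u$; the action of $x\in M(G)$ on $y\in\mathrm{Hom}(X'_G,Y'_G)$ is the composite $X'_G\to X_G\otimes X'_G\xrightarrow{x\otimes y}Y_G\otimes Y'_G\to Y'_G$ of the coaction, $x\otimes y$ and the action; the right case is analogous. *)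

theory Defs
  imports "HOL-Algebra.Module"
begin

section \<open>Categories, functors, adjunctions\<close>

record ('o, 'm) cat =
  obj :: "'o set"
  arr :: "'m set"
  cdom :: "'m \<Rightarrow> 'o"
  ccod :: "'m \<Rightarrow> 'o"
  cid :: "'o \<Rightarrow> 'm"
  ccomp :: "'m \<Rightarrow> 'm \<Rightarrow> 'm"  (infixr \<open>\<cdot>\<index>\<close> 71)

definition chom :: "('o, 'm, 'z) cat_scheme \<Rightarrow> 'o \<Rightarrow> 'o \<Rightarrow> 'm set"
  where "chom C x y = {f \<in> arr C. cdom C f = x \<and> ccod C f = y}"

locale category =
  fixes C :: "('o, 'm, 'z) cat_scheme" (structure)
  assumes dom_closed: "f \<in> arr C \<Longrightarrow> cdom C f \<in> obj C"
    and cod_closed: "f \<in> arr C \<Longrightarrow> ccod C f \<in> obj C"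
    and id_closed: "x \<in> obj C \<Longrightarrow> cid C x \<in> chom C x x"
    and comp_closed: "\<lbrakk>f \<in> chom C x y; g \<in> chom C y z\<rbrakk> \<Longrightarrow> g \<cdot> f \<in> chom C x z"
    and id_left: "f \<in> arr C \<Longrightarrow> cid C (ccod C f) \<cdot> f = f"
    and id_right: "f \<in> arr C \<Longrightarrow> f \<cdot> cid C (cdom C f) = f"
    and comp_assoc: "\<lbrakk>f \<in> chom C w x; g \<in> chom C x y; h \<in> chom C y z\<rbrakk>
      \<Longrightarrow> (h \<cdot> g) \<cdot> f = h \<cdot> (g \<cdot> f)"

definition inverse_arrows :: "('o, 'm, 'z) cat_scheme \<Rightarrow> 'm \<Rightarrow> 'm \<Rightarrow> bool"
  where "inverse_arrows C f g \<longleftrightarrow>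
    f \<in> arr C \<and> g \<in> chom C (ccod C f) (cdom C f) \<and>
    g \<cdot>\<^bsub>C\<^esub> f = cid C (cdom C f) \<and> f \<cdot>\<^bsub>C\<^esub> g = cid C (ccod C f)"

definition iso_arrow :: "('o, 'm, 'z) cat_scheme \<Rightarrow> 'm \<Rightarrow> bool"
  where "iso_arrow C f \<longleftrightarrow> (\<exists>g. inverse_arrows C f g)"

definition cinv :: "('o, 'm, 'z) cat_scheme \<Rightarrow> 'm \<Rightarrow> 'm"
  where "cinv C f = (THE g. inverse_arrows C f g)"

record ('o, 'm, 'p, 'n) ftor =
  fob :: "'o \<Rightarrow> 'p"
  fmor :: "'m \<Rightarrow> 'n"

definition is_functor ::
    "('o, 'm, 'y) cat_scheme \<Rightarrow> ('p, 'n, 'z) cat_scheme \<Rightarrow> ('o, 'm, 'p, 'n) ftor \<Rightarrow> bool"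
  where "is_functor C D F \<longleftrightarrow>
    category C \<and> category D \<and>
    (\<forall>x \<in> obj C. fob F x \<in> obj D) \<and>
    (\<forall>f \<in> arr C. fmor F f \<in> chom D (fob F (cdom C f)) (fob F (ccod C f))) \<and>
    (\<forall>x \<in> obj C. fmor F (cid C x) = cid D (fob F x)) \<and>
    (\<forall>f \<in> arr C. \<forall>g \<in> arr C. cdom C g = ccod C f \<longrightarrow>
       fmor F (g \<cdot>\<^bsub>C\<^esub> f) = fmor F g \<cdot>\<^bsub>D\<^esub> fmor F f)"

definition id_ftor :: "('o, 'm, 'o, 'm) ftor"
  where "id_ftor = \<lparr>fob = (\<lambda>x. x), fmor = (\<lambda>f. f)\<rparr>"

definition comp_ftor ::
    "('p, 'n, 'q, 'r) ftor \<Rightarrow> ('o, 'm, 'p, 'n) ftor \<Rightarrow> ('o, 'm, 'q, 'r) ftor"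
  where "comp_ftor K F = \<lparr>fob = (\<lambda>x. fob K (fob F x)), fmor = (\<lambda>f. fmor K (fmor F f))\<rparr>"

definition nat_trans ::
    "('o, 'm, 'y) cat_scheme \<Rightarrow> ('p, 'n, 'z) cat_scheme \<Rightarrow>
     ('o, 'm, 'p, 'n) ftor \<Rightarrow> ('o, 'm, 'p, 'n) ftor \<Rightarrow> ('o \<Rightarrow> 'n) \<Rightarrow> bool"
  where "nat_trans C D F K t \<longleftrightarrow>
    is_functor C D F \<and> is_functor C D K \<and>
    (\<forall>x \<in> obj C. t x \<in> chom D (fob F x) (fob K x)) \<and>
    (\<forall>f \<in> arr C. t (ccod C f) \<cdot>\<^bsub>D\<^esub> fmor F f = fmor K f \<cdot>\<^bsub>D\<^esub> t (cdom C f))"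

definition nat_iso ::
    "('o, 'm, 'y) cat_scheme \<Rightarrow> ('p, 'n, 'z) cat_scheme \<Rightarrow>
     ('o, 'm, 'p, 'n) ftor \<Rightarrow> ('o, 'm, 'p, 'n) ftor \<Rightarrow> ('o \<Rightarrow> 'n) \<Rightarrow> bool"
  where "nat_iso C D F K t \<longleftrightarrow> nat_trans C D F K t \<and> (\<forall>x \<in> obj C. iso_arrow D (t x))"

definition is_equivalence ::
    "('o, 'm, 'y) cat_scheme \<Rightarrow> ('p, 'n, 'z) cat_scheme \<Rightarrow> ('o, 'm, 'p, 'n) ftor \<Rightarrow> bool"
  where "is_equivalence C D F \<longleftrightarrow>
    is_functor C D F \<and>
    (\<exists>K. is_functor D C K \<and>
      (\<exists>s. nat_iso C C id_ftor (comp_ftor K F) s) \<and>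
      (\<exists>t. nat_iso D D (comp_ftor F K) id_ftor t))"

definition adjunction ::
    "('o, 'm, 'y) cat_scheme \<Rightarrow> ('p, 'n, 'z) cat_scheme \<Rightarrow>
     ('o, 'm, 'p, 'n) ftor \<Rightarrow> ('p, 'n, 'o, 'm) ftor \<Rightarrow> ('o \<Rightarrow> 'm) \<Rightarrow> ('p \<Rightarrow> 'n) \<Rightarrow> bool"
  where "adjunction C D L K \<eta> \<epsilon> \<longleftrightarrow>
    nat_trans C C id_ftor (comp_ftor K L) \<eta> \<and>
    nat_trans D D (comp_ftor L K) id_ftor \<epsilon> \<and>
    is_functor C D L \<and> is_functor D C K \<and>
    (\<forall>x \<in> obj C. \<epsilon> (fob L x) \<cdot>\<^bsub>D\<^esub> fmor L (\<eta> x) = cid D (fob L x)) \<and>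
    (\<forall>y \<in> obj D. fmor K (\<epsilon> y) \<cdot>\<^bsub>C\<^esub> \<eta> (fob K y) = cid C (fob K y))"

definition prod_cat ::
    "('o, 'm, 'y) cat_scheme \<Rightarrow> ('p, 'n, 'z) cat_scheme \<Rightarrow> ('o \<times> 'p, 'm \<times> 'n) cat"
  where "prod_cat C D =
    \<lparr>obj = obj C \<times> obj D, arr = arr C \<times> arr D,
     cdom = (\<lambda>(f, g). (cdom C f, cdom D g)), ccod = (\<lambda>(f, g). (ccod C f, ccod D g)),
     cid = (\<lambda>(x, y). (cid C x, cid D y)),
     ccomp = (\<lambda>(f', g') (f, g). (f' \<cdot>\<^bsub>C\<^esub> f, g' \<cdot>\<^bsub>D\<^esub> g))\<rparr>"

definition pi_cat ::
    "'l set \<Rightarrow> ('l \<Rightarrow> ('o, 'm, 'z) cat_scheme) \<Rightarrow> ('l \<Rightarrow> 'o, 'l \<Rightarrow> 'm) cat"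
  where "pi_cat I C =
    \<lparr>obj = (\<Pi>\<^sub>E l \<in> I. obj (C l)), arr = (\<Pi>\<^sub>E l \<in> I. arr (C l)),
     cdom = (\<lambda>f. \<lambda>l \<in> I. cdom (C l) (f l)), ccod = (\<lambda>f. \<lambda>l \<in> I. ccod (C l) (f l)),
     cid = (\<lambda>x. \<lambda>l \<in> I. cid (C l) (x l)),
     ccomp = (\<lambda>g f. \<lambda>l \<in> I. g l \<cdot>\<^bsub>C l\<^esub> f l)\<rparr>"

text \<open>The iso-comma category of \<open>F: C \<rightarrow> E\<close> and \<open>K: D \<rightarrow> E\<close>. Its arrows carry their source and
  target objects, since these cannot be recovered from the two components.\<close>

definition iso_comma ::
    "('o, 'm, 'x) cat_scheme \<Rightarrow> ('p, 'n, 'y) cat_scheme \<Rightarrow> ('q, 'r, 'z) cat_scheme \<Rightarrow>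
     ('o, 'm, 'q, 'r) ftor \<Rightarrow> ('p, 'n, 'q, 'r) ftor \<Rightarrow>
     ('o \<times> 'p \<times> 'r, ('o \<times> 'p \<times> 'r) \<times> ('m \<times> 'n) \<times> ('o \<times> 'p \<times> 'r)) cat"
  where "iso_comma C D E F K =
    (let Ob = {(a, b, \<beta>). a \<in> obj C \<and> b \<in> obj D \<and> \<beta> \<in> chom E (fob F a) (fob K b) \<and> iso_arrow E \<beta>} in
    \<lparr>obj = Ob,
     arr = {((a, b, \<beta>), (\<sigma>, \<tau>), (a', b', \<beta>')).
              (a, b, \<beta>) \<in> Ob \<and> (a', b', \<beta>') \<in> Ob \<and> \<sigma> \<in> chom C a a' \<and> \<tau> \<in> chom D b b' \<and>
              fmor K \<tau> \<cdot>\<^bsub>E\<^esub> \<beta> = \<beta>' \<cdot>\<^bsub>E\<^esub> fmor F \<sigma>},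
     cdom = (\<lambda>(x, _, _). x), ccod = (\<lambda>(_, _, y). y),
     cid = (\<lambda>(a, b, \<beta>). ((a, b, \<beta>), (cid C a, cid D b), (a, b, \<beta>))),
     ccomp = (\<lambda>(_, (\<sigma>', \<tau>'), z) (x, (\<sigma>, \<tau>), _). (x, (\<sigma>' \<cdot>\<^bsub>C\<^esub> \<sigma>, \<tau>' \<cdot>\<^bsub>D\<^esub> \<tau>), z))\<rparr>)"


section \<open>Linear and additive categories\<close>

text \<open>Only the additive and scalar structure of the Hom modules is meaningful; the fields
  \<^const>\<open>mult\<close> and \<^const>\<open>one\<close> of the library's module record are unconstrained.\<close>

record ('k, 'o, 'm) lin_cat = "('o, 'm) cat" +
  hmod :: "'o \<Rightarrow> 'o \<Rightarrow> ('k, 'm) module"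

definition linear_map ::
    "('k, 'r) ring_scheme \<Rightarrow> ('k, 'a, 'y) module_scheme \<Rightarrow> ('k, 'b, 'z) module_scheme \<Rightarrow>
     ('a \<Rightarrow> 'b) \<Rightarrow> bool"
  where "linear_map R V W f \<longleftrightarrow>
    module R V \<and> module R W \<and> f \<in> carrier V \<rightarrow> carrier W \<and>
    (\<forall>x \<in> carrier V. \<forall>y \<in> carrier V. f (x \<oplus>\<^bsub>V\<^esub> y) = f x \<oplus>\<^bsub>W\<^esub> f y) \<and>
    (\<forall>a \<in> carrier R. \<forall>x \<in> carrier V. f (a \<odot>\<^bsub>V\<^esub> x) = a \<odot>\<^bsub>W\<^esub> f x)"

definition bilinear_map ::
    "('k, 'r) ring_scheme \<Rightarrow> ('k, 'a, 'x) module_scheme \<Rightarrow> ('k, 'b, 'y) module_scheme \<Rightarrow>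
     ('k, 'c, 'z) module_scheme \<Rightarrow> ('a \<Rightarrow> 'b \<Rightarrow> 'c) \<Rightarrow> bool"
  where "bilinear_map R U V W b \<longleftrightarrow>
    (\<forall>x \<in> carrier U. linear_map R V W (b x)) \<and>
    (\<forall>y \<in> carrier V. linear_map R U W (\<lambda>x. b x y))"

definition linear_category :: "('k, 'r) ring_scheme \<Rightarrow> ('k, 'o, 'm) lin_cat \<Rightarrow> bool"
  where "linear_category R C \<longleftrightarrow>
    category C \<and>
    (\<forall>x \<in> obj C. \<forall>y \<in> obj C. module R (hmod C x y) \<and> carrier (hmod C x y) = chom C x y) \<and>
    (\<forall>x \<in> obj C. \<forall>y \<in> obj C. \<forall>z \<in> obj C.
       bilinear_map R (hmod C y z) (hmod C x y) (hmod C x z) (ccomp C))"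

definition additive_category :: "('k, 'r) ring_scheme \<Rightarrow> ('k, 'o, 'm) lin_cat \<Rightarrow> bool"
  where "additive_category R C \<longleftrightarrow>
    linear_category R C \<and>
    (\<exists>z \<in> obj C. cid C z = \<zero>\<^bsub>hmod C z z\<^esub>) \<and>
    (\<forall>x \<in> obj C. \<forall>y \<in> obj C. \<exists>s \<in> obj C.
       \<exists>i \<in> chom C x s. \<exists>j \<in> chom C y s. \<exists>p \<in> chom C s x. \<exists>q \<in> chom C s y.
         p \<cdot>\<^bsub>C\<^esub> i = cid C x \<and> q \<cdot>\<^bsub>C\<^esub> j = cid C y \<and>
         q \<cdot>\<^bsub>C\<^esub> i = \<zero>\<^bsub>hmod C x y\<^esub> \<and> p \<cdot>\<^bsub>C\<^esub> j = \<zero>\<^bsub>hmod C y x\<^esub> \<and>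
         (i \<cdot>\<^bsub>C\<^esub> p) \<oplus>\<^bsub>hmod C s s\<^esub> (j \<cdot>\<^bsub>C\<^esub> q) = cid C s)"

definition idempotent_complete :: "('o, 'm, 'z) cat_scheme \<Rightarrow> bool"
  where "idempotent_complete C \<longleftrightarrow>
    (\<forall>x \<in> obj C. \<forall>e \<in> chom C x x. e \<cdot>\<^bsub>C\<^esub> e = e \<longrightarrow>
       (\<exists>y \<in> obj C. \<exists>r \<in> chom C x y. \<exists>s \<in> chom C y x. r \<cdot>\<^bsub>C\<^esub> s = cid C y \<and> s \<cdot>\<^bsub>C\<^esub> r = e))"

text \<open>The two possible target 2-categories: all additive categories, or the idempotent complete ones.\<close>

datatype ambient = ADD | ADD_ic

definition in_ambient :: "ambient \<Rightarrow> ('k, 'r) ring_scheme \<Rightarrow> ('k, 'o, 'm) lin_cat \<Rightarrow> bool"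
  where "in_ambient \<AA> R C \<longleftrightarrow> additive_category R C \<and> (\<AA> = ADD_ic \<longrightarrow> idempotent_complete C)"

definition linear_functor ::
    "('k, 'r) ring_scheme \<Rightarrow> ('k, 'o, 'm) lin_cat \<Rightarrow> ('k, 'p, 'n) lin_cat \<Rightarrow>
     ('o, 'm, 'p, 'n) ftor \<Rightarrow> bool"
  where "linear_functor R C D F \<longleftrightarrow>
    is_functor C D F \<and>
    (\<forall>x \<in> obj C. \<forall>y \<in> obj C. linear_map R (hmod C x y) (hmod D (fob F x) (fob F y)) (fmor F))"


section \<open>Strict 2-categories\<close>

text \<open>\<open>Comp1 \<G> u v\<close> is \<open>u \<circ> v\<close> (first \<open>v\<close>), and \<open>HComp \<G> \<alpha> \<beta>\<close> is the horizontal composite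
  \<open>u \<circ> v \<Rightarrow> u' \<circ> v'\<close> of \<open>\<alpha>: u \<Rightarrow> u'\<close> and \<open>\<beta>: v \<Rightarrow> v'\<close>.\<close>

record ('g, 'c, 'd) two_cat =
  Ob :: "'g set"
  Arr1 :: "'c set"
  Src :: "'c \<Rightarrow> 'g"
  Trg :: "'c \<Rightarrow> 'g"
  Unit1 :: "'g \<Rightarrow> 'c"
  Comp1 :: "'c \<Rightarrow> 'c \<Rightarrow> 'c"
  Arr2 :: "'d set"
  Src2 :: "'d \<Rightarrow> 'c"
  Trg2 :: "'d \<Rightarrow> 'c"
  Id2 :: "'c \<Rightarrow> 'd"
  VComp :: "'d \<Rightarrow> 'd \<Rightarrow> 'd"
  HComp :: "'d \<Rightarrow> 'd \<Rightarrow> 'd"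

definition hom1 :: "('g, 'c, 'd) two_cat \<Rightarrow> 'g \<Rightarrow> 'g \<Rightarrow> 'c set"
  where "hom1 \<G> H G = {u \<in> Arr1 \<G>. Src \<G> u = H \<and> Trg \<G> u = G}"

definition hom2 :: "('g, 'c, 'd) two_cat \<Rightarrow> 'c \<Rightarrow> 'c \<Rightarrow> 'd set"
  where "hom2 \<G> u v = {\<alpha> \<in> Arr2 \<G>. Src2 \<G> \<alpha> = u \<and> Trg2 \<G> \<alpha> = v}"

definition under_cat :: "('g, 'c, 'd) two_cat \<Rightarrow> ('g, 'c) cat"
  where "under_cat \<G> =
    \<lparr>obj = Ob \<G>, arr = Arr1 \<G>, cdom = Src \<G>, ccod = Trg \<G>, cid = Unit1 \<G>, ccomp = Comp1 \<G>\<rparr>"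

definition hom_cat :: "('g, 'c, 'd) two_cat \<Rightarrow> 'g \<Rightarrow> 'g \<Rightarrow> ('c, 'd) cat"
  where "hom_cat \<G> H G =
    \<lparr>obj = hom1 \<G> H G,
     arr = {\<alpha> \<in> Arr2 \<G>. Src2 \<G> \<alpha> \<in> hom1 \<G> H G \<and> Trg2 \<G> \<alpha> \<in> hom1 \<G> H G},
     cdom = Src2 \<G>, ccod = Trg2 \<G>, cid = Id2 \<G>, ccomp = VComp \<G>\<rparr>"

locale two_category =
  fixes \<G> :: "('g, 'c, 'd) two_cat"
  assumes under_category: "category (under_cat \<G>)"
    and hom_category: "\<lbrakk>H \<in> Ob \<G>; G \<in> Ob \<G>\<rbrakk> \<Longrightarrow> category (hom_cat \<G> H G)"
    and parallel: "\<alpha> \<in> Arr2 \<G> \<Longrightarrow> Src2 \<G> \<alpha> \<in> Arr1 \<G> \<and> Trg2 \<G> \<alpha> \<in> Arr1 \<G> \<and>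
      Src \<G> (Src2 \<G> \<alpha>) = Src \<G> (Trg2 \<G> \<alpha>) \<and> Trg \<G> (Src2 \<G> \<alpha>) = Trg \<G> (Trg2 \<G> \<alpha>)"
    and hcomp_closed: "\<lbrakk>\<alpha> \<in> hom2 \<G> u u'; \<beta> \<in> hom2 \<G> v v'; Src \<G> u = Trg \<G> v\<rbrakk>
      \<Longrightarrow> HComp \<G> \<alpha> \<beta> \<in> hom2 \<G> (Comp1 \<G> u v) (Comp1 \<G> u' v')"
    and hcomp_id: "\<lbrakk>u \<in> Arr1 \<G>; v \<in> Arr1 \<G>; Src \<G> u = Trg \<G> v\<rbrakk>
      \<Longrightarrow> HComp \<G> (Id2 \<G> u) (Id2 \<G> v) = Id2 \<G> (Comp1 \<G> u v)"
    and interchange: "\<lbrakk>\<alpha> \<in> hom2 \<G> u u'; \<alpha>' \<in> hom2 \<G> u' u''; \<beta> \<in> hom2 \<G> v v'; \<beta>' \<in> hom2 \<G> v' v'';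
        Src \<G> u = Trg \<G> v\<rbrakk>
      \<Longrightarrow> HComp \<G> (VComp \<G> \<alpha>' \<alpha>) (VComp \<G> \<beta>' \<beta>) = VComp \<G> (HComp \<G> \<alpha>' \<beta>') (HComp \<G> \<alpha> \<beta>)"
    and hcomp_assoc: "\<lbrakk>\<alpha> \<in> hom2 \<G> u u'; \<beta> \<in> hom2 \<G> v v'; \<gamma> \<in> hom2 \<G> w w';
        Src \<G> u = Trg \<G> v; Src \<G> v = Trg \<G> w\<rbrakk>
      \<Longrightarrow> HComp \<G> (HComp \<G> \<alpha> \<beta>) \<gamma> = HComp \<G> \<alpha> (HComp \<G> \<beta> \<gamma>)"
    and hcomp_unit_left: "\<alpha> \<in> hom2 \<G> u u' \<Longrightarrow> HComp \<G> (Id2 \<G> (Unit1 \<G> (Trg \<G> u))) \<alpha> = \<alpha>"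
    and hcomp_unit_right: "\<alpha> \<in> hom2 \<G> u u' \<Longrightarrow> HComp \<G> \<alpha> (Id2 \<G> (Unit1 \<G> (Src \<G> u))) = \<alpha>"

definition inverse2 :: "('g, 'c, 'd) two_cat \<Rightarrow> 'd \<Rightarrow> 'd"
  where "inverse2 \<G> \<alpha> = cinv (hom_cat \<G> (Src \<G> (Src2 \<G> \<alpha>)) (Trg \<G> (Src2 \<G> \<alpha>))) \<alpha>"

locale two_one_category = two_category \<G> for \<G> :: "('g, 'c, 'd) two_cat" +
  assumes invertible2: "\<lbrakk>u \<in> hom1 \<G> H G; \<alpha> \<in> hom2 \<G> u v\<rbrakk> \<Longrightarrow> iso_arrow (hom_cat \<G> H G) \<alpha>"

definition isomorphic1 :: "('g, 'c, 'd) two_cat \<Rightarrow> 'c \<Rightarrow> 'c \<Rightarrow> bool"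
  where "isomorphic1 \<G> u v \<longleftrightarrow>
    u \<in> Arr1 \<G> \<and> (\<exists>\<alpha> \<in> hom2 \<G> u v. iso_arrow (hom_cat \<G> (Src \<G> u) (Trg \<G> u)) \<alpha>)"

definition equivalence1 :: "('g, 'c, 'd) two_cat \<Rightarrow> 'c \<Rightarrow> bool"
  where "equivalence1 \<G> e \<longleftrightarrow>
    e \<in> Arr1 \<G> \<and> (\<exists>f \<in> hom1 \<G> (Trg \<G> e) (Src \<G> e).
      isomorphic1 \<G> (Comp1 \<G> f e) (Unit1 \<G> (Src \<G> e)) \<and>
      isomorphic1 \<G> (Comp1 \<G> e f) (Unit1 \<G> (Trg \<G> e)))"

definition post_ftor :: "('g, 'c, 'd) two_cat \<Rightarrow> 'c \<Rightarrow> ('c, 'd, 'c, 'd) ftor"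
  where "post_ftor \<G> p = \<lparr>fob = Comp1 \<G> p, fmor = HComp \<G> (Id2 \<G> p)\<rparr>"

text \<open>Pseudopullbacks, i.e. squares \<open>\<gamma>: i p \<Rightarrow> u q\<close> inducing equivalences from \<open>\<G>(T, P)\<close> to the
  iso-comma category of \<open>\<G>(T, i)\<close> and \<open>\<G>(T, u)\<close>.\<close>

definition pseudopullback ::
    "('g, 'c, 'd) two_cat \<Rightarrow> 'c \<Rightarrow> 'c \<Rightarrow> 'c \<Rightarrow> 'c \<Rightarrow> 'd \<Rightarrow> bool"
  where "pseudopullback \<G> i u p q \<gamma> \<longleftrightarrow>
    i \<in> Arr1 \<G> \<and> u \<in> Arr1 \<G> \<and> p \<in> Arr1 \<G> \<and> q \<in> Arr1 \<G> \<and>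
    Trg \<G> i = Trg \<G> u \<and> Src \<G> p = Src \<G> q \<and> Trg \<G> p = Src \<G> i \<and> Trg \<G> q = Src \<G> u \<and>
    \<gamma> \<in> hom2 \<G> (Comp1 \<G> i p) (Comp1 \<G> u q) \<and>
    iso_arrow (hom_cat \<G> (Src \<G> p) (Trg \<G> i)) \<gamma> \<and>
    (\<forall>T \<in> Ob \<G>.
      let cone = (\<lambda>t. (Comp1 \<G> p t, Comp1 \<G> q t, HComp \<G> \<gamma> (Id2 \<G> t))) in
      is_equivalence
        (hom_cat \<G> T (Src \<G> p))
        (iso_comma (hom_cat \<G> T (Src \<G> i)) (hom_cat \<G> T (Src \<G> u)) (hom_cat \<G> T (Trg \<G> i))
           (post_ftor \<G> i) (post_ftor \<G> u))
        \<lparr>fob = cone,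
         fmor = (\<lambda>\<tau>. (cone (Src2 \<G> \<tau>),
                      (HComp \<G> (Id2 \<G> p) \<tau>, HComp \<G> (Id2 \<G> q) \<tau>),
                      cone (Trg2 \<G> \<tau>)))\<rparr>)"

text \<open>Coproducts are meant up to equivalence: \<open>\<G>(S, T)\<close> is equivalent, rather than isomorphic, to
  the product of the \<open>\<G>(H l, T)\<close>.\<close>

definition coproduct ::
    "('g, 'c, 'd) two_cat \<Rightarrow> nat set \<Rightarrow> (nat \<Rightarrow> 'g) \<Rightarrow> 'g \<Rightarrow> (nat \<Rightarrow> 'c) \<Rightarrow> bool"
  where "coproduct \<G> I H S incl \<longleftrightarrow>
    S \<in> Ob \<G> \<and> (\<forall>l \<in> I. H l \<in> Ob \<G> \<and> incl l \<in> hom1 \<G> (H l) S) \<and>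
    (\<forall>T \<in> Ob \<G>.
      is_equivalence (hom_cat \<G> S T) (pi_cat I (\<lambda>l. hom_cat \<G> (H l) T))
        \<lparr>fob = (\<lambda>w. \<lambda>l \<in> I. Comp1 \<G> w (incl l)),
         fmor = (\<lambda>\<alpha>. \<lambda>l \<in> I. HComp \<G> \<alpha> (Id2 \<G> (incl l)))\<rparr>)"

definition binary_coproduct ::
    "('g, 'c, 'd) two_cat \<Rightarrow> 'g \<Rightarrow> 'g \<Rightarrow> 'g \<Rightarrow> 'c \<Rightarrow> 'c \<Rightarrow> bool"
  where "binary_coproduct \<G> A B S i j \<longleftrightarrow>
    coproduct \<G> {0, 1} (\<lambda>l. if l = 0 then A else B) S (\<lambda>l. if l = 0 then i else j)"

definition has_finite_coproducts :: "('g, 'c, 'd) two_cat \<Rightarrow> bool"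
  where "has_finite_coproducts \<G> \<longleftrightarrow>
    (\<forall>n H. (\<forall>l < n. H l \<in> Ob \<G>) \<longrightarrow> (\<exists>S incl. coproduct \<G> {..<n} H S incl))"

text \<open>The (pseudo)slice 2-category over \<open>A\<close>. An object is a 1-cell \<open>u\<close> with target \<open>A\<close>, a 1-cell
  \<open>u \<rightarrow> u'\<close> is a pair of \<open>f\<close> and \<open>\<phi>: u \<Rightarrow> u' f\<close>, and a 2-cell \<open>(f, \<phi>) \<Rightarrow> (g, \<psi>)\<close> is a 2-cell
  \<open>\<alpha>: f \<Rightarrow> g\<close> with \<open>(u' \<alpha>) \<phi> = \<psi>\<close>; cells carry their sources and targets.\<close>

type_synonym ('c, 'd) slice1 = "'c \<times> ('c \<times> 'd) \<times> 'c"
type_synonym ('c, 'd) slice2 = "('c, 'd) slice1 \<times> 'd \<times> ('c, 'd) slice1"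

definition slice ::
    "('g, 'c, 'd) two_cat \<Rightarrow> 'g \<Rightarrow> ('c, ('c, 'd) slice1, ('c, 'd) slice2) two_cat"
  where "slice \<G> A =
    (let Obs = {u \<in> Arr1 \<G>. Trg \<G> u = A};
         Cells = {(u, (f, \<phi>), u'). u \<in> Obs \<and> u' \<in> Obs \<and> f \<in> hom1 \<G> (Src \<G> u) (Src \<G> u') \<and>
                    \<phi> \<in> hom2 \<G> u (Comp1 \<G> u' f) \<and> iso_arrow (hom_cat \<G> (Src \<G> u) A) \<phi>};
         comp1 = (\<lambda>(_, (g, \<psi>), u'') (u, (f, \<phi>), _).
                    (u, (Comp1 \<G> g f, VComp \<G> (HComp \<G> \<psi> (Id2 \<G> f)) \<phi>), u''))
     in
    \<lparr>Ob = Obs, Arr1 = Cells, Src = (\<lambda>(u, _, _). u), Trg = (\<lambda>(_, _, u'). u'),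
     Unit1 = (\<lambda>u. (u, (Unit1 \<G> (Src \<G> u), Id2 \<G> u), u)),
     Comp1 = comp1,
     Arr2 = {((u, (f, \<phi>), u'), \<alpha>, (v, (g, \<psi>), v')).
               (u, (f, \<phi>), u') \<in> Cells \<and> (v, (g, \<psi>), v') \<in> Cells \<and> u = v \<and> u' = v' \<and>
               \<alpha> \<in> hom2 \<G> f g \<and> VComp \<G> (HComp \<G> (Id2 \<G> u') \<alpha>) \<phi> = \<psi>},
     Src2 = (\<lambda>(m, _, _). m), Trg2 = (\<lambda>(_, _, m'). m'),
     Id2 = (\<lambda>(u, (f, \<phi>), u'). ((u, (f, \<phi>), u'), Id2 \<G> f, (u, (f, \<phi>), u'))),
     VComp = (\<lambda>(_, \<beta>, m'') (m, \<alpha>, _). (m, VComp \<G> \<beta> \<alpha>, m'')),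
     HComp = (\<lambda>(n, \<beta>, n') (m, \<alpha>, m'). (comp1 n m, HComp \<G> \<beta> \<alpha>, comp1 n' m'))\<rparr>)"

text \<open>The pseudofunctor \<open>\<squnion>: \<G>/A \<times> \<G>/B \<rightarrow> \<G>/(A \<squnion> B)\<close>, for \<open>A \<squnion> B = S\<close> with inclusions \<open>i, j\<close>.
  It depends on choices, hence is described by what characterizes its values up to canonical
  isomorphism: \<open>sum_object\<close> says that \<open>w: Z \<rightarrow> S\<close> is a value \<open>u \<squnion> v\<close>, with \<open>Z\<close> the coproduct
  (inclusions \<open>x, y\<close>) of the sources of \<open>u\<close> and \<open>v\<close> and with structure 2-cells
  \<open>\<theta>: w x \<Rightarrow> i u\<close> and \<open>\<kappa>: w y \<Rightarrow> j v\<close>.\<close>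

definition sum_object ::
    "('g, 'c, 'd) two_cat \<Rightarrow> 'c \<Rightarrow> 'c \<Rightarrow> 'c \<Rightarrow> 'c \<Rightarrow> 'c \<Rightarrow> 'c \<Rightarrow> 'c \<Rightarrow> 'd \<Rightarrow> 'd \<Rightarrow> bool"
  where "sum_object \<G> i j u v w x y \<theta> \<kappa> \<longleftrightarrow>
    u \<in> Arr1 \<G> \<and> Trg \<G> u = Src \<G> i \<and> v \<in> Arr1 \<G> \<and> Trg \<G> v = Src \<G> j \<and>
    w \<in> Arr1 \<G> \<and> Trg \<G> w = Trg \<G> i \<and>
    binary_coproduct \<G> (Src \<G> u) (Src \<G> v) (Src \<G> w) x y \<and>
    \<theta> \<in> hom2 \<G> (Comp1 \<G> w x) (Comp1 \<G> i u) \<and> iso_arrow (hom_cat \<G> (Src \<G> u) (Trg \<G> i)) \<theta> \<and>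
    \<kappa> \<in> hom2 \<G> (Comp1 \<G> w y) (Comp1 \<G> j v) \<and> iso_arrow (hom_cat \<G> (Src \<G> v) (Trg \<G> i)) \<kappa>"

text \<open>\<open>sum_compatible\<close> is the compatibility, on the first summand, of a slice 1-cell \<open>(h, \<chi>): w \<rightarrow> w'\<close>
  with \<open>(f, \<phi>): u \<rightarrow> u'\<close> along \<open>\<sigma>: h x \<Rightarrow> x' f\<close>:
  the composites \<open>w x \<Rightarrow> w' h x \<Rightarrow> w' x' f \<Rightarrow> i u' f\<close> and \<open>w x \<Rightarrow> i u \<Rightarrow> i u' f\<close> agree.\<close>

definition sum_compatible ::
    "('g, 'c, 'd) two_cat \<Rightarrow> 'c \<Rightarrow> 'c \<Rightarrow> 'd \<Rightarrow> 'c \<Rightarrow> 'd \<Rightarrow> ('c, 'd) slice1 \<Rightarrow> ('c, 'd) slice1 \<Rightarrow> 'd \<Rightarrow> bool"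
  where "sum_compatible \<G> i x \<theta> x' \<theta>' = (\<lambda>(u, (f, \<phi>), u') (w, (h, \<chi>), w') \<sigma>.
    \<sigma> \<in> hom2 \<G> (Comp1 \<G> h x) (Comp1 \<G> x' f) \<and>
    iso_arrow (hom_cat \<G> (Src \<G> x) (Trg \<G> x')) \<sigma> \<and>
    VComp \<G> (HComp \<G> \<theta>' (Id2 \<G> f)) (VComp \<G> (HComp \<G> (Id2 \<G> w') \<sigma>) (HComp \<G> \<chi> (Id2 \<G> x))) =
    VComp \<G> (HComp \<G> (Id2 \<G> i) \<phi>) \<theta>)"

definition sum_natural ::
    "('g, 'c, 'd) two_cat \<Rightarrow> 'c \<Rightarrow> 'c \<Rightarrow> ('c, 'd) slice2 \<Rightarrow> ('c, 'd) slice2 \<Rightarrow> 'd \<Rightarrow> 'd \<Rightarrow> bool"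
  where "sum_natural \<G> x x' = (\<lambda>(_, \<alpha>, _) (_, \<xi>, _) \<sigma> \<sigma>'.
    VComp \<G> \<sigma>' (HComp \<G> \<xi> (Id2 \<G> x)) = VComp \<G> (HComp \<G> (Id2 \<G> x') \<alpha>) \<sigma>)"

text \<open>\<open>\<Phi>\<close> is the action \<open>\<G>/A(u, u') \<times> \<G>/B(v, v') \<rightarrow> \<G>/S(u \<squnion> v, u' \<squnion> v')\<close> of \<open>\<squnion>\<close> on Hom categories.\<close>

definition sum_hom_functor ::
    "('g, 'c, 'd) two_cat \<Rightarrow> 'c \<Rightarrow> 'c \<Rightarrow>
     'c \<Rightarrow> 'c \<Rightarrow> 'c \<Rightarrow> 'c \<Rightarrow> 'c \<Rightarrow> 'd \<Rightarrow> 'd \<Rightarrow> 'c \<Rightarrow> 'c \<Rightarrow> 'c \<Rightarrow> 'c \<Rightarrow> 'c \<Rightarrow> 'd \<Rightarrow> 'd \<Rightarrow>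
     (('c, 'd) slice1 \<times> ('c, 'd) slice1, ('c, 'd) slice2 \<times> ('c, 'd) slice2,
      ('c, 'd) slice1, ('c, 'd) slice2) ftor \<Rightarrow> bool"
  where "sum_hom_functor \<G> i j u v w x y \<theta> \<kappa> u' v' w' x' y' \<theta>' \<kappa>' \<Phi> \<longleftrightarrow>
    (let HomA = hom_cat (slice \<G> (Src \<G> i)) u u';
         HomB = hom_cat (slice \<G> (Src \<G> j)) v v';
         HomS = hom_cat (slice \<G> (Trg \<G> i)) w w'
     in is_functor (prod_cat HomA HomB) HomS \<Phi> \<and>
        (\<exists>\<sigma> \<tau>.
          (\<forall>m \<in> obj HomA. \<forall>n \<in> obj HomB.
             sum_compatible \<G> i x \<theta> x' \<theta>' m (fob \<Phi> (m, n)) (\<sigma> (m, n)) \<and>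
             sum_compatible \<G> j y \<kappa> y' \<kappa>' n (fob \<Phi> (m, n)) (\<tau> (m, n))) \<and>
          (\<forall>a \<in> arr HomA. \<forall>b \<in> arr HomB.
             sum_natural \<G> x x' a (fmor \<Phi> (a, b)) (\<sigma> (cdom HomA a, cdom HomB b)) (\<sigma> (ccod HomA a, ccod HomB b)) \<and>
             sum_natural \<G> y y' b (fmor \<Phi> (a, b)) (\<tau> (cdom HomA a, cdom HomB b)) (\<tau> (ccod HomA a, ccod HomB b)))))"

text \<open>The pseudofunctor \<open>\<squnion>\<close> is a biequivalence: surjective on objects up to equivalence in
  \<open>\<G>/S\<close>, and an equivalence on Hom categories.\<close>

definition extensive :: "('g, 'c, 'd) two_cat \<Rightarrow> bool"
  where "extensive \<G> \<longleftrightarrow>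
    has_finite_coproducts \<G> \<and>
    (\<forall>A B S i j. binary_coproduct \<G> A B S i j \<longrightarrow>
      (\<forall>z \<in> Ob (slice \<G> S). \<exists>u v w x y \<theta> \<kappa>. sum_object \<G> i j u v w x y \<theta> \<kappa> \<and>
         (\<exists>e \<in> hom1 (slice \<G> S) w z. equivalence1 (slice \<G> S) e)) \<and>
      (\<forall>u v w x y \<theta> \<kappa> u' v' w' x' y' \<theta>' \<kappa>'.
         sum_object \<G> i j u v w x y \<theta> \<kappa> \<longrightarrow> sum_object \<G> i j u' v' w' x' y' \<theta>' \<kappa>' \<longrightarrow>
         (\<exists>\<Phi>. sum_hom_functor \<G> i j u v w x y \<theta> \<kappa> u' v' w' x' y' \<theta>' \<kappa>' \<Phi> \<and>
              is_equivalence
                (prod_cat (hom_cat (slice \<G> A) u u') (hom_cat (slice \<G> B) v v'))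
                (hom_cat (slice \<G> S) w w') \<Phi>)))"

text \<open>A 2-full 2-subcategory containing all equivalences is given by its set \<open>J\<close> of 1-cells.
  In \<open>family_iff\<close>, \<open>w\<close> is the 1-cell (determined up to isomorphism) induced by the family \<open>us\<close>.\<close>

locale spannable_pair = two_one_category \<G> for \<G> :: "('g, 'c, 'd) two_cat" +
  fixes J :: "'c set"
  assumes extensive: "extensive \<G>"
    and J_subset: "J \<subseteq> Arr1 \<G>"
    and J_comp: "\<lbrakk>u \<in> J; v \<in> J; Src \<G> u = Trg \<G> v\<rbrakk> \<Longrightarrow> Comp1 \<G> u v \<in> J"
    and J_equivalence: "equivalence1 \<G> e \<Longrightarrow> e \<in> J"
    and J_isomorphic: "\<lbrakk>u \<in> J; isomorphic1 \<G> u v\<rbrakk> \<Longrightarrow> v \<in> J"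
    and J_pullback: "\<lbrakk>i \<in> J; u \<in> Arr1 \<G>; Trg \<G> i = Trg \<G> u\<rbrakk>
      \<Longrightarrow> \<exists>p q \<gamma>. pseudopullback \<G> i u p q \<gamma> \<and> q \<in> J"
    and family_iff: "\<lbrakk>coproduct \<G> {..<n} Hs S incl; \<And>l. l < n \<Longrightarrow> us l \<in> hom1 \<G> (Hs l) G;
        w \<in> hom1 \<G> S G; \<And>l. l < n \<Longrightarrow> isomorphic1 \<G> (Comp1 \<G> w (incl l)) (us l)\<rbrakk>
      \<Longrightarrow> w \<in> J \<longleftrightarrow> (\<forall>l < n. us l \<in> J)"

definition mackey_square ::
    "('g, 'c, 'd) two_cat \<Rightarrow> 'c set \<Rightarrow> 'c \<Rightarrow> 'c \<Rightarrow> 'c \<Rightarrow> 'c \<Rightarrow> 'd \<Rightarrow> bool"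
  where "mackey_square \<G> J i u p q \<gamma> \<longleftrightarrow> pseudopullback \<G> i u p q \<gamma> \<and> i \<in> J \<and> q \<in> J"


section \<open>Rectified Mackey 2-functors\<close>

record ('g, 'c, 'd, 'k, 'o, 'm) two_ftor =
  Cat :: "'g \<Rightarrow> ('k, 'o, 'm) lin_cat"
  Pull :: "'c \<Rightarrow> ('o, 'm, 'o, 'm) ftor"
  Pull2 :: "'d \<Rightarrow> 'o \<Rightarrow> 'm"

abbreviation pullo :: "('g, 'c, 'd, 'k, 'o, 'm, 'z) two_ftor_scheme \<Rightarrow> 'c \<Rightarrow> 'o \<Rightarrow> 'o"
  where "pullo M u \<equiv> fob (Pull M u)"
abbreviation pullm :: "('g, 'c, 'd, 'k, 'o, 'm, 'z) two_ftor_scheme \<Rightarrow> 'c \<Rightarrow> 'm \<Rightarrow> 'm"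
  where "pullm M u \<equiv> fmor (Pull M u)"

text \<open>Strict 2-functors from \<open>\<G>\<close>, with 1-cells reversed, to the ambient 2-category. All categories
  \<open>Cat M G\<close> share one type of objects and one of arrows; this is no restriction, since a family of
  categories can always be tagged into such types.\<close>

locale two_functor =
  fixes \<AA> :: ambient and R :: "('k, 'r) ring_scheme"
    and \<G> :: "('g, 'c, 'd) two_cat"
    and M :: "('g, 'c, 'd, 'k, 'o, 'm, 'z) two_ftor_scheme"
  assumes cat_in_ambient: "G \<in> Ob \<G> \<Longrightarrow> in_ambient \<AA> R (Cat M G)"
    and pull_functor: "u \<in> hom1 \<G> H G \<Longrightarrow> linear_functor R (Cat M G) (Cat M H) (Pull M u)"
    and pull2_nat: "\<lbrakk>u \<in> hom1 \<G> H G; \<alpha> \<in> hom2 \<G> u v\<rbrakk>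
      \<Longrightarrow> nat_trans (Cat M G) (Cat M H) (Pull M u) (Pull M v) (Pull2 M \<alpha>)"
    and pull_unit_obj: "\<lbrakk>G \<in> Ob \<G>; X \<in> obj (Cat M G)\<rbrakk> \<Longrightarrow> pullo M (Unit1 \<G> G) X = X"
    and pull_unit_arr: "\<lbrakk>G \<in> Ob \<G>; f \<in> arr (Cat M G)\<rbrakk> \<Longrightarrow> pullm M (Unit1 \<G> G) f = f"
    and pull_comp_obj: "\<lbrakk>u \<in> hom1 \<G> H G; v \<in> hom1 \<G> K H; X \<in> obj (Cat M G)\<rbrakk>
      \<Longrightarrow> pullo M (Comp1 \<G> u v) X = pullo M v (pullo M u X)"
    and pull_comp_arr: "\<lbrakk>u \<in> hom1 \<G> H G; v \<in> hom1 \<G> K H; f \<in> arr (Cat M G)\<rbrakk>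
      \<Longrightarrow> pullm M (Comp1 \<G> u v) f = pullm M v (pullm M u f)"
    and pull2_id: "\<lbrakk>u \<in> hom1 \<G> H G; X \<in> obj (Cat M G)\<rbrakk>
      \<Longrightarrow> Pull2 M (Id2 \<G> u) X = cid (Cat M H) (pullo M u X)"
    and pull2_vcomp: "\<lbrakk>u \<in> hom1 \<G> H G; \<alpha> \<in> hom2 \<G> u v; \<beta> \<in> hom2 \<G> v w; X \<in> obj (Cat M G)\<rbrakk>
      \<Longrightarrow> Pull2 M (VComp \<G> \<beta> \<alpha>) X = Pull2 M \<beta> X \<cdot>\<^bsub>Cat M H\<^esub> Pull2 M \<alpha> X"
    and pull2_hcomp: "\<lbrakk>u \<in> hom1 \<G> H G; \<alpha> \<in> hom2 \<G> u u'; v \<in> hom1 \<G> K H; \<beta> \<in> hom2 \<G> v v';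
        X \<in> obj (Cat M G)\<rbrakk>
      \<Longrightarrow> Pull2 M (HComp \<G> \<alpha> \<beta>) X
          = Pull2 M \<beta> (pullo M u' X) \<cdot>\<^bsub>Cat M K\<^esub> pullm M v (Pull2 M \<alpha> X)"

text \<open>For \<open>i \<in> J\<close>, \<open>Push M i\<close> is the common functor \<open>i\<^sub>! = i\<^sub>*\<close>; \<open>leta\<close>, \<open>leps\<close> are unit and counit of
  \<open>i\<^sub>! \<stileturn> i\<^sup>*\<close>, and \<open>reta\<close>, \<open>reps\<close> those of \<open>i\<^sup>* \<stileturn> i\<^sub>*\<close>.\<close>

record ('g, 'c, 'd, 'k, 'o, 'm) mackey2 = "('g, 'c, 'd, 'k, 'o, 'm) two_ftor" +
  Push :: "'c \<Rightarrow> ('o, 'm, 'o, 'm) ftor"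
  leta :: "'c \<Rightarrow> 'o \<Rightarrow> 'm"
  leps :: "'c \<Rightarrow> 'o \<Rightarrow> 'm"
  reta :: "'c \<Rightarrow> 'o \<Rightarrow> 'm"
  reps :: "'c \<Rightarrow> 'o \<Rightarrow> 'm"

abbreviation pusho :: "('g, 'c, 'd, 'k, 'o, 'm, 'z) mackey2_scheme \<Rightarrow> 'c \<Rightarrow> 'o \<Rightarrow> 'o"
  where "pusho M u \<equiv> fob (Push M u)"
abbreviation pushm :: "('g, 'c, 'd, 'k, 'o, 'm, 'z) mackey2_scheme \<Rightarrow> 'c \<Rightarrow> 'm \<Rightarrow> 'm"
  where "pushm M u \<equiv> fmor (Push M u)"

text \<open>The component at \<open>Y\<close> of the mate \<open>\<gamma>\<^sub>!: q\<^sub>! p\<^sup>* \<Rightarrow> u\<^sup>* i\<^sub>!\<close> of \<open>\<gamma>: i p \<Rightarrow> u q\<close>, and of the mate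
  \<open>\<delta>\<^sub>*: u\<^sup>* i\<^sub>* \<Rightarrow> q\<^sub>* p\<^sup>*\<close> of \<open>\<delta>: u q \<Rightarrow> i p\<close>.\<close>

definition mate_l ::
    "('g, 'c, 'd) two_cat \<Rightarrow> ('g, 'c, 'd, 'k, 'o, 'm, 'z) mackey2_scheme \<Rightarrow>
     'c \<Rightarrow> 'c \<Rightarrow> 'c \<Rightarrow> 'c \<Rightarrow> 'd \<Rightarrow> 'o \<Rightarrow> 'm"
  where "mate_l \<G> M i u p q \<gamma> Y = (let C = Cat M (Trg \<G> q) in
    leps M q (pullo M u (pusho M i Y)) \<cdot>\<^bsub>C\<^esub>
    pushm M q (Pull2 M \<gamma> (pusho M i Y)) \<cdot>\<^bsub>C\<^esub>
    pushm M q (pullm M p (leta M i Y)))"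

definition mate_r ::
    "('g, 'c, 'd) two_cat \<Rightarrow> ('g, 'c, 'd, 'k, 'o, 'm, 'z) mackey2_scheme \<Rightarrow>
     'c \<Rightarrow> 'c \<Rightarrow> 'c \<Rightarrow> 'c \<Rightarrow> 'd \<Rightarrow> 'o \<Rightarrow> 'm"
  where "mate_r \<G> M i u p q \<delta> Y = (let C = Cat M (Trg \<G> q) in
    pushm M q (pullm M p (reps M i Y)) \<cdot>\<^bsub>C\<^esub>
    pushm M q (Pull2 M \<delta> (pusho M i Y)) \<cdot>\<^bsub>C\<^esub>
    reta M q (pullo M u (pusho M i Y)))"

text \<open>The pseudofunctors \<open>i \<mapsto> i\<^sub>!\<close> and \<open>i \<mapsto> i\<^sub>*\<close> have as further data the mates
  \<open>\<alpha>\<^sub>!, \<alpha>\<^sub>*: j\<^sub>! \<Rightarrow> i\<^sub>!\<close> of \<open>\<alpha>: i \<Rightarrow> j\<close>, the isomorphisms \<open>u\<^sub>! v\<^sub>! \<Rightarrow> (u v)\<^sub>!\<close> and \<open>u\<^sub>* v\<^sub>* \<Rightarrow> (u v)\<^sub>*\<close> given by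
  uniqueness of adjoints, and the isomorphisms \<open>Id \<Rightarrow> Id\<^sub>!\<close> and \<open>Id \<Rightarrow> Id\<^sub>*\<close>, which are the units
  \<open>leta\<close> and \<open>reta\<close> at the identity 1-cell because \<open>Id\<^sup>* = Id\<close>.\<close>

definition push2_l ::
    "('g, 'c, 'd) two_cat \<Rightarrow> ('g, 'c, 'd, 'k, 'o, 'm, 'z) mackey2_scheme \<Rightarrow> 'd \<Rightarrow> 'o \<Rightarrow> 'm"
  where "push2_l \<G> M \<alpha> Y = (let i = Src2 \<G> \<alpha>; j = Trg2 \<G> \<alpha>; C = Cat M (Trg \<G> i) in
    leps M j (pusho M i Y) \<cdot>\<^bsub>C\<^esub> pushm M j (Pull2 M \<alpha> (pusho M i Y)) \<cdot>\<^bsub>C\<^esub> pushm M j (leta M i Y))"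

definition push2_r ::
    "('g, 'c, 'd) two_cat \<Rightarrow> ('g, 'c, 'd, 'k, 'o, 'm, 'z) mackey2_scheme \<Rightarrow> 'd \<Rightarrow> 'o \<Rightarrow> 'm"
  where "push2_r \<G> M \<alpha> Y = (let i = Src2 \<G> \<alpha>; j = Trg2 \<G> \<alpha>; C = Cat M (Trg \<G> i) in
    pushm M i (reps M j Y) \<cdot>\<^bsub>C\<^esub> pushm M i (Pull2 M \<alpha> (pusho M j Y)) \<cdot>\<^bsub>C\<^esub> reta M i (pusho M j Y))"

definition push_comp_l ::
    "('g, 'c, 'd) two_cat \<Rightarrow> ('g, 'c, 'd, 'k, 'o, 'm, 'z) mackey2_scheme \<Rightarrow> 'c \<Rightarrow> 'c \<Rightarrow> 'o \<Rightarrow> 'm"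
  where "push_comp_l \<G> M u v Y = (let w = Comp1 \<G> u v; C = Cat M (Trg \<G> u) in
    leps M u (pusho M w Y) \<cdot>\<^bsub>C\<^esub>
    pushm M u (leps M v (pullo M u (pusho M w Y))) \<cdot>\<^bsub>C\<^esub>
    pushm M u (pushm M v (leta M w Y)))"

definition push_comp_r ::
    "('g, 'c, 'd) two_cat \<Rightarrow> ('g, 'c, 'd, 'k, 'o, 'm, 'z) mackey2_scheme \<Rightarrow> 'c \<Rightarrow> 'c \<Rightarrow> 'o \<Rightarrow> 'm"
  where "push_comp_r \<G> M u v Y = (let w = Comp1 \<G> u v; C = Cat M (Trg \<G> u) in
    pushm M w (reps M v Y) \<cdot>\<^bsub>C\<^esub>
    pushm M w (pullm M v (reps M u (pusho M v Y))) \<cdot>\<^bsub>C\<^esub>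
    reta M w (pusho M u (pusho M v Y)))"

text \<open>Existence of both adjoints and their isomorphism is witnessed by the chosen data.
  Invertibility of the mates and \<open>(\<gamma>\<^sub>!)\<^sup>-\<^sup>1 = (\<gamma>\<^sup>-\<^sup>1)\<^sub>*\<close> are together expressed by \<open>mackey_formula\<close>.\<close>

locale rectified_mackey_2functor = two_functor \<AA> R \<G> M
  for \<AA> :: ambient and R :: "('k, 'r) ring_scheme" and \<G> :: "('g, 'c, 'd) two_cat"
    and M :: "('g, 'c, 'd, 'k, 'o, 'm, 'z) mackey2_scheme" +
  fixes J :: "'c set"
  assumes additivity: "coproduct \<G> {..<n} Hs S incl \<Longrightarrow>
      is_equivalence (Cat M S) (pi_cat {..<n} (\<lambda>l. Cat M (Hs l)))
        \<lparr>fob = (\<lambda>X. \<lambda>l \<in> {..<n}. pullo M (incl l) X),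
         fmor = (\<lambda>f. \<lambda>l \<in> {..<n}. pullm M (incl l) f)\<rparr>"
    and push_functor: "\<lbrakk>i \<in> J; i \<in> hom1 \<G> H G\<rbrakk> \<Longrightarrow> linear_functor R (Cat M H) (Cat M G) (Push M i)"
    and left_adjunction: "\<lbrakk>i \<in> J; i \<in> hom1 \<G> H G\<rbrakk>
      \<Longrightarrow> adjunction (Cat M H) (Cat M G) (Push M i) (Pull M i) (leta M i) (leps M i)"
    and right_adjunction: "\<lbrakk>i \<in> J; i \<in> hom1 \<G> H G\<rbrakk>
      \<Longrightarrow> adjunction (Cat M G) (Cat M H) (Pull M i) (Push M i) (reta M i) (reps M i)"
    and mackey_formula: "\<lbrakk>mackey_square \<G> J i u p q \<gamma>; Y \<in> obj (Cat M (Src \<G> i))\<rbrakk>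
      \<Longrightarrow> inverse_arrows (Cat M (Trg \<G> q)) (mate_l \<G> M i u p q \<gamma> Y)
            (mate_r \<G> M i u p q (inverse2 \<G> \<gamma>) Y)"
    and push2_eq: "\<lbrakk>i \<in> J; j \<in> J; \<alpha> \<in> hom2 \<G> i j; Y \<in> obj (Cat M (Src \<G> i))\<rbrakk>
      \<Longrightarrow> push2_l \<G> M \<alpha> Y = push2_r \<G> M \<alpha> Y"
    and push_comp_eq: "\<lbrakk>u \<in> J; v \<in> J; Src \<G> u = Trg \<G> v; Y \<in> obj (Cat M (Src \<G> v))\<rbrakk>
      \<Longrightarrow> push_comp_l \<G> M u v Y = push_comp_r \<G> M u v Y"
    and push_unit_eq: "\<lbrakk>G \<in> Ob \<G>; Y \<in> obj (Cat M G)\<rbrakk>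
      \<Longrightarrow> leta M (Unit1 \<G> G) Y = reta M (Unit1 \<G> G) Y"
    and special_frobenius: "\<lbrakk>i \<in> J; Y \<in> obj (Cat M (Src \<G> i))\<rbrakk>
      \<Longrightarrow> reps M i Y \<cdot>\<^bsub>Cat M (Src \<G> i)\<^esub> leta M i Y = cid (Cat M (Src \<G> i)) Y"


section \<open>Monoidal categories and Green 2-functors\<close>

record ('o, 'm) tensor =
  tob :: "'o \<Rightarrow> 'o \<Rightarrow> 'o"  (infixr \<open>\<boxtimes>\<index>\<close> 73)
  tarr :: "'m \<Rightarrow> 'm \<Rightarrow> 'm"  (infixr \<open>\<boxdot>\<index>\<close> 73)
  tunit :: 'o
  tassoc :: "'o \<Rightarrow> 'o \<Rightarrow> 'o \<Rightarrow> 'm"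
  tlunit :: "'o \<Rightarrow> 'm"
  trunit :: "'o \<Rightarrow> 'm"

locale linear_monoidal_category =
  fixes R :: "('k, 'r) ring_scheme" and C :: "('k, 'o, 'm) lin_cat" and T :: "('o, 'm) tensor"
  assumes linear_category: "linear_category R C"
    and tensor_obj: "\<lbrakk>x \<in> obj C; y \<in> obj C\<rbrakk> \<Longrightarrow> x \<boxtimes>\<^bsub>T\<^esub> y \<in> obj C"
    and tensor_unit: "tunit T \<in> obj C"
    and tensor_bilinear: "\<lbrakk>x \<in> obj C; x' \<in> obj C; y \<in> obj C; y' \<in> obj C\<rbrakk>
      \<Longrightarrow> bilinear_map R (hmod C x x') (hmod C y y') (hmod C (x \<boxtimes>\<^bsub>T\<^esub> y) (x' \<boxtimes>\<^bsub>T\<^esub> y')) (tarr T)"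
    and tensor_id: "\<lbrakk>x \<in> obj C; y \<in> obj C\<rbrakk> \<Longrightarrow> cid C x \<boxdot>\<^bsub>T\<^esub> cid C y = cid C (x \<boxtimes>\<^bsub>T\<^esub> y)"
    and tensor_comp: "\<lbrakk>f \<in> chom C x x'; f' \<in> chom C x' x''; g \<in> chom C y y'; g' \<in> chom C y' y''\<rbrakk>
      \<Longrightarrow> (f' \<cdot>\<^bsub>C\<^esub> f) \<boxdot>\<^bsub>T\<^esub> (g' \<cdot>\<^bsub>C\<^esub> g) = (f' \<boxdot>\<^bsub>T\<^esub> g') \<cdot>\<^bsub>C\<^esub> (f \<boxdot>\<^bsub>T\<^esub> g)"
    and assoc_iso: "\<lbrakk>x \<in> obj C; y \<in> obj C; z \<in> obj C\<rbrakk>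
      \<Longrightarrow> tassoc T x y z \<in> chom C ((x \<boxtimes>\<^bsub>T\<^esub> y) \<boxtimes>\<^bsub>T\<^esub> z) (x \<boxtimes>\<^bsub>T\<^esub> (y \<boxtimes>\<^bsub>T\<^esub> z)) \<and> iso_arrow C (tassoc T x y z)"
    and assoc_natural: "\<lbrakk>f \<in> chom C x x'; g \<in> chom C y y'; h \<in> chom C z z'\<rbrakk>
      \<Longrightarrow> tassoc T x' y' z' \<cdot>\<^bsub>C\<^esub> ((f \<boxdot>\<^bsub>T\<^esub> g) \<boxdot>\<^bsub>T\<^esub> h) = (f \<boxdot>\<^bsub>T\<^esub> (g \<boxdot>\<^bsub>T\<^esub> h)) \<cdot>\<^bsub>C\<^esub> tassoc T x y z"
    and lunit_iso: "x \<in> obj C \<Longrightarrow> tlunit T x \<in> chom C (tunit T \<boxtimes>\<^bsub>T\<^esub> x) x \<and> iso_arrow C (tlunit T x)"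
    and lunit_natural: "f \<in> chom C x x'
      \<Longrightarrow> tlunit T x' \<cdot>\<^bsub>C\<^esub> (cid C (tunit T) \<boxdot>\<^bsub>T\<^esub> f) = f \<cdot>\<^bsub>C\<^esub> tlunit T x"
    and runit_iso: "x \<in> obj C \<Longrightarrow> trunit T x \<in> chom C (x \<boxtimes>\<^bsub>T\<^esub> tunit T) x \<and> iso_arrow C (trunit T x)"
    and runit_natural: "f \<in> chom C x x'
      \<Longrightarrow> trunit T x' \<cdot>\<^bsub>C\<^esub> (f \<boxdot>\<^bsub>T\<^esub> cid C (tunit T)) = f \<cdot>\<^bsub>C\<^esub> trunit T x"
    and pentagon: "\<lbrakk>w \<in> obj C; x \<in> obj C; y \<in> obj C; z \<in> obj C\<rbrakk>
      \<Longrightarrow> (cid C w \<boxdot>\<^bsub>T\<^esub> tassoc T x y z) \<cdot>\<^bsub>C\<^esub> tassoc T w (x \<boxtimes>\<^bsub>T\<^esub> y) z \<cdot>\<^bsub>C\<^esub> (tassoc T w x y \<boxdot>\<^bsub>T\<^esub> cid C z)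
          = tassoc T w x (y \<boxtimes>\<^bsub>T\<^esub> z) \<cdot>\<^bsub>C\<^esub> tassoc T (w \<boxtimes>\<^bsub>T\<^esub> x) y z"
    and triangle: "\<lbrakk>x \<in> obj C; y \<in> obj C\<rbrakk>
      \<Longrightarrow> (cid C x \<boxdot>\<^bsub>T\<^esub> tlunit T y) \<cdot>\<^bsub>C\<^esub> tassoc T x (tunit T) y = trunit T x \<boxdot>\<^bsub>T\<^esub> cid C y"

text \<open>The structure isomorphisms of a strong monoidal functor \<open>F\<close> are directed as
  \<open>\<phi> x y: F (x \<boxtimes> y) \<rightarrow> F x \<boxtimes> F y\<close> and \<open>\<upsilon>: F 1 \<rightarrow> 1\<close>.\<close>

locale strong_monoidal_functor =
  fixes C :: "('o, 'm, 'y) cat_scheme" and S :: "('o, 'm) tensor"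
    and D :: "('p, 'n, 'z) cat_scheme" and T :: "('p, 'n) tensor"
    and F :: "('o, 'm, 'p, 'n) ftor" and \<phi> :: "'o \<Rightarrow> 'o \<Rightarrow> 'n" and \<upsilon> :: 'n
  assumes "functor": "is_functor C D F"
    and tensor_iso: "\<lbrakk>x \<in> obj C; y \<in> obj C\<rbrakk>
      \<Longrightarrow> \<phi> x y \<in> chom D (fob F (x \<boxtimes>\<^bsub>S\<^esub> y)) (fob F x \<boxtimes>\<^bsub>T\<^esub> fob F y) \<and> iso_arrow D (\<phi> x y)"
    and tensor_natural: "\<lbrakk>f \<in> chom C x x'; g \<in> chom C y y'\<rbrakk>
      \<Longrightarrow> \<phi> x' y' \<cdot>\<^bsub>D\<^esub> fmor F (f \<boxdot>\<^bsub>S\<^esub> g) = (fmor F f \<boxdot>\<^bsub>T\<^esub> fmor F g) \<cdot>\<^bsub>D\<^esub> \<phi> x y"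
    and unit_iso: "\<upsilon> \<in> chom D (fob F (tunit S)) (tunit T) \<and> iso_arrow D \<upsilon>"
    and assoc_coherence: "\<lbrakk>x \<in> obj C; y \<in> obj C; z \<in> obj C\<rbrakk>
      \<Longrightarrow> tassoc T (fob F x) (fob F y) (fob F z) \<cdot>\<^bsub>D\<^esub> (\<phi> x y \<boxdot>\<^bsub>T\<^esub> cid D (fob F z)) \<cdot>\<^bsub>D\<^esub> \<phi> (x \<boxtimes>\<^bsub>S\<^esub> y) z
          = (cid D (fob F x) \<boxdot>\<^bsub>T\<^esub> \<phi> y z) \<cdot>\<^bsub>D\<^esub> \<phi> x (y \<boxtimes>\<^bsub>S\<^esub> z) \<cdot>\<^bsub>D\<^esub> fmor F (tassoc S x y z)"
    and lunit_coherence: "x \<in> obj C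
      \<Longrightarrow> tlunit T (fob F x) \<cdot>\<^bsub>D\<^esub> (\<upsilon> \<boxdot>\<^bsub>T\<^esub> cid D (fob F x)) \<cdot>\<^bsub>D\<^esub> \<phi> (tunit S) x = fmor F (tlunit S x)"
    and runit_coherence: "x \<in> obj C
      \<Longrightarrow> trunit T (fob F x) \<cdot>\<^bsub>D\<^esub> (cid D (fob F x) \<boxdot>\<^bsub>T\<^esub> \<upsilon>) \<cdot>\<^bsub>D\<^esub> \<phi> x (tunit S) = fmor F (trunit S x)"

record ('g, 'c, 'd, 'k, 'o, 'm) green2 = "('g, 'c, 'd, 'k, 'o, 'm) mackey2" +
  Ten :: "'g \<Rightarrow> ('o, 'm) tensor"
  Pten :: "'c \<Rightarrow> 'o \<Rightarrow> 'o \<Rightarrow> 'm"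
  Punit :: "'c \<Rightarrow> 'm"

definition Rp1 ::
    "('g, 'c, 'd) two_cat \<Rightarrow> ('g, 'c, 'd, 'k, 'o, 'm) green2 \<Rightarrow> 'c \<Rightarrow> 'o \<Rightarrow> 'o \<Rightarrow> 'm"
  where "Rp1 \<G> M i X Y = (let H = Src \<G> i; G = Trg \<G> i in
    pushm M i (cid (Cat M H) (pullo M i X) \<boxdot>\<^bsub>Ten M H\<^esub> reps M i Y) \<cdot>\<^bsub>Cat M G\<^esub>
    pushm M i (Pten M i X (pusho M i Y)) \<cdot>\<^bsub>Cat M G\<^esub>
    reta M i (X \<boxtimes>\<^bsub>Ten M G\<^esub> pusho M i Y))"

definition Rp2 ::
    "('g, 'c, 'd) two_cat \<Rightarrow> ('g, 'c, 'd, 'k, 'o, 'm) green2 \<Rightarrow> 'c \<Rightarrow> 'o \<Rightarrow> 'o \<Rightarrow> 'm"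
  where "Rp2 \<G> M i Y X = (let H = Src \<G> i; G = Trg \<G> i in
    pushm M i (reps M i Y \<boxdot>\<^bsub>Ten M H\<^esub> cid (Cat M H) (pullo M i X)) \<cdot>\<^bsub>Cat M G\<^esub>
    pushm M i (Pten M i (pusho M i Y) X) \<cdot>\<^bsub>Cat M G\<^esub>
    reta M i (pusho M i Y \<boxtimes>\<^bsub>Ten M G\<^esub> X))"

definition Lp1 ::
    "('g, 'c, 'd) two_cat \<Rightarrow> ('g, 'c, 'd, 'k, 'o, 'm) green2 \<Rightarrow> 'c \<Rightarrow> 'o \<Rightarrow> 'o \<Rightarrow> 'm"
  where "Lp1 \<G> M i X Y = (let H = Src \<G> i; G = Trg \<G> i in
    leps M i (X \<boxtimes>\<^bsub>Ten M G\<^esub> pusho M i Y) \<cdot>\<^bsub>Cat M G\<^esub>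
    pushm M i (cinv (Cat M H) (Pten M i X (pusho M i Y))) \<cdot>\<^bsub>Cat M G\<^esub>
    pushm M i (cid (Cat M H) (pullo M i X) \<boxdot>\<^bsub>Ten M H\<^esub> leta M i Y))"

definition Lp2 ::
    "('g, 'c, 'd) two_cat \<Rightarrow> ('g, 'c, 'd, 'k, 'o, 'm) green2 \<Rightarrow> 'c \<Rightarrow> 'o \<Rightarrow> 'o \<Rightarrow> 'm"
  where "Lp2 \<G> M i Y X = (let H = Src \<G> i; G = Trg \<G> i in
    leps M i (pusho M i Y \<boxtimes>\<^bsub>Ten M G\<^esub> X) \<cdot>\<^bsub>Cat M G\<^esub>
    pushm M i (cinv (Cat M H) (Pten M i (pusho M i Y) X)) \<cdot>\<^bsub>Cat M G\<^esub>
    pushm M i (leta M i Y \<boxdot>\<^bsub>Ten M H\<^esub> cid (Cat M H) (pullo M i X)))"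

locale green_2functor = rectified_mackey_2functor \<AA> R \<G> M J
  for \<AA> :: ambient and R :: "('k, 'r) ring_scheme" and \<G> :: "('g, 'c, 'd) two_cat"
    and J :: "'c set" and M :: "('g, 'c, 'd, 'k, 'o, 'm) green2" +
  assumes monoidal: "G \<in> Ob \<G> \<Longrightarrow> linear_monoidal_category R (Cat M G) (Ten M G)"
    and pull_monoidal: "u \<in> hom1 \<G> H G
      \<Longrightarrow> strong_monoidal_functor (Cat M G) (Ten M G) (Cat M H) (Ten M H) (Pull M u) (Pten M u) (Punit M u)"
    and pull2_monoidal_tensor: "\<lbrakk>u \<in> hom1 \<G> H G; \<alpha> \<in> hom2 \<G> u v; X \<in> obj (Cat M G); X' \<in> obj (Cat M G)\<rbrakk>
      \<Longrightarrow> (Pull2 M \<alpha> X \<boxdot>\<^bsub>Ten M H\<^esub> Pull2 M \<alpha> X') \<cdot>\<^bsub>Cat M H\<^esub> Pten M u X X'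
          = Pten M v X X' \<cdot>\<^bsub>Cat M H\<^esub> Pull2 M \<alpha> (X \<boxtimes>\<^bsub>Ten M G\<^esub> X')"
    and pull2_monoidal_unit: "\<lbrakk>u \<in> hom1 \<G> H G; \<alpha> \<in> hom2 \<G> u v\<rbrakk>
      \<Longrightarrow> Punit M v \<cdot>\<^bsub>Cat M H\<^esub> Pull2 M \<alpha> (tunit (Ten M G)) = Punit M u"
    and pten_unit: "\<lbrakk>G \<in> Ob \<G>; X \<in> obj (Cat M G); X' \<in> obj (Cat M G)\<rbrakk>
      \<Longrightarrow> Pten M (Unit1 \<G> G) X X' = cid (Cat M G) (X \<boxtimes>\<^bsub>Ten M G\<^esub> X')"
    and punit_unit: "G \<in> Ob \<G> \<Longrightarrow> Punit M (Unit1 \<G> G) = cid (Cat M G) (tunit (Ten M G))"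
    and pten_comp: "\<lbrakk>u \<in> hom1 \<G> H G; v \<in> hom1 \<G> K H; X \<in> obj (Cat M G); X' \<in> obj (Cat M G)\<rbrakk>
      \<Longrightarrow> Pten M (Comp1 \<G> u v) X X'
          = Pten M v (pullo M u X) (pullo M u X') \<cdot>\<^bsub>Cat M K\<^esub> pullm M v (Pten M u X X')"
    and punit_comp: "\<lbrakk>u \<in> hom1 \<G> H G; v \<in> hom1 \<G> K H\<rbrakk>
      \<Longrightarrow> Punit M (Comp1 \<G> u v) = Punit M v \<cdot>\<^bsub>Cat M K\<^esub> pullm M v (Punit M u)"
    and projection1: "\<lbrakk>i \<in> J; X \<in> obj (Cat M (Trg \<G> i)); Y \<in> obj (Cat M (Src \<G> i))\<rbrakk>
      \<Longrightarrow> inverse_arrows (Cat M (Trg \<G> i)) (Rp1 \<G> M i X Y) (Lp1 \<G> M i X Y)"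
    and projection2: "\<lbrakk>i \<in> J; X \<in> obj (Cat M (Trg \<G> i)); Y \<in> obj (Cat M (Src \<G> i))\<rbrakk>
      \<Longrightarrow> inverse_arrows (Cat M (Trg \<G> i)) (Rp2 \<G> M i Y X) (Lp2 \<G> M i Y X)"


section \<open>Ordinary Mackey and Green functors\<close>

record ('g, 'c, 'k, 'a) mackey =
  Val :: "'g \<Rightarrow> ('k, 'a) module"
  Res :: "'c \<Rightarrow> 'a \<Rightarrow> 'a"
  Ind :: "'c \<Rightarrow> 'a \<Rightarrow> 'a"

locale mackey_functor =
  fixes R :: "('k, 'r) ring_scheme" and \<G> :: "('g, 'c, 'd) two_cat" and J :: "'c set"
    and N :: "('g, 'c, 'k, 'a) mackey"
  assumes val_module: "G \<in> Ob \<G> \<Longrightarrow> module R (Val N G)"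
    and res_linear: "u \<in> hom1 \<G> H G \<Longrightarrow> linear_map R (Val N G) (Val N H) (Res N u)"
    and ind_linear: "\<lbrakk>u \<in> J; u \<in> hom1 \<G> H G\<rbrakk> \<Longrightarrow> linear_map R (Val N H) (Val N G) (Ind N u)"
    and res_unit: "\<lbrakk>G \<in> Ob \<G>; x \<in> carrier (Val N G)\<rbrakk> \<Longrightarrow> Res N (Unit1 \<G> G) x = x"
    and ind_unit: "\<lbrakk>G \<in> Ob \<G>; x \<in> carrier (Val N G)\<rbrakk> \<Longrightarrow> Ind N (Unit1 \<G> G) x = x"
    and res_comp: "\<lbrakk>u \<in> hom1 \<G> H G; v \<in> hom1 \<G> K H; x \<in> carrier (Val N G)\<rbrakk>
      \<Longrightarrow> Res N (Comp1 \<G> u v) x = Res N v (Res N u x)"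
    and ind_comp: "\<lbrakk>u \<in> J; v \<in> J; u \<in> hom1 \<G> H G; v \<in> hom1 \<G> K H; x \<in> carrier (Val N K)\<rbrakk>
      \<Longrightarrow> Ind N (Comp1 \<G> u v) x = Ind N u (Ind N v x)"
    and res_isomorphic: "\<lbrakk>u \<in> hom1 \<G> H G; isomorphic1 \<G> u v; x \<in> carrier (Val N G)\<rbrakk>
      \<Longrightarrow> Res N u x = Res N v x"
    and ind_isomorphic: "\<lbrakk>u \<in> J; u \<in> hom1 \<G> H G; isomorphic1 \<G> u v; x \<in> carrier (Val N H)\<rbrakk>
      \<Longrightarrow> Ind N u x = Ind N v x"
    and res_ind_sum: "\<lbrakk>binary_coproduct \<G> G H S i j; x \<in> carrier (Val N G); y \<in> carrier (Val N H)\<rbrakk>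
      \<Longrightarrow> Res N i (Ind N i x \<oplus>\<^bsub>Val N S\<^esub> Ind N j y) = x \<and>
          Res N j (Ind N i x \<oplus>\<^bsub>Val N S\<^esub> Ind N j y) = y"
    and ind_res_sum: "\<lbrakk>binary_coproduct \<G> G H S i j; z \<in> carrier (Val N S)\<rbrakk>
      \<Longrightarrow> Ind N i (Res N i z) \<oplus>\<^bsub>Val N S\<^esub> Ind N j (Res N j z) = z"
    and mackey_formula: "\<lbrakk>mackey_square \<G> J i u p q \<gamma>; x \<in> carrier (Val N (Src \<G> i))\<rbrakk>
      \<Longrightarrow> Res N u (Ind N i x) = Ind N q (Res N p x)"

text \<open>Associative unital, not necessarily commutative algebras (the library's \<^const>\<open>algebra\<close>
  requires commutativity).\<close>

definition assoc_algebra :: "('k, 'r) ring_scheme \<Rightarrow> ('k, 'a, 'z) module_scheme \<Rightarrow> bool"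
  where "assoc_algebra R A \<longleftrightarrow>
    module R A \<and> ring A \<and>
    (\<forall>a \<in> carrier R. \<forall>x \<in> carrier A. \<forall>y \<in> carrier A.
       a \<odot>\<^bsub>A\<^esub> (x \<otimes>\<^bsub>A\<^esub> y) = (a \<odot>\<^bsub>A\<^esub> x) \<otimes>\<^bsub>A\<^esub> y \<and> a \<odot>\<^bsub>A\<^esub> (x \<otimes>\<^bsub>A\<^esub> y) = x \<otimes>\<^bsub>A\<^esub> (a \<odot>\<^bsub>A\<^esub> y))"

locale green_functor = mackey_functor R \<G> J N
  for R :: "('k, 'r) ring_scheme" and \<G> :: "('g, 'c, 'd) two_cat" and J :: "'c set"
    and N :: "('g, 'c, 'k, 'a) mackey" +
  assumes val_algebra: "G \<in> Ob \<G> \<Longrightarrow> assoc_algebra R (Val N G)"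
    and res_mult: "\<lbrakk>u \<in> hom1 \<G> H G; x \<in> carrier (Val N G); y \<in> carrier (Val N G)\<rbrakk>
      \<Longrightarrow> Res N u (x \<otimes>\<^bsub>Val N G\<^esub> y) = Res N u x \<otimes>\<^bsub>Val N H\<^esub> Res N u y"
    and frobenius_left: "\<lbrakk>u \<in> J; u \<in> hom1 \<G> H G; x \<in> carrier (Val N G); y \<in> carrier (Val N H)\<rbrakk>
      \<Longrightarrow> x \<otimes>\<^bsub>Val N G\<^esub> Ind N u y = Ind N u (Res N u x \<otimes>\<^bsub>Val N H\<^esub> y)"
    and frobenius_right: "\<lbrakk>u \<in> J; u \<in> hom1 \<G> H G; x \<in> carrier (Val N G); y \<in> carrier (Val N H)\<rbrakk>
      \<Longrightarrow> Ind N u y \<otimes>\<^bsub>Val N G\<^esub> x = Ind N u (y \<otimes>\<^bsub>Val N H\<^esub> Res N u x)"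

locale left_green_module = A: green_functor R \<G> J A + N: mackey_functor R \<G> J N
  for R :: "('k, 'r) ring_scheme" and \<G> :: "('g, 'c, 'd) two_cat" and J :: "'c set"
    and A :: "('g, 'c, 'k, 'a) mackey" and N :: "('g, 'c, 'k, 'b) mackey" +
  fixes act :: "'g \<Rightarrow> 'a \<Rightarrow> 'b \<Rightarrow> 'b"
  assumes act_bilinear: "G \<in> Ob \<G> \<Longrightarrow> bilinear_map R (Val A G) (Val N G) (Val N G) (act G)"
    and act_mult: "\<lbrakk>G \<in> Ob \<G>; x \<in> carrier (Val A G); x' \<in> carrier (Val A G); y \<in> carrier (Val N G)\<rbrakk>
      \<Longrightarrow> act G (x \<otimes>\<^bsub>Val A G\<^esub> x') y = act G x (act G x' y)"
    and act_one: "\<lbrakk>G \<in> Ob \<G>; y \<in> carrier (Val N G)\<rbrakk> \<Longrightarrow> act G \<one>\<^bsub>Val A G\<^esub> y = y"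
    and res_act: "\<lbrakk>u \<in> hom1 \<G> H G; x \<in> carrier (Val A G); y \<in> carrier (Val N G)\<rbrakk>
      \<Longrightarrow> Res N u (act G x y) = act H (Res A u x) (Res N u y)"
    and act_ind: "\<lbrakk>u \<in> J; u \<in> hom1 \<G> H G; x \<in> carrier (Val A G); y \<in> carrier (Val N H)\<rbrakk>
      \<Longrightarrow> act G x (Ind N u y) = Ind N u (act H (Res A u x) y)"
    and ind_act: "\<lbrakk>u \<in> J; u \<in> hom1 \<G> H G; x \<in> carrier (Val A H); y \<in> carrier (Val N G)\<rbrakk>
      \<Longrightarrow> act G (Ind A u x) y = Ind N u (act H x (Res N u y))"

locale right_green_module = A: green_functor R \<G> J A + N: mackey_functor R \<G> J N
  for R :: "('k, 'r) ring_scheme" and \<G> :: "('g, 'c, 'd) two_cat" and J :: "'c set"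
    and A :: "('g, 'c, 'k, 'a) mackey" and N :: "('g, 'c, 'k, 'b) mackey" +
  fixes act :: "'g \<Rightarrow> 'b \<Rightarrow> 'a \<Rightarrow> 'b"
  assumes act_bilinear: "G \<in> Ob \<G> \<Longrightarrow> bilinear_map R (Val N G) (Val A G) (Val N G) (act G)"
    and act_mult: "\<lbrakk>G \<in> Ob \<G>; x \<in> carrier (Val A G); x' \<in> carrier (Val A G); y \<in> carrier (Val N G)\<rbrakk>
      \<Longrightarrow> act G y (x \<otimes>\<^bsub>Val A G\<^esub> x') = act G (act G y x) x'"
    and act_one: "\<lbrakk>G \<in> Ob \<G>; y \<in> carrier (Val N G)\<rbrakk> \<Longrightarrow> act G y \<one>\<^bsub>Val A G\<^esub> = y"
    and res_act: "\<lbrakk>u \<in> hom1 \<G> H G; x \<in> carrier (Val A G); y \<in> carrier (Val N G)\<rbrakk>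
      \<Longrightarrow> Res N u (act G y x) = act H (Res N u y) (Res A u x)"
    and ind_act: "\<lbrakk>u \<in> J; u \<in> hom1 \<G> H G; x \<in> carrier (Val A G); y \<in> carrier (Val N H)\<rbrakk>
      \<Longrightarrow> act G (Ind N u y) x = Ind N u (act H y (Res A u x))"
    and act_ind: "\<lbrakk>u \<in> J; u \<in> hom1 \<G> H G; x \<in> carrier (Val A H); y \<in> carrier (Val N G)\<rbrakk>
      \<Longrightarrow> act G y (Ind A u x) = Ind N u (act H (Res N u y) x)"


section \<open>Monoids, comonoids, modules and comodules in a monoidal category\<close>

definition is_monoid ::
    "('o, 'm, 'z) cat_scheme \<Rightarrow> ('o, 'm) tensor \<Rightarrow> 'o \<Rightarrow> 'm \<Rightarrow> 'm \<Rightarrow> bool"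
  where "is_monoid C T Y \<mu> \<iota> \<longleftrightarrow>
    Y \<in> obj C \<and> \<mu> \<in> chom C (Y \<boxtimes>\<^bsub>T\<^esub> Y) Y \<and> \<iota> \<in> chom C (tunit T) Y \<and>
    \<mu> \<cdot>\<^bsub>C\<^esub> (\<mu> \<boxdot>\<^bsub>T\<^esub> cid C Y) = \<mu> \<cdot>\<^bsub>C\<^esub> (cid C Y \<boxdot>\<^bsub>T\<^esub> \<mu>) \<cdot>\<^bsub>C\<^esub> tassoc T Y Y Y \<and>
    \<mu> \<cdot>\<^bsub>C\<^esub> (\<iota> \<boxdot>\<^bsub>T\<^esub> cid C Y) = tlunit T Y \<and> \<mu> \<cdot>\<^bsub>C\<^esub> (cid C Y \<boxdot>\<^bsub>T\<^esub> \<iota>) = trunit T Y"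

definition is_comonoid ::
    "('o, 'm, 'z) cat_scheme \<Rightarrow> ('o, 'm) tensor \<Rightarrow> 'o \<Rightarrow> 'm \<Rightarrow> 'm \<Rightarrow> bool"
  where "is_comonoid C T X \<delta> \<epsilon> \<longleftrightarrow>
    X \<in> obj C \<and> \<delta> \<in> chom C X (X \<boxtimes>\<^bsub>T\<^esub> X) \<and> \<epsilon> \<in> chom C X (tunit T) \<and>
    tassoc T X X X \<cdot>\<^bsub>C\<^esub> (\<delta> \<boxdot>\<^bsub>T\<^esub> cid C X) \<cdot>\<^bsub>C\<^esub> \<delta> = (cid C X \<boxdot>\<^bsub>T\<^esub> \<delta>) \<cdot>\<^bsub>C\<^esub> \<delta> \<and>
    tlunit T X \<cdot>\<^bsub>C\<^esub> (\<epsilon> \<boxdot>\<^bsub>T\<^esub> cid C X) \<cdot>\<^bsub>C\<^esub> \<delta> = cid C X \<and>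
    trunit T X \<cdot>\<^bsub>C\<^esub> (cid C X \<boxdot>\<^bsub>T\<^esub> \<epsilon>) \<cdot>\<^bsub>C\<^esub> \<delta> = cid C X"

definition monoid_map ::
    "('o, 'm, 'z) cat_scheme \<Rightarrow> ('o, 'm) tensor \<Rightarrow>
     'o \<Rightarrow> 'm \<Rightarrow> 'm \<Rightarrow> 'o \<Rightarrow> 'm \<Rightarrow> 'm \<Rightarrow> 'm \<Rightarrow> bool"
  where "monoid_map C T Y \<mu> \<iota> Y' \<mu>' \<iota>' f \<longleftrightarrow>
    f \<in> chom C Y Y' \<and> f \<cdot>\<^bsub>C\<^esub> \<mu> = \<mu>' \<cdot>\<^bsub>C\<^esub> (f \<boxdot>\<^bsub>T\<^esub> f) \<and> f \<cdot>\<^bsub>C\<^esub> \<iota> = \<iota>'"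

definition comonoid_map ::
    "('o, 'm, 'z) cat_scheme \<Rightarrow> ('o, 'm) tensor \<Rightarrow>
     'o \<Rightarrow> 'm \<Rightarrow> 'm \<Rightarrow> 'o \<Rightarrow> 'm \<Rightarrow> 'm \<Rightarrow> 'm \<Rightarrow> bool"
  where "comonoid_map C T X \<delta> \<epsilon> X' \<delta>' \<epsilon>' f \<longleftrightarrow>
    f \<in> chom C X X' \<and> \<delta>' \<cdot>\<^bsub>C\<^esub> f = (f \<boxdot>\<^bsub>T\<^esub> f) \<cdot>\<^bsub>C\<^esub> \<delta> \<and> \<epsilon>' \<cdot>\<^bsub>C\<^esub> f = \<epsilon>"

definition is_left_module ::
    "('o, 'm, 'z) cat_scheme \<Rightarrow> ('o, 'm) tensor \<Rightarrow> 'o \<Rightarrow> 'm \<Rightarrow> 'm \<Rightarrow> 'o \<Rightarrow> 'm \<Rightarrow> bool"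
  where "is_left_module C T Y \<mu> \<iota> V a \<longleftrightarrow>
    V \<in> obj C \<and> a \<in> chom C (Y \<boxtimes>\<^bsub>T\<^esub> V) V \<and>
    a \<cdot>\<^bsub>C\<^esub> (\<mu> \<boxdot>\<^bsub>T\<^esub> cid C V) = a \<cdot>\<^bsub>C\<^esub> (cid C Y \<boxdot>\<^bsub>T\<^esub> a) \<cdot>\<^bsub>C\<^esub> tassoc T Y Y V \<and>
    a \<cdot>\<^bsub>C\<^esub> (\<iota> \<boxdot>\<^bsub>T\<^esub> cid C V) = tlunit T V"

definition is_right_module ::
    "('o, 'm, 'z) cat_scheme \<Rightarrow> ('o, 'm) tensor \<Rightarrow> 'o \<Rightarrow> 'm \<Rightarrow> 'm \<Rightarrow> 'o \<Rightarrow> 'm \<Rightarrow> bool"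
  where "is_right_module C T Y \<mu> \<iota> V a \<longleftrightarrow>
    V \<in> obj C \<and> a \<in> chom C (V \<boxtimes>\<^bsub>T\<^esub> Y) V \<and>
    a \<cdot>\<^bsub>C\<^esub> (a \<boxdot>\<^bsub>T\<^esub> cid C Y) = a \<cdot>\<^bsub>C\<^esub> (cid C V \<boxdot>\<^bsub>T\<^esub> \<mu>) \<cdot>\<^bsub>C\<^esub> tassoc T V Y Y \<and>
    a \<cdot>\<^bsub>C\<^esub> (cid C V \<boxdot>\<^bsub>T\<^esub> \<iota>) = trunit T V"

definition is_left_comodule ::
    "('o, 'm, 'z) cat_scheme \<Rightarrow> ('o, 'm) tensor \<Rightarrow> 'o \<Rightarrow> 'm \<Rightarrow> 'm \<Rightarrow> 'o \<Rightarrow> 'm \<Rightarrow> bool"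
  where "is_left_comodule C T X \<delta> \<epsilon> V c \<longleftrightarrow>
    V \<in> obj C \<and> c \<in> chom C V (X \<boxtimes>\<^bsub>T\<^esub> V) \<and>
    tassoc T X X V \<cdot>\<^bsub>C\<^esub> (\<delta> \<boxdot>\<^bsub>T\<^esub> cid C V) \<cdot>\<^bsub>C\<^esub> c = (cid C X \<boxdot>\<^bsub>T\<^esub> c) \<cdot>\<^bsub>C\<^esub> c \<and>
    tlunit T V \<cdot>\<^bsub>C\<^esub> (\<epsilon> \<boxdot>\<^bsub>T\<^esub> cid C V) \<cdot>\<^bsub>C\<^esub> c = cid C V"

definition is_right_comodule ::
    "('o, 'm, 'z) cat_scheme \<Rightarrow> ('o, 'm) tensor \<Rightarrow> 'o \<Rightarrow> 'm \<Rightarrow> 'm \<Rightarrow> 'o \<Rightarrow> 'm \<Rightarrow> bool"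
  where "is_right_comodule C T X \<delta> \<epsilon> V c \<longleftrightarrow>
    V \<in> obj C \<and> c \<in> chom C V (V \<boxtimes>\<^bsub>T\<^esub> X) \<and>
    tassoc T V X X \<cdot>\<^bsub>C\<^esub> (c \<boxdot>\<^bsub>T\<^esub> cid C X) \<cdot>\<^bsub>C\<^esub> c = (cid C V \<boxdot>\<^bsub>T\<^esub> \<delta>) \<cdot>\<^bsub>C\<^esub> c \<and>
    trunit T V \<cdot>\<^bsub>C\<^esub> (cid C V \<boxdot>\<^bsub>T\<^esub> \<epsilon>) \<cdot>\<^bsub>C\<^esub> c = cid C V"

text \<open>Transport of structure along \<open>u\<^sup>*\<close>. For a map \<open>a: A \<boxtimes> B \<rightarrow> C\<close> (a multiplication or an action),
  \<open>pull_op \<G> M u A B a\<close> is \<open>u\<^sup>*A \<boxtimes> u\<^sup>*B \<rightarrow> u\<^sup>*C\<close>; for \<open>c: C \<rightarrow> A \<boxtimes> B\<close>, \<open>pull_coop \<G> M u A B c\<close> is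
  \<open>u\<^sup>*C \<rightarrow> u\<^sup>*A \<boxtimes> u\<^sup>*B\<close>.\<close>

definition pull_op ::
    "('g, 'c, 'd) two_cat \<Rightarrow> ('g, 'c, 'd, 'k, 'o, 'm) green2 \<Rightarrow> 'c \<Rightarrow> 'o \<Rightarrow> 'o \<Rightarrow> 'm \<Rightarrow> 'm"
  where "pull_op \<G> M u A B a =
    pullm M u a \<cdot>\<^bsub>Cat M (Src \<G> u)\<^esub> cinv (Cat M (Src \<G> u)) (Pten M u A B)"

definition pull_unit ::
    "('g, 'c, 'd) two_cat \<Rightarrow> ('g, 'c, 'd, 'k, 'o, 'm) green2 \<Rightarrow> 'c \<Rightarrow> 'm \<Rightarrow> 'm"
  where "pull_unit \<G> M u \<iota> =
    pullm M u \<iota> \<cdot>\<^bsub>Cat M (Src \<G> u)\<^esub> cinv (Cat M (Src \<G> u)) (Punit M u)"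

definition pull_coop ::
    "('g, 'c, 'd) two_cat \<Rightarrow> ('g, 'c, 'd, 'k, 'o, 'm) green2 \<Rightarrow> 'c \<Rightarrow> 'o \<Rightarrow> 'o \<Rightarrow> 'm \<Rightarrow> 'm"
  where "pull_coop \<G> M u A B c = Pten M u A B \<cdot>\<^bsub>Cat M (Src \<G> u)\<^esub> pullm M u c"

definition pull_counit ::
    "('g, 'c, 'd) two_cat \<Rightarrow> ('g, 'c, 'd, 'k, 'o, 'm) green2 \<Rightarrow> 'c \<Rightarrow> 'm \<Rightarrow> 'm"
  where "pull_counit \<G> M u \<epsilon> = Punit M u \<cdot>\<^bsub>Cat M (Src \<G> u)\<^esub> pullm M u \<epsilon>"


section \<open>Coherent families of pairs and their Hom-decategorifications\<close>

locale coherent_family =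
  fixes \<G> :: "('g, 'c, 'd) two_cat" and M :: "('g, 'c, 'd, 'k, 'o, 'm, 'z) mackey2_scheme"
    and X Y :: "'g \<Rightarrow> 'o" and lam rho :: "'c \<Rightarrow> 'm"
  assumes X_obj: "G \<in> Ob \<G> \<Longrightarrow> X G \<in> obj (Cat M G)"
    and Y_obj: "G \<in> Ob \<G> \<Longrightarrow> Y G \<in> obj (Cat M G)"
    and lam_iso: "u \<in> hom1 \<G> H G
      \<Longrightarrow> lam u \<in> chom (Cat M H) (X H) (pullo M u (X G)) \<and> iso_arrow (Cat M H) (lam u)"
    and rho_iso: "u \<in> hom1 \<G> H G
      \<Longrightarrow> rho u \<in> chom (Cat M H) (pullo M u (Y G)) (Y H) \<and> iso_arrow (Cat M H) (rho u)"
    and lam_unit: "G \<in> Ob \<G> \<Longrightarrow> lam (Unit1 \<G> G) = cid (Cat M G) (X G)"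
    and rho_unit: "G \<in> Ob \<G> \<Longrightarrow> rho (Unit1 \<G> G) = cid (Cat M G) (Y G)"
    and lam_comp: "\<lbrakk>u \<in> hom1 \<G> H G; v \<in> hom1 \<G> K H\<rbrakk>
      \<Longrightarrow> lam (Comp1 \<G> u v) = pullm M v (lam u) \<cdot>\<^bsub>Cat M K\<^esub> lam v"
    and rho_comp: "\<lbrakk>u \<in> hom1 \<G> H G; v \<in> hom1 \<G> K H\<rbrakk>
      \<Longrightarrow> rho (Comp1 \<G> u v) = rho v \<cdot>\<^bsub>Cat M K\<^esub> pullm M v (rho u)"
    and lam_2cell: "\<lbrakk>u \<in> hom1 \<G> H G; \<alpha> \<in> hom2 \<G> u v\<rbrakk>
      \<Longrightarrow> Pull2 M \<alpha> (X G) \<cdot>\<^bsub>Cat M H\<^esub> lam u = lam v"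
    and rho_2cell: "\<lbrakk>u \<in> hom1 \<G> H G; \<alpha> \<in> hom2 \<G> u v\<rbrakk>
      \<Longrightarrow> rho v \<cdot>\<^bsub>Cat M H\<^esub> Pull2 M \<alpha> (Y G) = rho u"

definition hom_decat ::
    "('g, 'c, 'd) two_cat \<Rightarrow> ('g, 'c, 'd, 'k, 'o, 'm, 'z) mackey2_scheme \<Rightarrow>
     ('g \<Rightarrow> 'o) \<Rightarrow> ('g \<Rightarrow> 'o) \<Rightarrow> ('c \<Rightarrow> 'm) \<Rightarrow> ('c \<Rightarrow> 'm) \<Rightarrow> ('g, 'c, 'k, 'm) mackey"
  where "hom_decat \<G> M X Y lam rho =
    \<lparr>Val = (\<lambda>G. hmod (Cat M G) (X G) (Y G)),
     Res = (\<lambda>u \<phi>. let C = Cat M (Src \<G> u) in rho u \<cdot>\<^bsub>C\<^esub> pullm M u \<phi> \<cdot>\<^bsub>C\<^esub> lam u),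
     Ind = (\<lambda>u \<psi>. let C = Cat M (Src \<G> u); G = Trg \<G> u in
       leps M u (Y G) \<cdot>\<^bsub>Cat M G\<^esub>
       pushm M u (cinv C (rho u) \<cdot>\<^bsub>C\<^esub> \<psi> \<cdot>\<^bsub>C\<^esub> cinv C (lam u)) \<cdot>\<^bsub>Cat M G\<^esub>
       reta M u (X G))\<rparr>"

definition convolution_decat ::
    "('g, 'c, 'd) two_cat \<Rightarrow> ('g, 'c, 'd, 'k, 'o, 'm) green2 \<Rightarrow>
     ('g \<Rightarrow> 'o) \<Rightarrow> ('g \<Rightarrow> 'o) \<Rightarrow> ('c \<Rightarrow> 'm) \<Rightarrow> ('c \<Rightarrow> 'm) \<Rightarrow>
     ('g \<Rightarrow> 'm) \<Rightarrow> ('g \<Rightarrow> 'm) \<Rightarrow> ('g \<Rightarrow> 'm) \<Rightarrow> ('g \<Rightarrow> 'm) \<Rightarrow> ('g, 'c, 'k, 'm) mackey"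
  where "convolution_decat \<G> M X Y lam rho \<delta> \<epsilon> \<mu> \<iota> =
    (hom_decat \<G> M X Y lam rho)
    \<lparr>Val := (\<lambda>G. (hmod (Cat M G) (X G) (Y G))
       \<lparr>mult := (\<lambda>x y. \<mu> G \<cdot>\<^bsub>Cat M G\<^esub> (x \<boxdot>\<^bsub>Ten M G\<^esub> y) \<cdot>\<^bsub>Cat M G\<^esub> \<delta> G),
        one := \<iota> G \<cdot>\<^bsub>Cat M G\<^esub> \<epsilon> G\<rparr>)\<rparr>"

locale comonoid_monoid_family = coherent_family \<G> M X Y lam rho
  for \<G> :: "('g, 'c, 'd) two_cat" and M :: "('g, 'c, 'd, 'k, 'o, 'm) green2"
    and X Y :: "'g \<Rightarrow> 'o" and lam rho :: "'c \<Rightarrow> 'm" +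
  fixes \<delta> \<epsilon> \<mu> \<iota> :: "'g \<Rightarrow> 'm"
  assumes comonoid: "G \<in> Ob \<G> \<Longrightarrow> is_comonoid (Cat M G) (Ten M G) (X G) (\<delta> G) (\<epsilon> G)"
    and "monoid": "G \<in> Ob \<G> \<Longrightarrow> is_monoid (Cat M G) (Ten M G) (Y G) (\<mu> G) (\<iota> G)"
    and lam_comonoid_map: "u \<in> hom1 \<G> H G
      \<Longrightarrow> comonoid_map (Cat M H) (Ten M H) (X H) (\<delta> H) (\<epsilon> H)
            (pullo M u (X G)) (pull_coop \<G> M u (X G) (X G) (\<delta> G)) (pull_counit \<G> M u (\<epsilon> G)) (lam u)"
    and rho_monoid_map: "u \<in> hom1 \<G> H G
      \<Longrightarrow> monoid_map (Cat M H) (Ten M H)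
            (pullo M u (Y G)) (pull_op \<G> M u (Y G) (Y G) (\<mu> G)) (pull_unit \<G> M u (\<iota> G))
            (Y H) (\<mu> H) (\<iota> H) (rho u)"

text \<open>Families \<open>V, W, lam', rho'\<close> of left comodules (coactions \<open>c\<close>) over \<open>X\<close> and left modules
  (actions \<open>a\<close>) over \<open>Y\<close>, and their right-handed versions.\<close>

locale left_module_family =
  base: comonoid_monoid_family \<G> M X Y lam rho \<delta> \<epsilon> \<mu> \<iota> + coherent_family \<G> M V W lam' rho'
  for \<G> :: "('g, 'c, 'd) two_cat" and M :: "('g, 'c, 'd, 'k, 'o, 'm) green2"
    and X Y :: "'g \<Rightarrow> 'o" and lam rho :: "'c \<Rightarrow> 'm" and \<delta> \<epsilon> \<mu> \<iota> :: "'g \<Rightarrow> 'm"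
    and V W :: "'g \<Rightarrow> 'o" and lam' rho' :: "'c \<Rightarrow> 'm" +
  fixes c a :: "'g \<Rightarrow> 'm"
  assumes left_comodule: "G \<in> Ob \<G>
      \<Longrightarrow> is_left_comodule (Cat M G) (Ten M G) (X G) (\<delta> G) (\<epsilon> G) (V G) (c G)"
    and left_module: "G \<in> Ob \<G>
      \<Longrightarrow> is_left_module (Cat M G) (Ten M G) (Y G) (\<mu> G) (\<iota> G) (W G) (a G)"
    and lam_comodule_map: "u \<in> hom1 \<G> H G
      \<Longrightarrow> pull_coop \<G> M u (X G) (V G) (c G) \<cdot>\<^bsub>Cat M H\<^esub> lam' u
          = (lam u \<boxdot>\<^bsub>Ten M H\<^esub> lam' u) \<cdot>\<^bsub>Cat M H\<^esub> c H"
    and rho_module_map: "u \<in> hom1 \<G> H G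
      \<Longrightarrow> rho' u \<cdot>\<^bsub>Cat M H\<^esub> pull_op \<G> M u (Y G) (W G) (a G)
          = a H \<cdot>\<^bsub>Cat M H\<^esub> (rho u \<boxdot>\<^bsub>Ten M H\<^esub> rho' u)"

locale right_module_family =
  base: comonoid_monoid_family \<G> M X Y lam rho \<delta> \<epsilon> \<mu> \<iota> + coherent_family \<G> M V W lam' rho'
  for \<G> :: "('g, 'c, 'd) two_cat" and M :: "('g, 'c, 'd, 'k, 'o, 'm) green2"
    and X Y :: "'g \<Rightarrow> 'o" and lam rho :: "'c \<Rightarrow> 'm" and \<delta> \<epsilon> \<mu> \<iota> :: "'g \<Rightarrow> 'm"
    and V W :: "'g \<Rightarrow> 'o" and lam' rho' :: "'c \<Rightarrow> 'm" +
  fixes c a :: "'g \<Rightarrow> 'm"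
  assumes right_comodule: "G \<in> Ob \<G>
      \<Longrightarrow> is_right_comodule (Cat M G) (Ten M G) (X G) (\<delta> G) (\<epsilon> G) (V G) (c G)"
    and right_module: "G \<in> Ob \<G>
      \<Longrightarrow> is_right_module (Cat M G) (Ten M G) (Y G) (\<mu> G) (\<iota> G) (W G) (a G)"
    and lam_comodule_map: "u \<in> hom1 \<G> H G
      \<Longrightarrow> pull_coop \<G> M u (V G) (X G) (c G) \<cdot>\<^bsub>Cat M H\<^esub> lam' u
          = (lam' u \<boxdot>\<^bsub>Ten M H\<^esub> lam u) \<cdot>\<^bsub>Cat M H\<^esub> c H"
    and rho_module_map: "u \<in> hom1 \<G> H G
      \<Longrightarrow> rho' u \<cdot>\<^bsub>Cat M H\<^esub> pull_op \<G> M u (W G) (Y G) (a G)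
          = a H \<cdot>\<^bsub>Cat M H\<^esub> (rho' u \<boxdot>\<^bsub>Ten M H\<^esub> rho u)"

definition convolution_action ::
    "('g, 'c, 'd, 'k, 'o, 'm) green2 \<Rightarrow> ('g \<Rightarrow> 'm) \<Rightarrow> ('g \<Rightarrow> 'm) \<Rightarrow> 'g \<Rightarrow> 'm \<Rightarrow> 'm \<Rightarrow> 'm"
  where "convolution_action M c a G x y =
    a G \<cdot>\<^bsub>Cat M G\<^esub> (x \<boxdot>\<^bsub>Ten M G\<^esub> y) \<cdot>\<^bsub>Cat M G\<^esub> c G"

end

theory Submission
  imports Defs
begin

text \<open>For \<open>i: H \<rightarrow> G\<close> in \<open>J\<close>, the functor \<open>i\<^sup>*\<close> has an adjoint \<open>i\<^sub>! = i\<^sub>*\<close> on both sides, and so every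
  arrow \<open>g: i\<^sup>*A \<rightarrow> i\<^sup>*B\<close> has a transfer \<open>T\<^sub>i g: A \<rightarrow> B\<close>, the composite
  \<open>A \<rightarrow> i\<^sub>*i\<^sup>*A \<rightarrow> i\<^sub>!i\<^sup>*B \<rightarrow> B\<close> of a unit, \<open>i\<^sub>* g\<close> and a counit. In the Hom-decategorification, induction
  along \<open>i\<close> is \<open>T\<^sub>i\<close> after conjugation with the coherence isomorphisms, while restriction is \<open>i\<^sup>*\<close> after
  such a conjugation. The axioms about induction reduce in this way to the following rules for transfers, in which
  the families \<open>X\<close> and \<open>Y\<close> do not occur:

  \<^item> \<open>f T\<^sub>i(g) = T\<^sub>i(i\<^sup>*f g)\<close> and \<open>T\<^sub>i(g) f = T\<^sub>i(g i\<^sup>*f)\<close> (\<open>transfer_post\<close>, \<open>transfer_pre\<close>);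
  \<^item> \<open>T\<close> is functorial in \<open>i\<close> and invariant under 2-cells (\<open>transfer_unit\<close>, \<open>transfer_comp\<close>,
    \<open>transfer_2cell\<close>);
  \<^item> \<open>u\<^sup>* T\<^sub>i(g) = T\<^sub>q(\<gamma> p\<^sup>*(g) \<gamma>\<^sup>-\<^sup>1)\<close> for Mackey squares (\<open>transfer_mackey\<close>);
  \<^item> for a coproduct with inclusions \<open>i\<close>, \<open>j\<close>: \<open>i\<^sup>* T\<^sub>i(g) = g\<close>, \<open>j\<^sup>* T\<^sub>i(g) = 0\<close> and
    \<open>T\<^sub>i(i\<^sup>*f) + T\<^sub>j(j\<^sup>*f) = f\<close> (\<open>transfer_coproduct\<close>);
  \<^item> \<open>f \<otimes> T\<^sub>i(g) = T\<^sub>i(i\<^sup>*f \<otimes> g)\<close> up to the monoidal structure of \<open>i\<^sup>*\<close>, and likewise with the factors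
    exchanged (\<open>transfer_tensor\<close>).

  Functoriality and base change are statements about mates. The mate of \<open>\<gamma>\<close> for the left adjoints
  absorbs one counit and produces the other, and the mate for the right adjoints does the same with
  the units; where the axioms of a rectified Mackey 2-functor identify the two mates, or make them
  inverse to each other, the transfers match. The rule for coproducts holds because \<open>(i\<^sup>*, j\<^sup>*)\<close> is an
  equivalence, under which \<open>i\<^sub>! A\<close> has to correspond to \<open>(A, 0)\<close>. The last rule follows by inserting the
  two projection maps, one next to the unit and the other next to the counit.

  The multiplication of the Green functor and the left and right actions on its modules are all
  convolutions \<open>a (x \<otimes> y) c\<close> of two coherent families with values in a third one. Compatibility with
  restriction and both Frobenius formulas are proved once for such pairings
  (\<open>convolution_pairing\<close>); associativity and unitality are those of the operations and
  cooperations (\<open>convolution_assoc\<close>, \<open>convolution_left_unit\<close>, \<open>convolution_right_unit\<close>).\<close>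

section \<open>Calculus of arrows\<close>

lemma chomD: "f \<in> chom C x y \<Longrightarrow> f \<in> arr C \<and> cdom C f = x \<and> ccod C f = y"
  by (simp add: chom_def)

lemma chomI: "\<lbrakk>f \<in> arr C; cdom C f = x; ccod C f = y\<rbrakk> \<Longrightarrow> f \<in> chom C x y"
  by (simp add: chom_def)

lemma chom_iff: "f \<in> chom C x y \<longleftrightarrow> f \<in> arr C \<and> cdom C f = x \<and> ccod C f = y"
  by (simp add: chom_def)

context category
begin

lemma objs [simp]:
  assumes "f \<in> arr C"
  shows "cdom C f \<in> obj C" "ccod C f \<in> obj C"
  using assms dom_closed cod_closed by auto

lemma comp [simp]:
  assumes "f \<in> arr C" "g \<in> arr C" "cdom C g = ccod C f"
  shows "g \<cdot> f \<in> arr C" "cdom C (g \<cdot> f) = cdom C f" "ccod C (g \<cdot> f) = ccod C g"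
  using comp_closed[of f "cdom C f" "ccod C f" g "ccod C g"] assms by (simp_all add: chom_def)

lemma ident [simp]:
  assumes "x \<in> obj C"
  shows "cid C x \<in> arr C" "cdom C (cid C x) = x" "ccod C (cid C x) = x"
  using id_closed[OF assms] by (simp_all add: chom_def)

lemma unit_laws [simp]:
  "\<lbrakk>f \<in> arr C; ccod C f = x\<rbrakk> \<Longrightarrow> cid C x \<cdot> f = f"
  "\<lbrakk>f \<in> arr C; cdom C f = x\<rbrakk> \<Longrightarrow> f \<cdot> cid C x = f"
  using id_left id_right by auto

lemma assoc [simp]:
  "\<lbrakk>f \<in> arr C; g \<in> arr C; h \<in> arr C; cdom C g = ccod C f; cdom C h = ccod C g\<rbrakk>
    \<Longrightarrow> (h \<cdot> g) \<cdot> f = h \<cdot> (g \<cdot> f)"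
  by (rule comp_assoc) (auto simp: chom_def)

text \<open>Composites are kept associated to the right; this turns an equation \<open>g f = h\<close> into a rule that
  also applies inside a longer composite.\<close>

lemma inside:
  "\<lbrakk>g \<cdot> f = h; f \<in> arr C; g \<in> arr C; cdom C g = ccod C f; r \<in> arr C; ccod C r = cdom C f\<rbrakk>
    \<Longrightarrow> g \<cdot> (f \<cdot> r) = h \<cdot> r"
  by (metis assoc)

lemma inverse_unique:
  assumes "inverse_arrows C f g" "inverse_arrows C f h"
  shows "g = h"
proof -
  note d = assms[unfolded inverse_arrows_def chom_iff]
  have "g = g \<cdot> (f \<cdot> h)" using d by simp
  also have "\<dots> = (g \<cdot> f) \<cdot> h" using d by (intro assoc[symmetric]) auto
  also have "\<dots> = h" using d by simp
  finally show ?thesis .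
qed

lemma cinv_inverse: "iso_arrow C f \<Longrightarrow> inverse_arrows C f (cinv C f)"
  unfolding cinv_def iso_arrow_def by (metis inverse_unique theI)

lemma cinv_eq: "inverse_arrows C f g \<Longrightarrow> cinv C f = g"
  using cinv_inverse inverse_unique iso_arrow_def by metis

lemma inverse [simp]:
  assumes "iso_arrow C f"
  shows "f \<in> arr C" "cinv C f \<in> arr C" "cdom C (cinv C f) = ccod C f" "ccod C (cinv C f) = cdom C f"
    "cinv C f \<cdot> f = cid C (cdom C f)" "f \<cdot> cinv C f = cid C (ccod C f)"
  using cinv_inverse[OF assms] by (simp_all add: inverse_arrows_def chom_iff)

lemma inverse_inside [simp]:
  assumes "iso_arrow C f" "r \<in> arr C"
  shows "ccod C r = cdom C f \<Longrightarrow> cinv C f \<cdot> (f \<cdot> r) = r"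
    "ccod C r = ccod C f \<Longrightarrow> f \<cdot> (cinv C f \<cdot> r) = r"
  using assms by (simp_all add: inside)

lemma iso_cancel_left:
  assumes "iso_arrow C f" "g \<in> arr C" "h \<in> arr C" "ccod C g = cdom C f" "ccod C h = cdom C f"
    "f \<cdot> g = f \<cdot> h"
  shows "g = h"
  by (metis assms inverse_inside(1))

lemma iso_cancel_right:
  assumes "iso_arrow C f" "g \<in> arr C" "h \<in> arr C" "cdom C g = ccod C f" "cdom C h = ccod C f"
    "g \<cdot> f = h \<cdot> f"
  shows "g = h"
proof -
  have "g = (g \<cdot> f) \<cdot> cinv C f" using assms(1-5) by simp
  also have "\<dots> = (h \<cdot> f) \<cdot> cinv C f" by (simp only: assms(6))
  also have "\<dots> = h" using assms(1-5) by simp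
  finally show ?thesis .
qed

lemma inverse_comp [simp]:
  assumes "iso_arrow C f" "iso_arrow C g" "cdom C g = ccod C f"
  shows "iso_arrow C (g \<cdot> f)" "cinv C (g \<cdot> f) = cinv C f \<cdot> cinv C g"
proof -
  have "inverse_arrows C (g \<cdot> f) (cinv C f \<cdot> cinv C g)"
    using assms by (simp add: inverse_arrows_def chom_iff)
  then show "iso_arrow C (g \<cdot> f)" "cinv C (g \<cdot> f) = cinv C f \<cdot> cinv C g"
    by (auto simp: iso_arrow_def intro: cinv_eq)
qed

text \<open>For coherence isomorphisms \<open>f\<close>, \<open>g\<close> related by the component \<open>a\<close> of a natural transformation; this
  moves the relation to their inverses.\<close>

lemma inverse_triangle:
  assumes "iso_arrow C f" "iso_arrow C g"
  shows "\<lbrakk>a \<in> arr C; cdom C a = cdom C f; ccod C a = cdom C g; g \<cdot> a = f\<rbrakk> \<Longrightarrow> a \<cdot> cinv C f = cinv C g"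
    "\<lbrakk>a \<in> arr C; cdom C a = ccod C f; ccod C a = ccod C g; a \<cdot> f = g\<rbrakk> \<Longrightarrow> cinv C g \<cdot> a = cinv C f"
proof -
  assume a: "a \<in> arr C" "cdom C a = cdom C f" "ccod C a = cdom C g" "g \<cdot> a = f"
  have "cinv C g \<cdot> (g \<cdot> a) \<cdot> cinv C f = a \<cdot> cinv C f" using a(1-3) assms by simp
  moreover have "ccod C f = ccod C g" using a assms by auto
  ultimately show "a \<cdot> cinv C f = cinv C g" using assms by (simp add: a(4))
next
  assume a: "a \<in> arr C" "cdom C a = ccod C f" "ccod C a = ccod C g" "a \<cdot> f = g"
  have "cinv C g \<cdot> (a \<cdot> f) \<cdot> cinv C f = cinv C g \<cdot> a" using a(1-3) assms by simp
  moreover have "cdom C f = cdom C g" using a assms by auto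
  ultimately show "cinv C g \<cdot> a = cinv C f" using assms by (simp add: a(4))
qed

end

locale ftor = C: category C + D: category D
  for C :: "('o, 'm, 'y) cat_scheme" and D :: "('p, 'n, 'z) cat_scheme" +
  fixes F :: "('o, 'm, 'p, 'n) ftor"
  assumes is_functor: "is_functor C D F"
begin

lemma pres [simp]:
  "x \<in> obj C \<Longrightarrow> fob F x \<in> obj D"
  "f \<in> arr C \<Longrightarrow> fmor F f \<in> arr D"
  "f \<in> arr C \<Longrightarrow> cdom D (fmor F f) = fob F (cdom C f)"
  "f \<in> arr C \<Longrightarrow> ccod D (fmor F f) = fob F (ccod C f)"
  "x \<in> obj C \<Longrightarrow> fmor F (cid C x) = cid D (fob F x)"
  "\<lbrakk>f \<in> arr C; g \<in> arr C; cdom C g = ccod C f\<rbrakk> \<Longrightarrow> fmor F (g \<cdot>\<^bsub>C\<^esub> f) = fmor F g \<cdot>\<^bsub>D\<^esub> fmor F f"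
  using is_functor by (auto simp: is_functor_def chom_iff)

lemma iso_inverse:
  assumes "iso_arrow C f"
  shows "inverse_arrows D (fmor F f) (fmor F (cinv C f))"
  using assms by (simp add: inverse_arrows_def chom_iff pres(6)[symmetric] del: pres(6))

lemma iso [simp]:
  assumes "iso_arrow C f"
  shows "iso_arrow D (fmor F f)" "cinv D (fmor F f) = fmor F (cinv C f)"
  using iso_inverse[OF assms] by (auto simp: iso_arrow_def intro: D.cinv_eq)

lemma image_eq:
  "\<lbrakk>g \<cdot>\<^bsub>C\<^esub> f = h; f \<in> arr C; g \<in> arr C; cdom C g = ccod C f\<rbrakk> \<Longrightarrow> fmor F g \<cdot>\<^bsub>D\<^esub> fmor F f = fmor F h"
  by (metis pres(6))

lemma image_inside:
  "\<lbrakk>g \<cdot>\<^bsub>C\<^esub> f = h; f \<in> arr C; g \<in> arr C; cdom C g = ccod C f; r \<in> arr D; ccod D r = fob F (cdom C f)\<rbrakk>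
    \<Longrightarrow> fmor F g \<cdot>\<^bsub>D\<^esub> (fmor F f \<cdot>\<^bsub>D\<^esub> r) = fmor F h \<cdot>\<^bsub>D\<^esub> r"
  by (rule D.inside) (auto intro: image_eq)

end

lemma ftorI: "is_functor C D F \<Longrightarrow> ftor C D F"
  by (simp add: ftor_def ftor_axioms_def is_functor_def)

locale adjoint_pair = L: ftor C D L + K: ftor D C K
  for C :: "('o, 'm, 'y) cat_scheme" and D :: "('p, 'n, 'z) cat_scheme" and L K +
  fixes \<eta> :: "'o \<Rightarrow> 'm" and \<epsilon> :: "'p \<Rightarrow> 'n"
  assumes adjunction: "adjunction C D L K \<eta> \<epsilon>"
begin

lemma unit [simp]:
  assumes "x \<in> obj C"
  shows "\<eta> x \<in> arr C" "cdom C (\<eta> x) = x" "ccod C (\<eta> x) = fob K (fob L x)"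
  using adjunction assms
  by (auto simp: adjunction_def nat_trans_def chom_iff id_ftor_def comp_ftor_def)

lemma counit [simp]:
  assumes "y \<in> obj D"
  shows "\<epsilon> y \<in> arr D" "cdom D (\<epsilon> y) = fob L (fob K y)" "ccod D (\<epsilon> y) = y"
  using adjunction assms
  by (auto simp: adjunction_def nat_trans_def chom_iff id_ftor_def comp_ftor_def)

lemma unit_natural: "f \<in> arr C \<Longrightarrow> \<eta> (ccod C f) \<cdot>\<^bsub>C\<^esub> f = fmor K (fmor L f) \<cdot>\<^bsub>C\<^esub> \<eta> (cdom C f)"
  using adjunction by (simp add: adjunction_def nat_trans_def id_ftor_def comp_ftor_def)

lemma counit_natural: "g \<in> arr D \<Longrightarrow> \<epsilon> (ccod D g) \<cdot>\<^bsub>D\<^esub> fmor L (fmor K g) = g \<cdot>\<^bsub>D\<^esub> \<epsilon> (cdom D g)"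
  using adjunction by (simp add: adjunction_def nat_trans_def id_ftor_def comp_ftor_def)

lemma triangles [simp]:
  "x \<in> obj C \<Longrightarrow> \<epsilon> (fob L x) \<cdot>\<^bsub>D\<^esub> fmor L (\<eta> x) = cid D (fob L x)"
  "y \<in> obj D \<Longrightarrow> fmor K (\<epsilon> y) \<cdot>\<^bsub>C\<^esub> \<eta> (fob K y) = cid C (fob K y)"
  using adjunction by (auto simp: adjunction_def)

end

lemma adjoint_pairI: "adjunction C D L K \<eta> \<epsilon> \<Longrightarrow> adjoint_pair C D L K \<eta> \<epsilon>"
  by (simp add: adjoint_pair_def adjoint_pair_axioms_def ftorI adjunction_def)


section \<open>Mates and transfers\<close>

lemma comp_ftor_apply [simp]:
  "fob (comp_ftor K F) x = fob K (fob F x)" "fmor (comp_ftor K F) f = fmor K (fmor F f)"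
  by (simp_all add: comp_ftor_def)

lemma id_ftor_apply [simp]: "fob id_ftor x = x" "fmor id_ftor f = f"
  by (simp_all add: id_ftor_def)

lemma comp_id_ftor [simp]: "comp_ftor id_ftor F = F" "comp_ftor F id_ftor = F"
  by (simp_all add: comp_ftor_def id_ftor_def)

lemma is_functor_id: "category C \<Longrightarrow> is_functor C C id_ftor"
  by (auto simp: is_functor_def chom_iff category.objs category.ident)

lemma is_functor_comp: "is_functor C D F \<Longrightarrow> is_functor D E K \<Longrightarrow> is_functor C E (comp_ftor K F)"
proof -
  assume "is_functor C D F" "is_functor D E K"
  then interpret F: ftor C D F + K: ftor D E K by (auto intro: ftorI)
  show ?thesis
    by (auto simp: is_functor_def chom_iff F.C.category_axioms K.D.category_axioms)
qed

lemma nat_transD: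
  assumes "nat_trans C D F K t"
  shows "x \<in> obj C \<Longrightarrow> t x \<in> arr D" "x \<in> obj C \<Longrightarrow> cdom D (t x) = fob F x"
    "x \<in> obj C \<Longrightarrow> ccod D (t x) = fob K x"
    "f \<in> arr C \<Longrightarrow> t (ccod C f) \<cdot>\<^bsub>D\<^esub> fmor F f = fmor K f \<cdot>\<^bsub>D\<^esub> t (cdom C f)"
  using assms by (auto simp: nat_trans_def chom_iff)

text \<open>The two locales below describe one square of functors each, with \<open>U: G \<rightarrow> Q\<close>, \<open>V: H \<rightarrow> P\<close>;
  the vertical functors have left adjoints \<open>L\<close>, \<open>L'\<close> in the first and right adjoints \<open>K\<close>, \<open>K'\<close>
  in the second. With identities for \<open>U\<close> and \<open>V\<close> the mate compares two adjoints of isomorphic functors.\<close>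

locale left_mate =
  i: adjoint_pair H G L K \<eta> \<epsilon> + q: adjoint_pair P Q L' K' \<eta>' \<epsilon>' + U: ftor G Q U + V: ftor H P V
  for H G L K \<eta> \<epsilon> P Q L' K' \<eta>' \<epsilon>' U V +
  fixes \<gamma>
  assumes nat: "nat_trans G P (comp_ftor V K) (comp_ftor K' U) \<gamma>"
begin

text \<open>The mate \<open>L' V \<rightarrow> U L\<close> of \<open>\<gamma>: V K \<rightarrow> K' U\<close>.\<close>

definition "mate Y = \<epsilon>' (fob U (fob L Y)) \<cdot>\<^bsub>Q\<^esub> fmor L' (\<gamma> (fob L Y)) \<cdot>\<^bsub>Q\<^esub> fmor L' (fmor V (\<eta> Y))"

lemmas gamma = nat_transD[OF nat, unfolded comp_ftor_apply]
declare gamma(1-3) [simp]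

lemma mate_hom [simp]:
  assumes "Y \<in> obj H"
  shows "mate Y \<in> arr Q" "cdom Q (mate Y) = fob L' (fob V Y)" "ccod Q (mate Y) = fob U (fob L Y)"
  using assms by (auto simp: mate_def)

lemma mate_natural:
  assumes g: "g \<in> arr H"
  shows "fmor U (fmor L g) \<cdot>\<^bsub>Q\<^esub> mate (cdom H g) = mate (ccod H g) \<cdot>\<^bsub>Q\<^esub> fmor L' (fmor V g)"
proof -
  have 1: "fmor U (fmor L g) \<cdot>\<^bsub>Q\<^esub> \<epsilon>' (fob U (fob L (cdom H g)))
      = \<epsilon>' (fob U (fob L (ccod H g))) \<cdot>\<^bsub>Q\<^esub> fmor L' (fmor K' (fmor U (fmor L g)))"
    using q.counit_natural[of "fmor U (fmor L g)"] g by simp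
  have 2: "fmor K' (fmor U (fmor L g)) \<cdot>\<^bsub>P\<^esub> \<gamma> (fob L (cdom H g))
      = \<gamma> (fob L (ccod H g)) \<cdot>\<^bsub>P\<^esub> fmor V (fmor K (fmor L g))"
    using gamma(4)[of "fmor L g"] g by simp
  have 3: "fmor V (fmor K (fmor L g)) \<cdot>\<^bsub>P\<^esub> fmor V (\<eta> (cdom H g)) = fmor V (\<eta> (ccod H g) \<cdot>\<^bsub>H\<^esub> g)"
    using i.unit_natural[OF g] g by (intro V.image_eq) auto
  show ?thesis
    using g by (simp add: mate_def q.L.D.inside[OF 1] q.L.image_inside[OF 2] q.L.image_eq[OF 3])
qed

text \<open>The counit \<open>\<epsilon>\<close> is pushed through the mate by naturality, until it meets the unit \<open>\<eta>\<close> contained in the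
  mate and cancels with it.\<close>

lemma mate_counit:
  assumes B: "B \<in> obj G"
  shows "fmor U (\<epsilon> B) \<cdot>\<^bsub>Q\<^esub> mate (fob K B) = \<epsilon>' (fob U B) \<cdot>\<^bsub>Q\<^esub> fmor L' (\<gamma> B)"
proof -
  have 1: "fmor U (\<epsilon> B) \<cdot>\<^bsub>Q\<^esub> \<epsilon>' (fob U (fob L (fob K B)))
      = \<epsilon>' (fob U B) \<cdot>\<^bsub>Q\<^esub> fmor L' (fmor K' (fmor U (\<epsilon> B)))"
    using q.counit_natural[of "fmor U (\<epsilon> B)"] B by simp
  have 2: "fmor K' (fmor U (\<epsilon> B)) \<cdot>\<^bsub>P\<^esub> \<gamma> (fob L (fob K B)) = \<gamma> B \<cdot>\<^bsub>P\<^esub> fmor V (fmor K (\<epsilon> B))"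
    using gamma(4)[of "\<epsilon> B"] B by simp
  have 3: "fmor V (fmor K (\<epsilon> B)) \<cdot>\<^bsub>P\<^esub> fmor V (\<eta> (fob K B)) = fmor V (cid H (fob K B))"
    using B by (intro V.image_eq) auto
  show ?thesis
    using B by (simp add: mate_def q.L.D.inside[OF 1] q.L.image_inside[OF 2] q.L.image_eq[OF 3])
qed

end

locale right_mate =
  i: adjoint_pair G H L K \<eta> \<epsilon> + q: adjoint_pair Q P L' K' \<eta>' \<epsilon>' + U: ftor G Q U + V: ftor H P V
  for G H L K \<eta> \<epsilon> Q P L' K' \<eta>' \<epsilon>' U V +
  fixes \<delta>
  assumes nat: "nat_trans G P (comp_ftor L' U) (comp_ftor V L) \<delta>"
begin

text \<open>The mate \<open>U K \<rightarrow> K' V\<close> of \<open>\<delta>: L' U \<rightarrow> V L\<close>.\<close>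

definition "mate Y = fmor K' (fmor V (\<epsilon> Y)) \<cdot>\<^bsub>Q\<^esub> fmor K' (\<delta> (fob K Y)) \<cdot>\<^bsub>Q\<^esub> \<eta>' (fob U (fob K Y))"

lemmas delta = nat_transD[OF nat, unfolded comp_ftor_apply]
declare delta(1-3) [simp]

lemma mate_hom [simp]:
  assumes "Y \<in> obj H"
  shows "mate Y \<in> arr Q" "cdom Q (mate Y) = fob U (fob K Y)" "ccod Q (mate Y) = fob K' (fob V Y)"
  using assms by (auto simp: mate_def)

text \<open>The unit \<open>\<eta>\<close> is pulled through the mate by naturality, until it meets the counit \<open>\<epsilon>\<close> contained in
  the mate and cancels with it.\<close>

lemma mate_unit:
  assumes A: "A \<in> obj G"
  shows "mate (fob L A) \<cdot>\<^bsub>Q\<^esub> fmor U (\<eta> A) = fmor K' (\<delta> A) \<cdot>\<^bsub>Q\<^esub> \<eta>' (fob U A)"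
proof -
  have 1: "\<eta>' (fob U (fob K (fob L A))) \<cdot>\<^bsub>Q\<^esub> fmor U (\<eta> A)
      = fmor K' (fmor L' (fmor U (\<eta> A))) \<cdot>\<^bsub>Q\<^esub> \<eta>' (fob U A)"
    using q.unit_natural[of "fmor U (\<eta> A)"] A by simp
  have 2: "\<delta> (fob K (fob L A)) \<cdot>\<^bsub>P\<^esub> fmor L' (fmor U (\<eta> A)) = fmor V (fmor L (\<eta> A)) \<cdot>\<^bsub>P\<^esub> \<delta> A"
    using delta(4)[of "\<eta> A"] A by simp
  have 3: "fmor V (\<epsilon> (fob L A)) \<cdot>\<^bsub>P\<^esub> fmor V (fmor L (\<eta> A)) = fmor V (cid H (fob L A))"
    using A by (intro V.image_eq) auto
  show ?thesis
    using A by (simp add: mate_def 1 q.K.image_inside[OF 2] q.K.image_inside[OF 3])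
qed

end

text \<open>A functor \<open>F\<close> with a functor \<open>P\<close> that is both left and right adjoint to it. Such data sends
  \<open>g: F A \<rightarrow> F B\<close> to an arrow \<open>A \<rightarrow> B\<close>, the transfer (relative trace) of \<open>g\<close>.\<close>

locale ambidextrous =
  left: adjoint_pair D C P F \<eta>\<^sub>l \<epsilon>\<^sub>l + right: adjoint_pair C D F P \<eta>\<^sub>r \<epsilon>\<^sub>r
  for C :: "('o, 'm, 'y) cat_scheme" and D :: "('p, 'n, 'z) cat_scheme" and F P \<eta>\<^sub>l \<epsilon>\<^sub>l \<eta>\<^sub>r \<epsilon>\<^sub>r
begin

definition "transfer A B g = \<epsilon>\<^sub>l B \<cdot>\<^bsub>C\<^esub> fmor P g \<cdot>\<^bsub>C\<^esub> \<eta>\<^sub>r A"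

lemma transfer_hom [simp]:
  assumes "A \<in> obj C" "B \<in> obj C" "g \<in> arr D" "cdom D g = fob F A" "ccod D g = fob F B"
  shows "transfer A B g \<in> arr C" "cdom C (transfer A B g) = A" "ccod C (transfer A B g) = B"
  using assms by (auto simp: transfer_def)

text \<open>Arrows of \<open>C\<close> slide into a transfer by naturality of the counit, respectively of the unit.\<close>

lemma transfer_post:
  assumes "A \<in> obj C" "g \<in> arr D" "cdom D g = fob F A" "ccod D g = fob F B"
    "f \<in> arr C" "cdom C f = B" "ccod C f = B'"
  shows "f \<cdot>\<^bsub>C\<^esub> transfer A B g = transfer A B' (fmor F f \<cdot>\<^bsub>D\<^esub> g)"
proof -
  have 1: "f \<cdot>\<^bsub>C\<^esub> \<epsilon>\<^sub>l B = \<epsilon>\<^sub>l B' \<cdot>\<^bsub>C\<^esub> fmor P (fmor F f)"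
    using left.counit_natural[of f] assms by simp
  show ?thesis using assms left.L.D.objs[of f] by (simp add: transfer_def left.L.D.inside[OF 1])
qed

lemma transfer_pre:
  assumes "B \<in> obj C" "g \<in> arr D" "cdom D g = fob F A" "ccod D g = fob F B"
    "f \<in> arr C" "cdom C f = A'" "ccod C f = A"
  shows "transfer A B g \<cdot>\<^bsub>C\<^esub> f = transfer A' B (g \<cdot>\<^bsub>D\<^esub> fmor F f)"
proof -
  have 1: "\<eta>\<^sub>r A \<cdot>\<^bsub>C\<^esub> f = fmor P (fmor F f) \<cdot>\<^bsub>C\<^esub> \<eta>\<^sub>r A'"
    using right.unit_natural[of f] assms by simp
  show ?thesis using assms left.L.D.objs[of f] by (simp add: transfer_def 1)
qed

end

text \<open>Applied to \<open>u\<^sup>*\<close> and \<open>v\<^sup>*\<close>, the unit and the counit below are those from which the comparisons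
  between \<open>u\<^sub>! v\<^sub>!\<close> and \<open>(u v)\<^sub>!\<close>, and between \<open>u\<^sub>* v\<^sub>*\<close> and \<open>(u v)\<^sub>*\<close>, are built.\<close>

lemma adjunction_comp:
  assumes "adjunction C D L K \<eta> \<epsilon>" "adjunction D E L' K' \<eta>' \<epsilon>'"
  shows "adjunction C E (comp_ftor L' L) (comp_ftor K K')
    (\<lambda>x. fmor K (\<eta>' (fob L x)) \<cdot>\<^bsub>C\<^esub> \<eta> x) (\<lambda>z. \<epsilon>' z \<cdot>\<^bsub>E\<^esub> fmor L' (\<epsilon> (fob K' z)))"
proof -
  interpret a: adjoint_pair C D L K \<eta> \<epsilon> by (rule adjoint_pairI) fact
  interpret b: adjoint_pair D E L' K' \<eta>' \<epsilon>' by (rule adjoint_pairI) fact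
  have unit_nat: "fmor K (\<eta>' (fob L (ccod C f))) \<cdot>\<^bsub>C\<^esub> \<eta> (ccod C f) \<cdot>\<^bsub>C\<^esub> f
      = fmor K (fmor K' (fmor L' (fmor L f))) \<cdot>\<^bsub>C\<^esub> fmor K (\<eta>' (fob L (cdom C f))) \<cdot>\<^bsub>C\<^esub> \<eta> (cdom C f)"
    if f: "f \<in> arr C" for f
  proof -
    have 2: "\<eta>' (fob L (ccod C f)) \<cdot>\<^bsub>D\<^esub> fmor L f
        = fmor K' (fmor L' (fmor L f)) \<cdot>\<^bsub>D\<^esub> \<eta>' (fob L (cdom C f))"
      using b.unit_natural[of "fmor L f"] f by simp
    show ?thesis using f by (simp add: a.unit_natural a.K.image_inside[OF 2])
  qed
  have counit_nat: "\<epsilon>' (ccod E g) \<cdot>\<^bsub>E\<^esub> fmor L' (\<epsilon> (fob K' (ccod E g))) \<cdot>\<^bsub>E\<^esub> fmor L' (fmor L (fmor K (fmor K' g)))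
      = g \<cdot>\<^bsub>E\<^esub> \<epsilon>' (cdom E g) \<cdot>\<^bsub>E\<^esub> fmor L' (\<epsilon> (fob K' (cdom E g)))"
    if g: "g \<in> arr E" for g
  proof -
    have 1: "\<epsilon> (fob K' (ccod E g)) \<cdot>\<^bsub>D\<^esub> fmor L (fmor K (fmor K' g))
        = fmor K' g \<cdot>\<^bsub>D\<^esub> \<epsilon> (fob K' (cdom E g))"
      using a.counit_natural[of "fmor K' g"] g by simp
    show ?thesis
      using g by (simp add: b.L.image_eq[OF 1] b.L.D.inside[OF b.counit_natural])
  qed
  have tri1: "\<epsilon>' (fob L' (fob L x)) \<cdot>\<^bsub>E\<^esub> fmor L' (\<epsilon> (fob K' (fob L' (fob L x)))) \<cdot>\<^bsub>E\<^esub>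
      fmor L' (fmor L (fmor K (\<eta>' (fob L x)))) \<cdot>\<^bsub>E\<^esub> fmor L' (fmor L (\<eta> x)) = cid E (fob L' (fob L x))"
    if x: "x \<in> obj C" for x
  proof -
    have 1: "\<epsilon> (fob K' (fob L' (fob L x))) \<cdot>\<^bsub>D\<^esub> fmor L (fmor K (\<eta>' (fob L x)))
        = \<eta>' (fob L x) \<cdot>\<^bsub>D\<^esub> \<epsilon> (fob L x)"
      using a.counit_natural[of "\<eta>' (fob L x)"] x by simp
    have 2: "fmor L' (\<epsilon> (fob L x)) \<cdot>\<^bsub>E\<^esub> fmor L' (fmor L (\<eta> x)) = cid E (fob L' (fob L x))"
      using x b.L.image_eq[OF a.triangles(1)[OF x]] by simp
    show ?thesis
      using x by (simp add: b.L.image_inside[OF 1] 2)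
  qed
  have tri2: "fmor K (fmor K' (\<epsilon>' z)) \<cdot>\<^bsub>C\<^esub> fmor K (fmor K' (fmor L' (\<epsilon> (fob K' z)))) \<cdot>\<^bsub>C\<^esub>
      fmor K (\<eta>' (fob L (fob K (fob K' z)))) \<cdot>\<^bsub>C\<^esub> \<eta> (fob K (fob K' z)) = cid C (fob K (fob K' z))"
    if z: "z \<in> obj E" for z
  proof -
    have 1: "fmor K' (fmor L' (\<epsilon> (fob K' z))) \<cdot>\<^bsub>D\<^esub> \<eta>' (fob L (fob K (fob K' z)))
        = \<eta>' (fob K' z) \<cdot>\<^bsub>D\<^esub> \<epsilon> (fob K' z)"
      using b.unit_natural[of "\<epsilon> (fob K' z)"] z by simp
    have 2: "fmor K' (\<epsilon>' z) \<cdot>\<^bsub>D\<^esub> \<eta>' (fob K' z) = cid D (fob K' z)"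
      using z by simp
    show ?thesis
      using z by (simp add: a.K.image_inside[OF 1] a.K.image_eq[OF 2])
  qed
  show ?thesis
    by (auto simp: adjunction_def nat_trans_def chom_iff unit_nat counit_nat tri1 tri2 is_functor_id
        a.L.C.category_axioms b.L.D.category_axioms
        intro!: is_functor_comp a.L.is_functor a.K.is_functor b.L.is_functor b.K.is_functor)
qed

text \<open>The comparison \<open>P' \<rightarrow> P\<close> of adjoints induced by \<open>\<alpha>: F \<rightarrow> F'\<close> turns the counit of one left
  adjunction into that of the other, and likewise for the units of the right adjunctions. When \<open>\<alpha>\<close>
  induces the same comparison on both sides, arrows that correspond to each other under \<open>\<alpha>\<close> therefore
  have the same transfer.\<close>

theorem transfer_comparison:
  fixes C :: "('o, 'm, 'y) cat_scheme" and D :: "('p, 'n, 'z) cat_scheme"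
  assumes "ambidextrous C D F P \<eta>\<^sub>l \<epsilon>\<^sub>l \<eta>\<^sub>r \<epsilon>\<^sub>r" "ambidextrous C D F' P' \<eta>\<^sub>l' \<epsilon>\<^sub>l' \<eta>\<^sub>r' \<epsilon>\<^sub>r'"
    and nat: "nat_trans C D F F' \<alpha>" and iso: "iso_arrow D (\<alpha> A)"
    and mates: "\<And>Y. Y \<in> obj D \<Longrightarrow>
      \<epsilon>\<^sub>l' (fob P Y) \<cdot>\<^bsub>C\<^esub> fmor P' (\<alpha> (fob P Y)) \<cdot>\<^bsub>C\<^esub> fmor P' (\<eta>\<^sub>l Y)
      = fmor P (\<epsilon>\<^sub>r' Y) \<cdot>\<^bsub>C\<^esub> fmor P (\<alpha> (fob P' Y)) \<cdot>\<^bsub>C\<^esub> \<eta>\<^sub>r (fob P' Y)"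
    and obs: "A \<in> obj C" "B \<in> obj C"
    and g: "g \<in> chom D (fob F A) (fob F B)" and g': "g' \<in> chom D (fob F' A) (fob F' B)"
    and intertwined: "\<alpha> B \<cdot>\<^bsub>D\<^esub> g = g' \<cdot>\<^bsub>D\<^esub> \<alpha> A"
  shows "ambidextrous.transfer C P \<epsilon>\<^sub>l \<eta>\<^sub>r A B g = ambidextrous.transfer C P' \<epsilon>\<^sub>l' \<eta>\<^sub>r' A B g'"
proof -
  interpret a: ambidextrous C D F P \<eta>\<^sub>l \<epsilon>\<^sub>l \<eta>\<^sub>r \<epsilon>\<^sub>r by fact
  interpret b: ambidextrous C D F' P' \<eta>\<^sub>l' \<epsilon>\<^sub>l' \<eta>\<^sub>r' \<epsilon>\<^sub>r' by fact
  interpret l: left_mate D C P F \<eta>\<^sub>l \<epsilon>\<^sub>l D C P' F' \<eta>\<^sub>l' \<epsilon>\<^sub>l' id_ftor id_ftor \<alpha>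
    by unfold_locales (auto intro: is_functor_id simp: nat a.left.L.C.category_axioms a.left.L.D.category_axioms)
  interpret r: right_mate C D F' P' \<eta>\<^sub>r' \<epsilon>\<^sub>r' C D F P \<eta>\<^sub>r \<epsilon>\<^sub>r id_ftor id_ftor \<alpha>
    by unfold_locales (auto intro: is_functor_id simp: nat a.left.L.C.category_axioms a.left.L.D.category_axioms)
  have eq: "l.mate Y = r.mate Y" if "Y \<in> obj D" for Y
    using mates[OF that] by (simp add: l.mate_def r.mate_def)
  note hom [simp] = chomD[OF g, THEN conjunct1] chomD[OF g, THEN conjunct2, THEN conjunct1]
    chomD[OF g, THEN conjunct2, THEN conjunct2] chomD[OF g', THEN conjunct1]
    chomD[OF g', THEN conjunct2, THEN conjunct1] chomD[OF g', THEN conjunct2, THEN conjunct2]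
  \<comment> \<open>The common diagonal \<open>F' A \<rightarrow> F B\<close> of the square formed by \<open>g\<close>, \<open>g'\<close> and \<open>\<alpha>\<close>: then \<open>g = h \<alpha>\<close> and \<open>g' = \<alpha> h\<close>,
    and the two transfers differ by moving \<open>\<alpha>\<close> across \<open>h\<close>.\<close>
  define h where "h = g \<cdot>\<^bsub>D\<^esub> cinv D (\<alpha> A)"
  have h [simp]: "h \<in> arr D" "cdom D h = fob F' A" "ccod D h = fob F B"
    using obs iso by (auto simp: h_def)
  have ha: "h \<cdot>\<^bsub>D\<^esub> \<alpha> A = g" using obs iso by (simp add: h_def)
  have ah: "\<alpha> B \<cdot>\<^bsub>D\<^esub> h = g'" using obs iso
    by (simp add: h_def a.left.L.C.inside[OF intertwined])
  have "a.transfer A B g = \<epsilon>\<^sub>l B \<cdot>\<^bsub>C\<^esub> fmor P h \<cdot>\<^bsub>C\<^esub> fmor P (\<alpha> A) \<cdot>\<^bsub>C\<^esub> \<eta>\<^sub>r A"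
    using obs by (simp add: a.transfer_def a.left.L.image_inside[OF ha])
  also have "\<dots> = \<epsilon>\<^sub>l B \<cdot>\<^bsub>C\<^esub> fmor P h \<cdot>\<^bsub>C\<^esub> l.mate (fob F' A) \<cdot>\<^bsub>C\<^esub> \<eta>\<^sub>r' A"
    using obs r.mate_unit[of A] by (simp add: eq)
  also have "\<dots> = \<epsilon>\<^sub>l B \<cdot>\<^bsub>C\<^esub> l.mate (fob F B) \<cdot>\<^bsub>C\<^esub> fmor P' h \<cdot>\<^bsub>C\<^esub> \<eta>\<^sub>r' A"
    using obs l.mate_natural[of h]
      a.left.L.D.inside[of "fmor P h" "l.mate (fob F' A)" _ "\<eta>\<^sub>r' A"] by simp
  also have "\<dots> = \<epsilon>\<^sub>l' B \<cdot>\<^bsub>C\<^esub> fmor P' (\<alpha> B) \<cdot>\<^bsub>C\<^esub> fmor P' h \<cdot>\<^bsub>C\<^esub> \<eta>\<^sub>r' A"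
    using obs l.mate_counit[of B]
      a.left.L.D.inside[of "\<epsilon>\<^sub>l B" "l.mate (fob F B)" _ "fmor P' h \<cdot>\<^bsub>C\<^esub> \<eta>\<^sub>r' A"] by simp
  also have "\<dots> = b.transfer A B g'"
    using obs by (simp add: b.transfer_def b.left.L.image_inside[OF ah])
  finally show ?thesis .
qed

text \<open>Since the left mate of \<open>\<gamma>\<close> and the right mate of its inverse \<open>\<delta>\<close> compose to the identity, both may
  be inserted into \<open>U (transfer g)\<close>. By naturality of the left mate they can be moved next to the counit
  and the unit, where they are replaced by the counit and the unit of the other adjunctions.\<close>

theorem transfer_base_change:
  assumes "ambidextrous G H F P \<eta>\<^sub>l \<epsilon>\<^sub>l \<eta>\<^sub>r \<epsilon>\<^sub>r" "ambidextrous Q S F' P' \<eta>\<^sub>l' \<epsilon>\<^sub>l' \<eta>\<^sub>r' \<epsilon>\<^sub>r'"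
    and functors: "is_functor G Q U" "is_functor H S V"
    and nat: "nat_trans G S (comp_ftor V F) (comp_ftor F' U) \<gamma>"
      "nat_trans G S (comp_ftor F' U) (comp_ftor V F) \<delta>"
    and inv: "\<gamma> A \<cdot>\<^bsub>S\<^esub> \<delta> A = cid S (fob F' (fob U A))"
    and mates: "\<And>Y. Y \<in> obj H \<Longrightarrow>
      (\<epsilon>\<^sub>l' (fob U (fob P Y)) \<cdot>\<^bsub>Q\<^esub> fmor P' (\<gamma> (fob P Y)) \<cdot>\<^bsub>Q\<^esub> fmor P' (fmor V (\<eta>\<^sub>l Y))) \<cdot>\<^bsub>Q\<^esub>
      (fmor P' (fmor V (\<epsilon>\<^sub>r Y)) \<cdot>\<^bsub>Q\<^esub> fmor P' (\<delta> (fob P Y)) \<cdot>\<^bsub>Q\<^esub> \<eta>\<^sub>r' (fob U (fob P Y)))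
      = cid Q (fob U (fob P Y))"
    and obs: "A \<in> obj G" "B \<in> obj G"
    and g: "g \<in> chom H (fob F A) (fob F B)"
    and g': "g' \<in> chom S (fob F' (fob U A)) (fob F' (fob U B))"
    and intertwined: "\<gamma> B \<cdot>\<^bsub>S\<^esub> fmor V g = g' \<cdot>\<^bsub>S\<^esub> \<gamma> A"
  shows "fmor U (ambidextrous.transfer G P \<epsilon>\<^sub>l \<eta>\<^sub>r A B g)
    = ambidextrous.transfer Q P' \<epsilon>\<^sub>l' \<eta>\<^sub>r' (fob U A) (fob U B) g'"
proof -
  interpret a: ambidextrous G H F P \<eta>\<^sub>l \<epsilon>\<^sub>l \<eta>\<^sub>r \<epsilon>\<^sub>r by fact
  interpret b: ambidextrous Q S F' P' \<eta>\<^sub>l' \<epsilon>\<^sub>l' \<eta>\<^sub>r' \<epsilon>\<^sub>r' by fact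
  interpret l: left_mate H G P F \<eta>\<^sub>l \<epsilon>\<^sub>l S Q P' F' \<eta>\<^sub>l' \<epsilon>\<^sub>l' U V \<gamma>
    by unfold_locales (auto intro: nat functors)
  interpret r: right_mate G H F P \<eta>\<^sub>r \<epsilon>\<^sub>r Q S F' P' \<eta>\<^sub>r' \<epsilon>\<^sub>r' U V \<delta>
    by unfold_locales (auto intro: nat functors)
  have lr: "l.mate Y \<cdot>\<^bsub>Q\<^esub> r.mate Y = cid Q (fob U (fob P Y))" if "Y \<in> obj H" for Y
    using mates[OF that] by (simp add: l.mate_def r.mate_def)
  note hom [simp] = chomD[OF g, THEN conjunct1] chomD[OF g, THEN conjunct2, THEN conjunct1]
    chomD[OF g, THEN conjunct2, THEN conjunct2] chomD[OF g', THEN conjunct1]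
    chomD[OF g', THEN conjunct2, THEN conjunct1] chomD[OF g', THEN conjunct2, THEN conjunct2]
  have key: "\<gamma> B \<cdot>\<^bsub>S\<^esub> fmor V g \<cdot>\<^bsub>S\<^esub> \<delta> A = g'"
    using obs by (simp add: b.left.L.C.inside[OF intertwined] inv)
  have "fmor U (a.transfer A B g) = fmor U (\<epsilon>\<^sub>l B) \<cdot>\<^bsub>Q\<^esub> fmor U (fmor P g) \<cdot>\<^bsub>Q\<^esub> fmor U (\<eta>\<^sub>r A)"
    using obs by (simp add: a.transfer_def)
  also have "\<dots> = fmor U (\<epsilon>\<^sub>l B) \<cdot>\<^bsub>Q\<^esub> fmor U (fmor P g) \<cdot>\<^bsub>Q\<^esub>
      l.mate (fob F A) \<cdot>\<^bsub>Q\<^esub> r.mate (fob F A) \<cdot>\<^bsub>Q\<^esub> fmor U (\<eta>\<^sub>r A)"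
    using obs by (simp add: b.left.L.D.inside[OF lr])
  also have "\<dots> = fmor U (\<epsilon>\<^sub>l B) \<cdot>\<^bsub>Q\<^esub> l.mate (fob F B) \<cdot>\<^bsub>Q\<^esub> fmor P' (fmor V g) \<cdot>\<^bsub>Q\<^esub>
      r.mate (fob F A) \<cdot>\<^bsub>Q\<^esub> fmor U (\<eta>\<^sub>r A)"
    using obs l.mate_natural[of g]
      b.left.L.D.inside[of "fmor U (fmor P g)" "l.mate (fob F A)" _ "r.mate (fob F A) \<cdot>\<^bsub>Q\<^esub> fmor U (\<eta>\<^sub>r A)"]
    by simp
  also have "\<dots> = \<epsilon>\<^sub>l' (fob U B) \<cdot>\<^bsub>Q\<^esub> fmor P' (\<gamma> B) \<cdot>\<^bsub>Q\<^esub> fmor P' (fmor V g) \<cdot>\<^bsub>Q\<^esub>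
      fmor P' (\<delta> A) \<cdot>\<^bsub>Q\<^esub> \<eta>\<^sub>r' (fob U A)"
    using obs l.mate_counit[of B] r.mate_unit[of A]
      b.left.L.D.inside[of "fmor U (\<epsilon>\<^sub>l B)" "l.mate (fob F B)" _
        "fmor P' (fmor V g) \<cdot>\<^bsub>Q\<^esub> fmor P' (\<delta> A) \<cdot>\<^bsub>Q\<^esub> \<eta>\<^sub>r' (fob U A)"]
    by simp
  also have "\<dots> = b.transfer (fob U A) (fob U B) g'"
    using obs by (simp add: b.transfer_def key[symmetric])
  finally show ?thesis .
qed


section \<open>Transfers and tensor products\<close>

locale bifunctor = category C for C :: "('o, 'm, 'z) cat_scheme" (structure) +
  fixes ten :: "'o \<Rightarrow> 'o \<Rightarrow> 'o" and tenm :: "'m \<Rightarrow> 'm \<Rightarrow> 'm"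
  assumes ten_obj [simp]: "\<lbrakk>x \<in> obj C; y \<in> obj C\<rbrakk> \<Longrightarrow> ten x y \<in> obj C"
    and ten_arr [simp]: "\<lbrakk>f \<in> arr C; g \<in> arr C\<rbrakk> \<Longrightarrow> tenm f g \<in> arr C"
      "\<lbrakk>f \<in> arr C; g \<in> arr C\<rbrakk> \<Longrightarrow> cdom C (tenm f g) = ten (cdom C f) (cdom C g)"
      "\<lbrakk>f \<in> arr C; g \<in> arr C\<rbrakk> \<Longrightarrow> ccod C (tenm f g) = ten (ccod C f) (ccod C g)"
    and ten_id [simp]: "\<lbrakk>x \<in> obj C; y \<in> obj C\<rbrakk> \<Longrightarrow> tenm (cid C x) (cid C y) = cid C (ten x y)"
    and merge: "\<lbrakk>f \<in> arr C; f' \<in> arr C; g \<in> arr C; g' \<in> arr C; cdom C f' = ccod C f; cdom C g' = ccod C g\<rbrakk>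
      \<Longrightarrow> tenm f' g' \<cdot> tenm f g = tenm (f' \<cdot> f) (g' \<cdot> g)"
begin

lemma merge_inside:
  "\<lbrakk>f \<in> arr C; f' \<in> arr C; g \<in> arr C; g' \<in> arr C; cdom C f' = ccod C f; cdom C g' = ccod C g;
    r \<in> arr C; ccod C r = ten (cdom C f) (cdom C g)\<rbrakk>
    \<Longrightarrow> tenm f' g' \<cdot> tenm f g \<cdot> r = tenm (f' \<cdot> f) (g' \<cdot> g) \<cdot> r"
  by (rule inside) (auto simp: merge)

lemma ten_iso:
  assumes "iso_arrow C f" "iso_arrow C g"
  shows "inverse_arrows C (tenm f g) (tenm (cinv C f) (cinv C g))"
  using assms by (simp add: inverse_arrows_def chom_iff merge)

lemma ten_cinv [simp]:
  assumes "iso_arrow C f" "iso_arrow C g"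
  shows "iso_arrow C (tenm f g)" "cinv C (tenm f g) = tenm (cinv C f) (cinv C g)"
  using ten_iso[OF assms] by (auto simp: iso_arrow_def intro: cinv_eq)

lemma flip: "bifunctor C (\<lambda>x y. ten y x) (\<lambda>f g. tenm g f)"
  by unfold_locales (auto simp: merge)

end

text \<open>The tensor products enter as mere bifunctors, so that the projection formula for transfers in the
  first factor results from the one for the second factor by exchanging the two variables.\<close>

locale tensor_compatible =
  ambidextrous C D F P \<eta>\<^sub>l \<epsilon>\<^sub>l \<eta>\<^sub>r \<epsilon>\<^sub>r + C: bifunctor C ten tenm + D: bifunctor D ten' tenm'
  for C D F P \<eta>\<^sub>l \<epsilon>\<^sub>l \<eta>\<^sub>r \<epsilon>\<^sub>r ten tenm ten' tenm' +
  fixes \<phi>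
  assumes phi_hom: "\<lbrakk>x \<in> obj C; y \<in> obj C\<rbrakk>
      \<Longrightarrow> \<phi> x y \<in> chom D (fob F (ten x y)) (ten' (fob F x) (fob F y))"
    and phi_iso [simp]: "\<lbrakk>x \<in> obj C; y \<in> obj C\<rbrakk> \<Longrightarrow> iso_arrow D (\<phi> x y)"
    and phi_natural: "\<lbrakk>f \<in> arr C; g \<in> arr C\<rbrakk> \<Longrightarrow> \<phi> (ccod C f) (ccod C g) \<cdot>\<^bsub>D\<^esub> fmor F (tenm f g)
      = tenm' (fmor F f) (fmor F g) \<cdot>\<^bsub>D\<^esub> \<phi> (cdom C f) (cdom C g)"
begin

lemma phi [simp]:
  assumes "x \<in> obj C" "y \<in> obj C"
  shows "\<phi> x y \<in> arr D" "cdom D (\<phi> x y) = fob F (ten x y)" "ccod D (\<phi> x y) = ten' (fob F x) (fob F y)"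
  using phi_hom[OF assms] by (auto simp: chom_iff)

lemma phi_inv_natural:
  assumes "f \<in> arr C" "g \<in> arr C"
  shows "fmor F (tenm f g) \<cdot>\<^bsub>D\<^esub> cinv D (\<phi> (cdom C f) (cdom C g))
      = cinv D (\<phi> (ccod C f) (ccod C g)) \<cdot>\<^bsub>D\<^esub> tenm' (fmor F f) (fmor F g)"
proof (rule left.L.C.iso_cancel_left[of "\<phi> (ccod C f) (ccod C g)"])
  show "\<phi> (ccod C f) (ccod C g) \<cdot>\<^bsub>D\<^esub> fmor F (tenm f g) \<cdot>\<^bsub>D\<^esub> cinv D (\<phi> (cdom C f) (cdom C g)) =
    \<phi> (ccod C f) (ccod C g) \<cdot>\<^bsub>D\<^esub> cinv D (\<phi> (ccod C f) (ccod C g)) \<cdot>\<^bsub>D\<^esub> tenm' (fmor F f) (fmor F g)"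
    using assms by (simp add: left.L.C.inside[OF phi_natural])
qed (use assms in auto)

definition "Rproj A Y =
  fmor P (tenm' (cid D (fob F A)) (\<epsilon>\<^sub>r Y)) \<cdot>\<^bsub>C\<^esub> fmor P (\<phi> A (fob P Y)) \<cdot>\<^bsub>C\<^esub> \<eta>\<^sub>r (ten A (fob P Y))"

definition "Lproj A Y =
  \<epsilon>\<^sub>l (ten A (fob P Y)) \<cdot>\<^bsub>C\<^esub> fmor P (cinv D (\<phi> A (fob P Y))) \<cdot>\<^bsub>C\<^esub> fmor P (tenm' (cid D (fob F A)) (\<eta>\<^sub>l Y))"

lemma proj_hom [simp]:
  assumes "A \<in> obj C" "Y \<in> obj D"
  shows "Rproj A Y \<in> arr C" "cdom C (Rproj A Y) = ten A (fob P Y)" "ccod C (Rproj A Y) = fob P (ten' (fob F A) Y)"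
    "Lproj A Y \<in> arr C" "cdom C (Lproj A Y) = fob P (ten' (fob F A) Y)" "ccod C (Lproj A Y) = ten A (fob P Y)"
  using assms by (auto simp: Rproj_def Lproj_def)

lemma Rproj_natural:
  assumes f: "f \<in> arr C" and g: "g \<in> arr D"
  shows "Rproj (ccod C f) (ccod D g) \<cdot>\<^bsub>C\<^esub> tenm f (fmor P g)
    = fmor P (tenm' (fmor F f) g) \<cdot>\<^bsub>C\<^esub> Rproj (cdom C f) (cdom D g)"
proof -
  have 1: "\<eta>\<^sub>r (ten (ccod C f) (fob P (ccod D g))) \<cdot>\<^bsub>C\<^esub> tenm f (fmor P g)
      = fmor P (fmor F (tenm f (fmor P g))) \<cdot>\<^bsub>C\<^esub> \<eta>\<^sub>r (ten (cdom C f) (fob P (cdom D g)))"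
    using right.unit_natural[of "tenm f (fmor P g)"] f g by simp
  have 2: "\<phi> (ccod C f) (fob P (ccod D g)) \<cdot>\<^bsub>D\<^esub> fmor F (tenm f (fmor P g))
      = tenm' (fmor F f) (fmor F (fmor P g)) \<cdot>\<^bsub>D\<^esub> \<phi> (cdom C f) (fob P (cdom D g))"
    using phi_natural[of f "fmor P g"] f g by simp
  have 3: "tenm' (cid D (fob F (ccod C f))) (\<epsilon>\<^sub>r (ccod D g)) \<cdot>\<^bsub>D\<^esub> tenm' (fmor F f) (fmor F (fmor P g))
      = tenm' (fmor F f) g \<cdot>\<^bsub>D\<^esub> tenm' (cid D (fob F (cdom C f))) (\<epsilon>\<^sub>r (cdom D g))"
    using f g right.counit_natural[OF g] by (simp add: D.merge)
  show ?thesis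
    using f g by (simp add: Rproj_def 1 left.L.image_inside[OF 2] left.L.image_inside[OF 3])
qed

text \<open>Up to \<open>\<phi>\<close>, the maps \<open>Rproj\<close> and \<open>Lproj\<close> are the transposes of \<open>F A \<otimes> \<epsilon>\<^sub>r\<close> and \<open>F A \<otimes> \<eta>\<^sub>l\<close>. By the
  triangle identities they relate the unit and the counit at \<open>A \<otimes> B\<close> to those at \<open>B\<close>.\<close>

lemma Rproj_unit:
  assumes "A \<in> obj C" "B \<in> obj C"
  shows "Rproj A (fob F B) \<cdot>\<^bsub>C\<^esub> tenm (cid C A) (\<eta>\<^sub>r B) = fmor P (\<phi> A B) \<cdot>\<^bsub>C\<^esub> \<eta>\<^sub>r (ten A B)"
proof -
  have 1: "\<eta>\<^sub>r (ten A (fob P (fob F B))) \<cdot>\<^bsub>C\<^esub> tenm (cid C A) (\<eta>\<^sub>r B)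
      = fmor P (fmor F (tenm (cid C A) (\<eta>\<^sub>r B))) \<cdot>\<^bsub>C\<^esub> \<eta>\<^sub>r (ten A B)"
    using right.unit_natural[of "tenm (cid C A) (\<eta>\<^sub>r B)"] assms by simp
  have 2: "\<phi> A (fob P (fob F B)) \<cdot>\<^bsub>D\<^esub> fmor F (tenm (cid C A) (\<eta>\<^sub>r B))
      = tenm' (cid D (fob F A)) (fmor F (\<eta>\<^sub>r B)) \<cdot>\<^bsub>D\<^esub> \<phi> A B"
    using phi_natural[of "cid C A" "\<eta>\<^sub>r B"] assms by simp
  have 3: "tenm' (cid D (fob F A)) (\<epsilon>\<^sub>r (fob F B)) \<cdot>\<^bsub>D\<^esub> tenm' (cid D (fob F A)) (fmor F (\<eta>\<^sub>r B))
      = cid D (ten' (fob F A) (fob F B))"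
    using assms by (simp add: D.merge)
  show ?thesis
    using assms by (simp add: Rproj_def 1 left.L.image_inside[OF 2] left.L.image_inside[OF 3])
qed

lemma Lproj_counit:
  assumes "A \<in> obj C" "B \<in> obj C"
  shows "tenm (cid C A) (\<epsilon>\<^sub>l B) \<cdot>\<^bsub>C\<^esub> Lproj A (fob F B) = \<epsilon>\<^sub>l (ten A B) \<cdot>\<^bsub>C\<^esub> fmor P (cinv D (\<phi> A B))"
proof -
  have 1: "tenm (cid C A) (\<epsilon>\<^sub>l B) \<cdot>\<^bsub>C\<^esub> \<epsilon>\<^sub>l (ten A (fob P (fob F B)))
      = \<epsilon>\<^sub>l (ten A B) \<cdot>\<^bsub>C\<^esub> fmor P (fmor F (tenm (cid C A) (\<epsilon>\<^sub>l B)))"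
    using left.counit_natural[of "tenm (cid C A) (\<epsilon>\<^sub>l B)"] assms by simp
  have 2: "fmor F (tenm (cid C A) (\<epsilon>\<^sub>l B)) \<cdot>\<^bsub>D\<^esub> cinv D (\<phi> A (fob P (fob F B)))
      = cinv D (\<phi> A B) \<cdot>\<^bsub>D\<^esub> tenm' (cid D (fob F A)) (fmor F (\<epsilon>\<^sub>l B))"
    using phi_inv_natural[of "cid C A" "\<epsilon>\<^sub>l B"] assms by simp
  have 3: "tenm' (cid D (fob F A)) (fmor F (\<epsilon>\<^sub>l B)) \<cdot>\<^bsub>D\<^esub> tenm' (cid D (fob F A)) (\<eta>\<^sub>l (fob F B))
      = cid D (ten' (fob F A) (fob F B))"
    using assms by (simp add: D.merge)
  show ?thesis
    using assms by (simp add: Lproj_def left.L.D.inside[OF 1] left.L.image_inside[OF 2] left.L.image_eq[OF 3])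
qed

text \<open>With \<open>Lproj Rproj = id\<close> inserted in the middle of \<open>f \<otimes> transfer g\<close>, \<open>Lproj\<close> turns the counit at \<open>B'\<close>
  into that at \<open>A' \<otimes> B'\<close>, and \<open>Rproj\<close>, moved past \<open>f \<otimes> P g\<close> by naturality, does the same with the unit.\<close>

theorem transfer_projection:
  assumes inv: "\<And>A Y. \<lbrakk>A \<in> obj C; Y \<in> obj D\<rbrakk> \<Longrightarrow> Lproj A Y \<cdot>\<^bsub>C\<^esub> Rproj A Y = cid C (ten A (fob P Y))"
    and f: "f \<in> arr C" and B: "B \<in> obj C" "B' \<in> obj C" and g: "g \<in> chom D (fob F B) (fob F B')"
  shows "tenm f (transfer B B' g) = transfer (ten (cdom C f) B) (ten (ccod C f) B')
    (cinv D (\<phi> (ccod C f) B') \<cdot>\<^bsub>D\<^esub> tenm' (fmor F f) g \<cdot>\<^bsub>D\<^esub> \<phi> (cdom C f) B)"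
proof -
  have g [simp]: "g \<in> arr D" "cdom D g = fob F B" "ccod D g = fob F B'"
    using g by (auto simp: chom_iff)
  let ?A = "cdom C f" and ?A' = "ccod C f"
  have "tenm f (transfer B B' g)
      = tenm (cid C ?A') (\<epsilon>\<^sub>l B') \<cdot>\<^bsub>C\<^esub> tenm f (fmor P g) \<cdot>\<^bsub>C\<^esub> tenm (cid C ?A) (\<eta>\<^sub>r B)"
    using f B by (simp add: transfer_def C.merge)
  also have "\<dots> = tenm (cid C ?A') (\<epsilon>\<^sub>l B') \<cdot>\<^bsub>C\<^esub> Lproj ?A' (fob F B') \<cdot>\<^bsub>C\<^esub> Rproj ?A' (fob F B') \<cdot>\<^bsub>C\<^esub>
      tenm f (fmor P g) \<cdot>\<^bsub>C\<^esub> tenm (cid C ?A) (\<eta>\<^sub>r B)"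
    using f B by (simp add: left.L.D.inside[OF inv])
  also have "\<dots> = \<epsilon>\<^sub>l (ten ?A' B') \<cdot>\<^bsub>C\<^esub> fmor P (cinv D (\<phi> ?A' B')) \<cdot>\<^bsub>C\<^esub> Rproj ?A' (fob F B') \<cdot>\<^bsub>C\<^esub>
      tenm f (fmor P g) \<cdot>\<^bsub>C\<^esub> tenm (cid C ?A) (\<eta>\<^sub>r B)"
    using f B by (simp add: left.L.D.inside[OF Lproj_counit])
  also have "\<dots> = \<epsilon>\<^sub>l (ten ?A' B') \<cdot>\<^bsub>C\<^esub> fmor P (cinv D (\<phi> ?A' B')) \<cdot>\<^bsub>C\<^esub> fmor P (tenm' (fmor F f) g) \<cdot>\<^bsub>C\<^esub>
      Rproj ?A (fob F B) \<cdot>\<^bsub>C\<^esub> tenm (cid C ?A) (\<eta>\<^sub>r B)"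
    using f B Rproj_natural[OF f g(1)]
      left.L.D.inside[of "Rproj ?A' (fob F B')" "tenm f (fmor P g)" _ "tenm (cid C ?A) (\<eta>\<^sub>r B)"] by simp
  also have "\<dots> = \<epsilon>\<^sub>l (ten ?A' B') \<cdot>\<^bsub>C\<^esub> fmor P (cinv D (\<phi> ?A' B')) \<cdot>\<^bsub>C\<^esub> fmor P (tenm' (fmor F f) g) \<cdot>\<^bsub>C\<^esub>
      fmor P (\<phi> ?A B) \<cdot>\<^bsub>C\<^esub> \<eta>\<^sub>r (ten ?A B)"
    using f B by (simp add: Rproj_unit)
  also have "\<dots> = transfer (ten ?A B) (ten ?A' B')
      (cinv D (\<phi> ?A' B') \<cdot>\<^bsub>D\<^esub> tenm' (fmor F f) g \<cdot>\<^bsub>D\<^esub> \<phi> ?A B)"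
    using f B by (simp add: transfer_def)
  finally show ?thesis .
qed

end


section \<open>Decompositions of a category into a product\<close>

text \<open>Zero objects in terms of universal properties, the form in which decompositions of plain
  categories can use them.\<close>

definition null_obj :: "('o, 'm, 'z) cat_scheme \<Rightarrow> 'o \<Rightarrow> bool"
  where "null_obj C z \<longleftrightarrow> z \<in> obj C \<and>
    (\<forall>x \<in> obj C. (\<exists>!f. f \<in> chom C x z) \<and> (\<exists>!f. f \<in> chom C z x))"

lemma null_obj_unique:
  assumes "null_obj C z" "f \<in> arr C" "g \<in> arr C" "cdom C f = cdom C g" "ccod C f = ccod C g"
    "category C" "cdom C f = z \<or> ccod C f = z"
  shows "f = g"
proof -
  interpret category C by fact
  have "f \<in> chom C (cdom C f) (ccod C f)" "g \<in> chom C (cdom C f) (ccod C f)"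
    "cdom C f \<in> obj C" "ccod C f \<in> obj C"
    using assms by (auto simp: chom_iff)
  with assms(1,7) show ?thesis unfolding null_obj_def by blast
qed

lemma null_obj_iso:
  assumes "null_obj C z" "iso_arrow C t" "cdom C t = z" "category C"
  shows "null_obj C (ccod C t)"
proof -
  interpret category C by fact
  note [simp] = inverse[OF assms(2)]
  have into: "\<exists>!f. f \<in> chom C x (ccod C t)" if x: "x \<in> obj C" for x
  proof (rule ex_ex1I)
    obtain f where "f \<in> chom C x z" using assms(1) x by (auto simp: null_obj_def)
    then show "\<exists>f. f \<in> chom C x (ccod C t)"
      using assms(3) by (intro exI[of _ "t \<cdot>\<^bsub>C\<^esub> f"]) (simp add: chom_iff)
  next
    fix f g assume fg: "f \<in> chom C x (ccod C t)" "g \<in> chom C x (ccod C t)"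
    have "cinv C t \<cdot>\<^bsub>C\<^esub> f = cinv C t \<cdot>\<^bsub>C\<^esub> g"
      by (rule null_obj_unique[OF assms(1)]) (use fg assms in \<open>auto simp: chom_iff\<close>)
    then have "t \<cdot>\<^bsub>C\<^esub> cinv C t \<cdot>\<^bsub>C\<^esub> f = t \<cdot>\<^bsub>C\<^esub> cinv C t \<cdot>\<^bsub>C\<^esub> g" by (rule arg_cong)
    then show "f = g" using fg assms(2) by (simp add: chom_iff)
  qed
  have outof: "\<exists>!f. f \<in> chom C (ccod C t) x" if x: "x \<in> obj C" for x
  proof (rule ex_ex1I)
    obtain f where "f \<in> chom C z x" using assms(1) x by (auto simp: null_obj_def)
    then show "\<exists>f. f \<in> chom C (ccod C t) x"
      using assms(3) by (intro exI[of _ "f \<cdot>\<^bsub>C\<^esub> cinv C t"]) (simp add: chom_iff)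
  next
    fix f g assume fg: "f \<in> chom C (ccod C t) x" "g \<in> chom C (ccod C t) x"
    have "f \<cdot>\<^bsub>C\<^esub> t = g \<cdot>\<^bsub>C\<^esub> t"
      by (rule null_obj_unique[OF assms(1)]) (use fg assms in \<open>auto simp: chom_iff\<close>)
    then show "f = g"
      using fg assms(2) by - (rule iso_cancel_right[of t f g], auto simp: chom_iff)
  qed
  show ?thesis
    using into outof by (simp add: null_obj_def)
qed

lemma equivalence_faithful:
  assumes "is_equivalence C D F" "f \<in> arr C" "f' \<in> arr C" "cdom C f = cdom C f'" "ccod C f = ccod C f'"
    "fmor F f = fmor F f'"
  shows "f = f'"
proof -
  obtain K s where K: "is_functor C D F" "is_functor D C K" "nat_iso C C id_ftor (comp_ftor K F) s"
    using assms(1) by (auto simp: is_equivalence_def)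
  interpret F: ftor C D F + K: ftor D C K using K by (auto intro: ftorI)
  have snat: "nat_trans C C id_ftor (comp_ftor K F) s" and i: "\<And>x. x \<in> obj C \<Longrightarrow> iso_arrow C (s x)"
    using K by (auto simp: nat_iso_def)
  note s = nat_transD[OF snat, unfolded comp_ftor_apply id_ftor_apply]
  have "s (ccod C f) \<cdot>\<^bsub>C\<^esub> f = s (ccod C f) \<cdot>\<^bsub>C\<^esub> f'"
    using s(4)[of f] s(4)[of f'] assms by simp
  then show ?thesis
    using assms by - (rule F.C.iso_cancel_left[of "s (ccod C f)" f f'], auto simp: i s(1-3))
qed

lemma equivalence_full_ess:
  assumes E: "is_equivalence C D F"
  shows "\<lbrakk>x \<in> obj C; y \<in> obj C; g \<in> chom D (fob F x) (fob F y)\<rbrakk> \<Longrightarrow> \<exists>f \<in> chom C x y. fmor F f = g"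
    and "d \<in> obj D \<Longrightarrow> \<exists>x \<in> obj C. \<exists>t \<in> chom D d (fob F x). iso_arrow D t"
proof -
  obtain K s t where K: "is_functor C D F" "is_functor D C K" "nat_iso C C id_ftor (comp_ftor K F) s"
    "nat_iso D D (comp_ftor F K) id_ftor t"
    using E by (auto simp: is_equivalence_def)
  interpret F: ftor C D F + K: ftor D C K using K by (auto intro: ftorI)
  have snat: "nat_trans C C id_ftor (comp_ftor K F) s" and si: "\<And>x. x \<in> obj C \<Longrightarrow> iso_arrow C (s x)"
    and tnat: "nat_trans D D (comp_ftor F K) id_ftor t" and ti: "\<And>x. x \<in> obj D \<Longrightarrow> iso_arrow D (t x)"
    using K by (auto simp: nat_iso_def)
  note s = nat_transD[OF snat, unfolded comp_ftor_apply id_ftor_apply]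
    and t = nat_transD[OF tnat, unfolded comp_ftor_apply id_ftor_apply]
  note [simp] = s(1-3) t(1-3) si ti
  show "\<exists>f \<in> chom C x y. fmor F f = g"
    if x: "x \<in> obj C" "y \<in> obj C" and g: "g \<in> chom D (fob F x) (fob F y)" for x y g
  proof -
    have [simp]: "g \<in> arr D" "cdom D g = fob F x" "ccod D g = fob F y" using g by (auto simp: chom_iff)
    define f where "f = cinv C (s y) \<cdot>\<^bsub>C\<^esub> fmor K g \<cdot>\<^bsub>C\<^esub> s x"
    have f [simp]: "f \<in> arr C" "cdom C f = x" "ccod C f = y" using x by (auto simp: f_def)
    have "fmor K (fmor F f) \<cdot>\<^bsub>C\<^esub> s x = s y \<cdot>\<^bsub>C\<^esub> f" using s(4)[OF f(1)] by simp
    also have "\<dots> = fmor K g \<cdot>\<^bsub>C\<^esub> s x" using x by (simp add: f_def)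
    finally have "fmor K (fmor F f) = fmor K g"
      using x by - (rule F.C.iso_cancel_right[of "s x"], auto)
    then have "fmor F f \<cdot>\<^bsub>D\<^esub> t (fob F x) = g \<cdot>\<^bsub>D\<^esub> t (fob F x)"
      using t(4)[of "fmor F f"] t(4)[of g] by simp
    then have "fmor F f = g"
      using x by - (rule F.D.iso_cancel_right[of "t (fob F x)"], auto)
    then show ?thesis using f by (blast intro: chomI)
  qed
  show "\<exists>x \<in> obj C. \<exists>t \<in> chom D d (fob F x). iso_arrow D t" if d: "d \<in> obj D"
  proof -
    have "inverse_arrows D (cinv D (t d)) (t d)"
      using d by (simp add: inverse_arrows_def chom_iff)
    then have "iso_arrow D (cinv D (t d))" by (auto simp: iso_arrow_def)
    moreover have "cinv D (t d) \<in> chom D d (fob F (fob K d))" using d by (simp add: chom_iff)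
    ultimately show ?thesis using d by (intro bexI[of _ "fob K d"]) auto
  qed
qed

text \<open>What it means for \<open>(F\<^sub>1, F\<^sub>2)\<close> to be an equivalence from \<open>C\<close> to \<open>D\<^sub>1 \<times> D\<^sub>2\<close>, in a form that is visibly
  symmetric in the two factors.\<close>

locale category_decomposition = F\<^sub>1: ftor C D\<^sub>1 F\<^sub>1 + F\<^sub>2: ftor C D\<^sub>2 F\<^sub>2
  for C :: "('o, 'm, 'z) cat_scheme" and D\<^sub>1 :: "('p, 'n, 'y) cat_scheme" and F\<^sub>1
    and D\<^sub>2 :: "('q, 'r, 'x) cat_scheme" and F\<^sub>2 +
  assumes faithful: "\<lbrakk>f \<in> arr C; f' \<in> arr C; cdom C f = cdom C f'; ccod C f = ccod C f';
      fmor F\<^sub>1 f = fmor F\<^sub>1 f'; fmor F\<^sub>2 f = fmor F\<^sub>2 f'\<rbrakk> \<Longrightarrow> f = f'"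
    and full: "\<lbrakk>x \<in> obj C; y \<in> obj C; g \<in> chom D\<^sub>1 (fob F\<^sub>1 x) (fob F\<^sub>1 y); h \<in> chom D\<^sub>2 (fob F\<^sub>2 x) (fob F\<^sub>2 y)\<rbrakk>
      \<Longrightarrow> \<exists>f \<in> chom C x y. fmor F\<^sub>1 f = g \<and> fmor F\<^sub>2 f = h"
    and essentially_surjective: "\<lbrakk>a \<in> obj D\<^sub>1; b \<in> obj D\<^sub>2\<rbrakk> \<Longrightarrow> \<exists>x \<in> obj C.
      (\<exists>s \<in> chom D\<^sub>1 a (fob F\<^sub>1 x). iso_arrow D\<^sub>1 s) \<and> (\<exists>t \<in> chom D\<^sub>2 b (fob F\<^sub>2 x). iso_arrow D\<^sub>2 t)"
begin

lemma swap: "category_decomposition C D\<^sub>2 F\<^sub>2 D\<^sub>1 F\<^sub>1"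
proof
  show "f = f'" if "f \<in> arr C" "f' \<in> arr C" "cdom C f = cdom C f'" "ccod C f = ccod C f'"
    "fmor F\<^sub>2 f = fmor F\<^sub>2 f'" "fmor F\<^sub>1 f = fmor F\<^sub>1 f'" for f f'
    using that by (intro faithful)
  show "\<exists>f \<in> chom C x y. fmor F\<^sub>2 f = g \<and> fmor F\<^sub>1 f = h"
    if "x \<in> obj C" "y \<in> obj C" "g \<in> chom D\<^sub>2 (fob F\<^sub>2 x) (fob F\<^sub>2 y)" "h \<in> chom D\<^sub>1 (fob F\<^sub>1 x) (fob F\<^sub>1 y)"
    for x y g h
    using full[OF that(1,2,4,3)] by blast
  show "\<exists>x \<in> obj C. (\<exists>s \<in> chom D\<^sub>2 a (fob F\<^sub>2 x). iso_arrow D\<^sub>2 s) \<and> (\<exists>t \<in> chom D\<^sub>1 b (fob F\<^sub>1 x). iso_arrow D\<^sub>1 t)"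
    if "a \<in> obj D\<^sub>2" "b \<in> obj D\<^sub>1" for a b
    using essentially_surjective[OF that(2,1)] by blast
qed

end

lemma category_decompositionI:
  fixes Ds :: "nat \<Rightarrow> ('p, 'n, 'z) cat_scheme"
  assumes E: "is_equivalence C (pi_cat {..<2} Ds)
      \<lparr>fob = (\<lambda>X. \<lambda>l \<in> {..<2}. fob (Fs l) X), fmor = (\<lambda>f. \<lambda>l \<in> {..<2}. fmor (Fs l) f)\<rparr>"
    and F: "is_functor C (Ds 0) (Fs 0)" "is_functor C (Ds 1) (Fs 1)"
  shows "category_decomposition C (Ds 0) (Fs 0) (Ds 1) (Fs 1)"
proof -
  interpret F1: ftor C "Ds 0" "Fs 0" + F2: ftor C "Ds 1" "Fs 1" using F by (auto intro: ftorI)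
  have two: "{..<2} = {0, 1 :: nat}" by auto
  show ?thesis
  proof
    fix f f'
    assume "f \<in> arr C" "f' \<in> arr C" "cdom C f = cdom C f'" "ccod C f = ccod C f'"
      "fmor (Fs 0) f = fmor (Fs 0) f'" "fmor (Fs 1) f = fmor (Fs 1) f'"
    then show "f = f'"
      by (intro equivalence_faithful[OF E]) (auto simp: two intro!: restrict_ext)
  next
    fix x y g h
    assume xy: "x \<in> obj C" "y \<in> obj C"
      and gh: "g \<in> chom (Ds 0) (fob (Fs 0) x) (fob (Fs 0) y)" "h \<in> chom (Ds 1) (fob (Fs 1) x) (fob (Fs 1) y)"
    let ?gh = "\<lambda>l \<in> {..<2}. if l = 0 then g else h"
    have "\<exists>f \<in> chom C x y. fmor \<lparr>fob = (\<lambda>X. \<lambda>l \<in> {..<2}. fob (Fs l) X), fmor = (\<lambda>f. \<lambda>l \<in> {..<2}. fmor (Fs l) f)\<rparr> f = ?gh"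
      using xy gh by (intro equivalence_full_ess(1)[OF E])
        (auto simp: chom_iff pi_cat_def two PiE_iff intro!: restrict_ext)
    then obtain f where f: "f \<in> chom C x y" "(\<lambda>l \<in> {..<2}. fmor (Fs l) f) = ?gh" by auto
    have "fmor (Fs 0) f = g" "fmor (Fs 1) f = h"
      using fun_cong[OF f(2), of 0] fun_cong[OF f(2), of 1] by auto
    with f show "\<exists>f \<in> chom C x y. fmor (Fs 0) f = g \<and> fmor (Fs 1) f = h" by blast
  next
    fix a b assume ab: "a \<in> obj (Ds 0)" "b \<in> obj (Ds 1)"
    let ?ab = "\<lambda>l \<in> {..<2}. if l = 0 then a else b"
    have "?ab \<in> obj (pi_cat {..<2} Ds)" using ab by (auto simp: pi_cat_def two)
    from equivalence_full_ess(2)[OF E this] obtain x t where x: "x \<in> obj C"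
      and t: "t \<in> chom (pi_cat {..<2} Ds) ?ab (\<lambda>l \<in> {..<2}. fob (Fs l) x)" "iso_arrow (pi_cat {..<2} Ds) t"
      by auto
    obtain t' where t': "inverse_arrows (pi_cat {..<2} Ds) t t'" using t(2) by (auto simp: iso_arrow_def)
    note d = t(1)[unfolded chom_iff] t'[unfolded inverse_arrows_def chom_iff]
    have comp: "t l \<in> chom (Ds l) (if l = 0 then a else b) (fob (Fs l) x) \<and> iso_arrow (Ds l) (t l)"
      if l: "l \<in> {..<2}" for l
    proof -
      have 1: "t l \<in> arr (Ds l)" "t' l \<in> arr (Ds l)"
        using d l by (auto simp: pi_cat_def)
      have 2: "cdom (Ds l) (t l) = (if l = 0 then a else b)" "ccod (Ds l) (t l) = fob (Fs l) x"
        using d(1)[THEN conjunct2, THEN conjunct1, THEN fun_cong, of l]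
          d(1)[THEN conjunct2, THEN conjunct2, THEN fun_cong, of l] l by (auto simp: pi_cat_def)
      have e: "cdom (pi_cat {..<2} Ds) t' = ccod (pi_cat {..<2} Ds) t"
        "ccod (pi_cat {..<2} Ds) t' = cdom (pi_cat {..<2} Ds) t"
        "t' \<cdot>\<^bsub>pi_cat {..<2} Ds\<^esub> t = cid (pi_cat {..<2} Ds) (cdom (pi_cat {..<2} Ds) t)"
        "t \<cdot>\<^bsub>pi_cat {..<2} Ds\<^esub> t' = cid (pi_cat {..<2} Ds) (ccod (pi_cat {..<2} Ds) t)"
        using d(2) by auto
      have 3: "inverse_arrows (Ds l) (t l) (t' l)"
        using e[THEN fun_cong, of l] 1 l by (simp add: pi_cat_def inverse_arrows_def chom_iff)
      show ?thesis using 1 2 3 by (auto simp: chom_iff iso_arrow_def)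
    qed
    show "\<exists>x \<in> obj C. (\<exists>s \<in> chom (Ds 0) a (fob (Fs 0) x). iso_arrow (Ds 0) s) \<and>
        (\<exists>t \<in> chom (Ds 1) b (fob (Fs 1) x). iso_arrow (Ds 1) t)"
      using comp[of 0] comp[of 1] x by auto
  qed
qed

text \<open>A left adjoint of \<open>F\<^sub>1\<close> must send \<open>a\<close> to an object corresponding to \<open>(a, 0)\<close>, because that object has
  the universal property of \<open>L a\<close>.\<close>

lemma (in category_decomposition) adjoint_unit_iso:
  assumes "adjunction D\<^sub>1 C L F\<^sub>1 \<eta> \<epsilon>" and a: "a \<in> obj D\<^sub>1" and z: "null_obj D\<^sub>2 z"
  shows "iso_arrow D\<^sub>1 (\<eta> a)" "null_obj D\<^sub>2 (fob F\<^sub>2 (fob L a))"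
proof -
  interpret a: adjoint_pair D\<^sub>1 C L F\<^sub>1 \<eta> \<epsilon> by (rule adjoint_pairI) fact
  obtain x s t where x: "x \<in> obj C" and s: "s \<in> chom D\<^sub>1 a (fob F\<^sub>1 x)" "iso_arrow D\<^sub>1 s"
    and t: "t \<in> chom D\<^sub>2 z (fob F\<^sub>2 x)" "iso_arrow D\<^sub>2 t"
    using essentially_surjective[OF a, of z] z by (auto simp: null_obj_def)
  have s' [simp]: "s \<in> arr D\<^sub>1" "cdom D\<^sub>1 s = a" "ccod D\<^sub>1 s = fob F\<^sub>1 x" using s by (auto simp: chom_iff)
  have null: "null_obj D\<^sub>2 (fob F\<^sub>2 x)"
    using null_obj_iso[OF z t(2)] t(1) by (simp add: chom_iff F\<^sub>2.D.category_axioms)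
  \<comment> \<open>The object \<open>x\<close> corresponds to \<open>(a, 0)\<close>, and \<open>p: L a \<rightarrow> x\<close> is the transpose of \<open>s: a \<rightarrow> F\<^sub>1 x\<close>. Its
    inverse \<open>f\<close> is the arrow that corresponds to \<open>(\<eta> a s\<^sup>-\<^sup>1, 0)\<close>.\<close>
  define p where "p = \<epsilon> x \<cdot>\<^bsub>C\<^esub> fmor L s"
  have p [simp]: "p \<in> arr C" "cdom C p = fob L a" "ccod C p = x"
    using x by (auto simp: p_def)
  have pe: "fmor F\<^sub>1 p \<cdot>\<^bsub>D\<^sub>1\<^esub> \<eta> a = s"
    using x a a.unit_natural[of s, symmetric] by (simp add: p_def F\<^sub>1.D.inside[OF a.triangles(2)])
  obtain k where k: "k \<in> chom D\<^sub>2 (fob F\<^sub>2 x) (fob F\<^sub>2 (fob L a))"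
    using null a F\<^sub>2.pres(1)[OF a.L.pres(1)[OF a]] unfolding null_obj_def by blast
  have "\<eta> a \<cdot>\<^bsub>D\<^sub>1\<^esub> cinv D\<^sub>1 s \<in> chom D\<^sub>1 (fob F\<^sub>1 x) (fob F\<^sub>1 (fob L a))"
    using s a by (simp add: chom_iff)
  from full[OF x a.L.pres(1)[OF a] this k]
  obtain f where f: "f \<in> chom C x (fob L a)" "fmor F\<^sub>1 f = \<eta> a \<cdot>\<^bsub>D\<^sub>1\<^esub> cinv D\<^sub>1 s" by auto
  have f' [simp]: "f \<in> arr C" "cdom C f = x" "ccod C f = fob L a" using f by (auto simp: chom_iff)
  have pf: "p \<cdot>\<^bsub>C\<^esub> f = cid C x"
  proof (rule faithful)
    show "fmor F\<^sub>1 (p \<cdot>\<^bsub>C\<^esub> f) = fmor F\<^sub>1 (cid C x)"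
      using x a s by (simp add: f(2) F\<^sub>1.D.inside[OF pe])
    show "fmor F\<^sub>2 (p \<cdot>\<^bsub>C\<^esub> f) = fmor F\<^sub>2 (cid C x)"
      by (rule null_obj_unique[OF null]) (use x in \<open>auto simp: F\<^sub>2.D.category_axioms\<close>)
  qed (use x in auto)
  have fp: "f \<cdot>\<^bsub>C\<^esub> p = cid C (fob L a)"
  proof -
    define e where "e = f \<cdot>\<^bsub>C\<^esub> p"
    have e [simp]: "e \<in> arr C" "cdom C e = fob L a" "ccod C e = fob L a" using a by (auto simp: e_def)
    have 1: "fmor F\<^sub>1 e \<cdot>\<^bsub>D\<^sub>1\<^esub> \<eta> a = \<eta> a"
      using a s by (simp add: e_def f(2) pe)
    have "e = e \<cdot>\<^bsub>C\<^esub> \<epsilon> (fob L a) \<cdot>\<^bsub>C\<^esub> fmor L (\<eta> a)"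
      using a by simp
    also have "\<dots> = \<epsilon> (fob L a) \<cdot>\<^bsub>C\<^esub> fmor L (fmor F\<^sub>1 e) \<cdot>\<^bsub>C\<^esub> fmor L (\<eta> a)"
      using a a.counit_natural[of e]
        F\<^sub>1.C.inside[of "\<epsilon> (fob L a)" "fmor L (fmor F\<^sub>1 e)" _ "fmor L (\<eta> a)"] by simp
    also have "\<dots> = cid C (fob L a)"
      using a a.L.image_eq[OF 1] by simp
    finally show ?thesis by (simp only: e_def)
  qed
  have "inverse_arrows D\<^sub>1 (\<eta> a) (cinv D\<^sub>1 s \<cdot>\<^bsub>D\<^sub>1\<^esub> fmor F\<^sub>1 p)"
    using a s F\<^sub>1.image_eq[OF fp] by (simp add: inverse_arrows_def chom_iff pe f(2))
  then show "iso_arrow D\<^sub>1 (\<eta> a)" by (auto simp: iso_arrow_def)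
  have "inverse_arrows C f p" using pf fp by (simp add: inverse_arrows_def chom_iff)
  then have "iso_arrow C f" by (auto simp: iso_arrow_def)
  from null_obj_iso[OF null F\<^sub>2.iso(1)[OF this]]
  show "null_obj D\<^sub>2 (fob F\<^sub>2 (fob L a))" by (simp add: F\<^sub>2.D.category_axioms)
qed

text \<open>If \<open>\<eta>\<^sub>l\<close> is invertible, its retraction \<open>\<epsilon>\<^sub>r\<close> is its inverse. The triangle identities then give
  \<open>F \<epsilon>\<^sub>l = \<epsilon>\<^sub>r\<close> and \<open>F \<eta>\<^sub>r = \<eta>\<^sub>l\<close>, and in \<open>F (transfer g)\<close> these cancel by naturality.\<close>

lemma (in ambidextrous) transfer_section:
  assumes special: "\<And>Y. Y \<in> obj D \<Longrightarrow> \<epsilon>\<^sub>r Y \<cdot>\<^bsub>D\<^esub> \<eta>\<^sub>l Y = cid D Y"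
    and iso: "\<And>Y. Y \<in> obj D \<Longrightarrow> iso_arrow D (\<eta>\<^sub>l Y)"
    and obs: "A \<in> obj C" "B \<in> obj C" and g: "g \<in> chom D (fob F A) (fob F B)"
  shows "fmor F (transfer A B g) = g"
proof -
  have [simp]: "g \<in> arr D" "cdom D g = fob F A" "ccod D g = fob F B" using g by (auto simp: chom_iff)
  have 1: "fmor F (\<epsilon>\<^sub>l B) = \<epsilon>\<^sub>r (fob F B)"
    by (rule left.L.C.iso_cancel_right[OF iso[of "fob F B"]]) (use obs special in auto)
  have inv: "\<eta>\<^sub>l (fob F A) \<cdot>\<^bsub>D\<^esub> \<epsilon>\<^sub>r (fob F A) = cid D (fob F (fob P (fob F A)))"
    by (rule left.L.C.iso_cancel_right[OF iso[of "fob F A"]]) (use obs special in auto)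
  have "\<eta>\<^sub>l (fob F A) = \<eta>\<^sub>l (fob F A) \<cdot>\<^bsub>D\<^esub> \<epsilon>\<^sub>r (fob F A) \<cdot>\<^bsub>D\<^esub> fmor F (\<eta>\<^sub>r A)"
    using obs by simp
  also have "\<dots> = fmor F (\<eta>\<^sub>r A)"
    using obs by (simp add: left.L.C.inside[OF inv] del: right.triangles)
  finally have 2: "fmor F (\<eta>\<^sub>r A) = \<eta>\<^sub>l (fob F A)" by simp
  have 3: "\<epsilon>\<^sub>r (fob F B) \<cdot>\<^bsub>D\<^esub> fmor F (fmor P g) = g \<cdot>\<^bsub>D\<^esub> \<epsilon>\<^sub>r (fob F A)"
    using right.counit_natural[of g] by simp
  show ?thesis
    using obs by (simp add: transfer_def 1 2 left.L.C.inside[OF 3] special)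
qed


section \<open>Linear maps and linear categories\<close>

lemma linear_map_comp:
  "\<lbrakk>linear_map R V W f; linear_map R W Z g\<rbrakk> \<Longrightarrow> linear_map R V Z (\<lambda>x. g (f x))"
  by (auto simp: linear_map_def Pi_iff)

lemma linear_map_add:
  "\<lbrakk>linear_map R V W f; x \<in> carrier V; y \<in> carrier V\<rbrakk> \<Longrightarrow> f (x \<oplus>\<^bsub>V\<^esub> y) = f x \<oplus>\<^bsub>W\<^esub> f y"
  by (simp add: linear_map_def)

lemma linear_map_closed: "\<lbrakk>linear_map R V W f; x \<in> carrier V\<rbrakk> \<Longrightarrow> f x \<in> carrier W"
  by (auto simp: linear_map_def)

lemma linear_map_zero:
  assumes "linear_map R V W f"
  shows "f \<zero>\<^bsub>V\<^esub> = \<zero>\<^bsub>W\<^esub>"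
proof -
  interpret V: module R V using assms by (simp add: linear_map_def)
  interpret W: module R W using assms by (simp add: linear_map_def)
  have "f \<zero>\<^bsub>V\<^esub> \<oplus>\<^bsub>W\<^esub> f \<zero>\<^bsub>V\<^esub> = f (\<zero>\<^bsub>V\<^esub> \<oplus>\<^bsub>V\<^esub> \<zero>\<^bsub>V\<^esub>)"
    using linear_map_add[OF assms V.zero_closed V.zero_closed] by (rule sym)
  then show ?thesis using linear_map_closed[OF assms V.zero_closed] by simp
qed

locale lin_category =
  fixes R :: "('k, 'r) ring_scheme" and C :: "('k, 'o, 'm) lin_cat" (structure)
  assumes linear_category: "linear_category R C"

sublocale lin_category \<subseteq> category C
  using linear_category by (simp add: linear_category_def)

context lin_category
begin

lemma hmod_module: "\<lbrakk>x \<in> obj C; y \<in> obj C\<rbrakk> \<Longrightarrow> module R (hmod C x y)"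
  and carrier_hmod: "\<lbrakk>x \<in> obj C; y \<in> obj C\<rbrakk> \<Longrightarrow> carrier (hmod C x y) = chom C x y"
  using linear_category by (auto simp: linear_category_def)

lemma zero_hom [simp]:
  assumes "x \<in> obj C" "y \<in> obj C"
  shows "\<zero>\<^bsub>hmod C x y\<^esub> \<in> arr C" "cdom C \<zero>\<^bsub>hmod C x y\<^esub> = x" "ccod C \<zero>\<^bsub>hmod C x y\<^esub> = y"
proof -
  interpret module R "hmod C x y" using assms by (rule hmod_module)
  show "\<zero>\<^bsub>hmod C x y\<^esub> \<in> arr C" "cdom C \<zero>\<^bsub>hmod C x y\<^esub> = x" "ccod C \<zero>\<^bsub>hmod C x y\<^esub> = y"
    using M.zero_closed assms by (auto simp: carrier_hmod chom_iff)
qed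

lemma post_linear:
  assumes "x \<in> obj C" "h \<in> arr C" "cdom C h = y" "ccod C h = z"
  shows "linear_map R (hmod C x y) (hmod C x z) (\<lambda>f. h \<cdot> f)"
proof -
  have "y \<in> obj C" "z \<in> obj C" using assms by auto
  moreover have "h \<in> carrier (hmod C y z)" using assms calculation by (simp add: carrier_hmod chom_iff)
  ultimately show ?thesis
    using linear_category assms(1) unfolding linear_category_def bilinear_map_def by blast
qed

lemma pre_linear:
  assumes "z \<in> obj C" "k \<in> arr C" "cdom C k = x" "ccod C k = y"
  shows "linear_map R (hmod C y z) (hmod C x z) (\<lambda>f. f \<cdot> k)"
proof -
  have "y \<in> obj C" "x \<in> obj C" using assms by auto
  moreover have "k \<in> carrier (hmod C x y)" using assms calculation by (simp add: carrier_hmod chom_iff)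
  ultimately show ?thesis
    using linear_category assms(1) unfolding linear_category_def bilinear_map_def by blast
qed

lemma through_null:
  assumes "null_obj C w" "h \<in> arr C" "k \<in> arr C" "cdom C h = w" "ccod C k = w"
  shows "h \<cdot> k = \<zero>\<^bsub>hmod C (cdom C k) (ccod C h)\<^esub>"
proof -
  have w: "w \<in> obj C" using assms by auto
  have k: "k = \<zero>\<^bsub>hmod C (cdom C k) w\<^esub>"
    by (rule null_obj_unique[OF assms(1)]) (use assms w category_axioms in auto)
  have "linear_map R (hmod C (cdom C k) w) (hmod C (cdom C k) (ccod C h)) (\<lambda>f. h \<cdot> f)"
    using assms by (intro post_linear) auto
  from linear_map_zero[OF this] k show ?thesis by metis
qed

lemma zero_identity_null:
  assumes z: "z \<in> obj C" "cid C z = \<zero>\<^bsub>hmod C z z\<^esub>"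
  shows "null_obj C z"
  unfolding null_obj_def
proof (intro conjI ballI)
  fix x assume x: "x \<in> obj C"
  have "f = \<zero>\<^bsub>hmod C x z\<^esub>" if "f \<in> chom C x z" for f
  proof -
    have f: "f \<in> arr C" "cdom C f = x" "ccod C f = z" using that by (auto simp: chom_iff)
    have "f = cid C z \<cdot> f" using f by simp
    also have "\<dots> = \<zero>\<^bsub>hmod C z z\<^esub> \<cdot> f" by (simp only: z(2))
    also have "\<dots> = \<zero>\<^bsub>hmod C x z\<^esub>" using z f by (intro linear_map_zero[OF pre_linear]) auto
    finally show ?thesis .
  qed
  then show "\<exists>!f. f \<in> chom C x z" using x z by (intro ex1I[of _ "\<zero>\<^bsub>hmod C x z\<^esub>"]) (auto intro!: chomI)
  have "f = \<zero>\<^bsub>hmod C z x\<^esub>" if "f \<in> chom C z x" for f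
  proof -
    have f: "f \<in> arr C" "cdom C f = z" "ccod C f = x" using that by (auto simp: chom_iff)
    have "f = f \<cdot> cid C z" using f by simp
    also have "\<dots> = f \<cdot> \<zero>\<^bsub>hmod C z z\<^esub>" by (simp only: z(2))
    also have "\<dots> = \<zero>\<^bsub>hmod C z x\<^esub>" using z f by (intro linear_map_zero[OF post_linear]) auto
    finally show ?thesis .
  qed
  then show "\<exists>!f. f \<in> chom C z x" using x z by (intro ex1I[of _ "\<zero>\<^bsub>hmod C z x\<^esub>"]) (auto intro!: chomI)
qed (use z in auto)

end


section \<open>The transfers of a Mackey 2-functor\<close>

context two_category
begin

lemma hom1_obs: "u \<in> hom1 \<G> H G \<Longrightarrow> H \<in> Ob \<G> \<and> G \<in> Ob \<G>"
proof -
  interpret category "under_cat \<G>" by (rule under_category)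
  show "u \<in> hom1 \<G> H G \<Longrightarrow> ?thesis"
    using dom_closed[of u] cod_closed[of u] by (auto simp: under_cat_def hom1_def)
qed

lemma comp1_hom: "\<lbrakk>u \<in> hom1 \<G> H G; v \<in> hom1 \<G> K H\<rbrakk> \<Longrightarrow> Comp1 \<G> u v \<in> hom1 \<G> K G"
proof -
  interpret category "under_cat \<G>" by (rule under_category)
  show "\<lbrakk>u \<in> hom1 \<G> H G; v \<in> hom1 \<G> K H\<rbrakk> \<Longrightarrow> ?thesis"
    using comp[of v u] by (auto simp: under_cat_def hom1_def)
qed

lemma unit1_hom: "G \<in> Ob \<G> \<Longrightarrow> Unit1 \<G> G \<in> hom1 \<G> G G"
proof -
  interpret category "under_cat \<G>" by (rule under_category)
  show "G \<in> Ob \<G> \<Longrightarrow> ?thesis"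
    using ident[of G] by (auto simp: under_cat_def hom1_def)
qed

lemma unit1_comp: "u \<in> hom1 \<G> H G \<Longrightarrow> Comp1 \<G> (Unit1 \<G> G) u = u"
proof -
  interpret category "under_cat \<G>" by (rule under_category)
  show "u \<in> hom1 \<G> H G \<Longrightarrow> ?thesis"
    using unit_laws(1)[of u G] by (auto simp: under_cat_def hom1_def)
qed

lemma hom2_parallel: "\<lbrakk>\<alpha> \<in> hom2 \<G> u v; u \<in> hom1 \<G> H G\<rbrakk> \<Longrightarrow> v \<in> hom1 \<G> H G"
  using parallel[of \<alpha>] by (auto simp: hom1_def hom2_def)

lemma id2_inverse:
  assumes u: "u \<in> hom1 \<G> H G"
  shows "Id2 \<G> u \<in> hom2 \<G> u u" "iso_arrow (hom_cat \<G> H G) (Id2 \<G> u)"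
proof -
  interpret category "hom_cat \<G> H G" using hom1_obs[OF u] by (auto intro: hom_category)
  have id: "Id2 \<G> u \<in> hom2 \<G> u u"
    using ident[of u] u by (auto simp: hom_cat_def hom2_def)
  then show "Id2 \<G> u \<in> hom2 \<G> u u" .
  have "cid (hom_cat \<G> H G) u = Id2 \<G> u" "u \<in> obj (hom_cat \<G> H G)" using u by (auto simp: hom_cat_def)
  then have "inverse_arrows (hom_cat \<G> H G) (Id2 \<G> u) (Id2 \<G> u)"
    using ident[of u] unit_laws[of "Id2 \<G> u" u] by (auto simp: inverse_arrows_def chom_iff)
  then show "iso_arrow (hom_cat \<G> H G) (Id2 \<G> u)" by (auto simp: iso_arrow_def)
qed

lemma isomorphic1_refl: "u \<in> Arr1 \<G> \<Longrightarrow> isomorphic1 \<G> u u"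
  using id2_inverse[of u "Src \<G> u" "Trg \<G> u"] by (auto simp: isomorphic1_def hom1_def)

lemma inverse2:
  assumes u: "u \<in> hom1 \<G> H G" and \<alpha>: "\<alpha> \<in> hom2 \<G> u v" and i: "iso_arrow (hom_cat \<G> H G) \<alpha>"
  shows "inverse2 \<G> \<alpha> \<in> hom2 \<G> v u" "VComp \<G> (inverse2 \<G> \<alpha>) \<alpha> = Id2 \<G> u" "VComp \<G> \<alpha> (inverse2 \<G> \<alpha>) = Id2 \<G> v"
proof -
  interpret category "hom_cat \<G> H G" using hom1_obs[OF u] by (auto intro: hom_category)
  have e: "inverse2 \<G> \<alpha> = cinv (hom_cat \<G> H G) \<alpha>"
    using u \<alpha> by (simp add: inverse2_def hom1_def hom2_def)
  show "inverse2 \<G> \<alpha> \<in> hom2 \<G> v u" "VComp \<G> (inverse2 \<G> \<alpha>) \<alpha> = Id2 \<G> u" "VComp \<G> \<alpha> (inverse2 \<G> \<alpha>) = Id2 \<G> v"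
    using inverse[OF i] \<alpha> unfolding e by (auto simp: hom_cat_def hom2_def)
qed

end

locale mackey_setting = spannable_pair \<G> J + rectified_mackey_2functor \<AA> R \<G> M J
  for \<AA> :: ambient and R :: "('k, 'r) ring_scheme" and \<G> :: "('g, 'c, 'd) two_cat" and J :: "'c set"
    and M :: "('g, 'c, 'd, 'k, 'o, 'm, 'z) mackey2_scheme"
begin

lemma hom1D: "u \<in> hom1 \<G> H G \<Longrightarrow> Src \<G> u = H \<and> Trg \<G> u = G"
  by (simp add: hom1_def)

lemma linear_category: "G \<in> Ob \<G> \<Longrightarrow> lin_category R (Cat M G)"
  using cat_in_ambient by (simp add: in_ambient_def additive_category_def lin_category_def)

lemma pull: "u \<in> hom1 \<G> H G \<Longrightarrow> ftor (Cat M G) (Cat M H) (Pull M u)"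
  using pull_functor by (auto simp: linear_functor_def intro: ftorI)

lemma pull_linear:
  "\<lbrakk>u \<in> hom1 \<G> H G; A \<in> obj (Cat M G); B \<in> obj (Cat M G)\<rbrakk>
    \<Longrightarrow> linear_map R (hmod (Cat M G) A B) (hmod (Cat M H) (pullo M u A) (pullo M u B)) (pullm M u)"
  using pull_functor by (auto simp: linear_functor_def)

lemma push_linear:
  "\<lbrakk>u \<in> J; u \<in> hom1 \<G> H G; A \<in> obj (Cat M H); B \<in> obj (Cat M H)\<rbrakk>
    \<Longrightarrow> linear_map R (hmod (Cat M H) A B) (hmod (Cat M G) (pusho M u A) (pusho M u B)) (pushm M u)"
  using push_functor by (auto simp: linear_functor_def)

lemma push_pull: "\<lbrakk>u \<in> J; u \<in> hom1 \<G> H G\<rbrakk> \<Longrightarrow> ambidextrous (Cat M G) (Cat M H)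
    (Pull M u) (Push M u) (leta M u) (leps M u) (reta M u) (reps M u)"
  by (simp add: ambidextrous_def adjoint_pairI left_adjunction right_adjunction)

lemma pull2_inverse:
  assumes u: "u \<in> hom1 \<G> H G" and \<alpha>: "\<alpha> \<in> hom2 \<G> u v" and A: "A \<in> obj (Cat M G)"
  shows "inverse_arrows (Cat M H) (Pull2 M \<alpha> A) (Pull2 M (inverse2 \<G> \<alpha>) A)"
    "iso_arrow (Cat M H) (Pull2 M \<alpha> A)"
proof -
  note v = hom2_parallel[OF \<alpha> u]
  note i = inverse2[OF u \<alpha> invertible2[OF u \<alpha>]]
  note a = nat_transD(1-3)[OF pull2_nat[OF u \<alpha>] A] nat_transD(1-3)[OF pull2_nat[OF v i(1)] A]
  show "inverse_arrows (Cat M H) (Pull2 M \<alpha> A) (Pull2 M (inverse2 \<G> \<alpha>) A)"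
    using a pull2_vcomp[OF u \<alpha> i(1) A] pull2_vcomp[OF v i(1) \<alpha> A] pull2_id[OF u A] pull2_id[OF v A]
    by (simp add: inverse_arrows_def chom_iff i)
  then show "iso_arrow (Cat M H) (Pull2 M \<alpha> A)" by (auto simp: iso_arrow_def)
qed

text \<open>The transfer of the ambidextrous functor \<open>u\<^sup>*\<close>, with the categories read off from \<open>u\<close>.\<close>

definition transfer :: "'c \<Rightarrow> 'o \<Rightarrow> 'o \<Rightarrow> 'm \<Rightarrow> 'm"
  where "transfer u A B g =
    leps M u B \<cdot>\<^bsub>Cat M (Trg \<G> u)\<^esub> pushm M u g \<cdot>\<^bsub>Cat M (Trg \<G> u)\<^esub> reta M u A"

lemma transfer_eq:
  assumes "u \<in> J" "u \<in> hom1 \<G> H G"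
  shows "transfer u A B g = ambidextrous.transfer (Cat M G) (Push M u) (leps M u) (reta M u) A B g"
  using ambidextrous.transfer_def[OF push_pull[OF assms]] hom1D[OF assms(2)] by (simp add: transfer_def)

lemma transfer_hom [simp]:
  assumes "u \<in> J" "u \<in> hom1 \<G> H G" "A \<in> obj (Cat M G)" "B \<in> obj (Cat M G)"
    "g \<in> arr (Cat M H)" "cdom (Cat M H) g = pullo M u A" "ccod (Cat M H) g = pullo M u B"
  shows "transfer u A B g \<in> arr (Cat M G)" "cdom (Cat M G) (transfer u A B g) = A"
    "ccod (Cat M G) (transfer u A B g) = B"
proof -
  interpret u: ambidextrous "Cat M G" "Cat M H" "Pull M u" "Push M u" "leta M u" "leps M u" "reta M u" "reps M u"
    by (rule push_pull) fact+
  show "transfer u A B g \<in> arr (Cat M G)" "cdom (Cat M G) (transfer u A B g) = A"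
    "ccod (Cat M G) (transfer u A B g) = B"
    using assms by (auto simp: transfer_eq[OF assms(1,2)])
qed

lemma transfer_linear:
  assumes u: "u \<in> J" "u \<in> hom1 \<G> H G" and obs: "A \<in> obj (Cat M G)" "B \<in> obj (Cat M G)"
  shows "linear_map R (hmod (Cat M H) (pullo M u A) (pullo M u B)) (hmod (Cat M G) A B) (transfer u A B)"
proof -
  interpret u: ambidextrous "Cat M G" "Cat M H" "Pull M u" "Push M u" "leta M u" "leps M u" "reta M u" "reps M u"
    by (rule push_pull) fact+
  interpret C: lin_category R "Cat M G" using hom1_obs[OF u(2)] by (auto intro: linear_category)
  have 1: "linear_map R (hmod (Cat M H) (pullo M u A) (pullo M u B))
      (hmod (Cat M G) (pusho M u (pullo M u A)) (pusho M u (pullo M u B))) (pushm M u)"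
    using obs by (intro push_linear[OF u]) auto
  have 2: "linear_map R (hmod (Cat M G) (pusho M u (pullo M u A)) (pusho M u (pullo M u B)))
     (hmod (Cat M G) A (pusho M u (pullo M u B))) (\<lambda>f. f \<cdot>\<^bsub>Cat M G\<^esub> reta M u A)"
    using obs by (intro C.pre_linear) auto
  have 3: "linear_map R (hmod (Cat M G) A (pusho M u (pullo M u B))) (hmod (Cat M G) A B)
     (\<lambda>f. leps M u B \<cdot>\<^bsub>Cat M G\<^esub> f)"
    using obs by (intro C.post_linear) auto
  show ?thesis
    using linear_map_comp[OF linear_map_comp[OF 1 2] 3] hom1D[OF u(2)] by (simp add: transfer_def[abs_def])
qed

lemma unit1_J: "G \<in> Ob \<G> \<Longrightarrow> Unit1 \<G> G \<in> J"
  using unit1_hom[of G] unit1_comp[of "Unit1 \<G> G" G G] isomorphic1_refl[of "Unit1 \<G> G"]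
  by (intro J_equivalence) (auto simp: equivalence1_def hom1_def)

text \<open>For the identity, \<open>\<eta>\<^sub>l = \<eta>\<^sub>r\<close>; so the unit of the right adjunction cancels with the counit of the left one.\<close>

lemma transfer_unit:
  assumes G: "G \<in> Ob \<G>" and g: "g \<in> arr (Cat M G)"
  shows "transfer (Unit1 \<G> G) (cdom (Cat M G) g) (ccod (Cat M G) g) g = g"
proof -
  let ?u = "Unit1 \<G> G" and ?B = "ccod (Cat M G) g"
  note u = unit1_J[OF G] unit1_hom[OF G]
  interpret u: ambidextrous "Cat M G" "Cat M G" "Pull M ?u" "Push M ?u" "leta M ?u" "leps M ?u" "reta M ?u" "reps M ?u"
    by (rule push_pull[OF u])
  have B: "?B \<in> obj (Cat M G)" "cdom (Cat M G) g \<in> obj (Cat M G)" using g by auto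
  have 1: "leps M ?u ?B \<cdot>\<^bsub>Cat M G\<^esub> leta M ?u ?B = cid (Cat M G) ?B"
    using u.left.triangles(2)[of ?B] B G by (simp add: pull_unit_arr pull_unit_obj)
  have 2: "pushm M ?u g \<cdot>\<^bsub>Cat M G\<^esub> leta M ?u (cdom (Cat M G) g) = leta M ?u ?B \<cdot>\<^bsub>Cat M G\<^esub> g"
    using u.left.unit_natural[of g] g G by (simp add: pull_unit_arr)
  show ?thesis
    using u g B G push_unit_eq[OF G B(2)]
    by (simp add: transfer_eq u.transfer_def 2 u.left.L.C.inside[OF 1] pull_unit_obj flip: push_unit_eq)
qed

text \<open>The functor \<open>(u v)\<^sup>* = v\<^sup>* u\<^sup>*\<close> carries two ambidextrous structures: the chosen one and the composite
  of those of \<open>u\<^sup>*\<close> and \<open>v\<^sup>*\<close>. The comparisons \<open>u\<^sub>! v\<^sub>! \<rightarrow> (u v)\<^sub>!\<close> and \<open>u\<^sub>* v\<^sub>* \<rightarrow> (u v)\<^sub>*\<close> coincide, and so the transfers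
  do.\<close>

lemma transfer_comp:
  assumes J: "u \<in> J" "v \<in> J" and hom: "u \<in> hom1 \<G> H G" "v \<in> hom1 \<G> K H"
    and obs: "A \<in> obj (Cat M G)" "B \<in> obj (Cat M G)"
    and g: "g \<in> chom (Cat M K) (pullo M v (pullo M u A)) (pullo M v (pullo M u B))"
  shows "transfer (Comp1 \<G> u v) A B g = transfer u A B (transfer v (pullo M u A) (pullo M u B) g)"
proof -
  let ?w = "Comp1 \<G> u v"
  have w: "?w \<in> J" "?w \<in> hom1 \<G> K G" using J_comp[OF J] comp1_hom[OF hom] hom by (auto simp: hom1_def)
  interpret u: ambidextrous "Cat M G" "Cat M H" "Pull M u" "Push M u" "leta M u" "leps M u" "reta M u" "reps M u"
    by (rule push_pull) fact+
  interpret v: ambidextrous "Cat M H" "Cat M K" "Pull M v" "Push M v" "leta M v" "leps M v" "reta M v" "reps M v"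
    by (rule push_pull) fact+
  interpret w: ambidextrous "Cat M G" "Cat M K" "Pull M ?w" "Push M ?w" "leta M ?w" "leps M ?w" "reta M ?w" "reps M ?w"
    by (rule push_pull) fact+
  note [simp] = pull_comp_obj[OF hom] pull_comp_arr[OF hom] chomD[OF g, THEN conjunct1]
    chomD[OF g, THEN conjunct2, THEN conjunct1] chomD[OF g, THEN conjunct2, THEN conjunct2]
  let ?F = "comp_ftor (Pull M v) (Pull M u)" and ?P = "comp_ftor (Push M u) (Push M v)"
  let ?\<eta>\<^sub>l = "\<lambda>x. pullm M v (leta M u (pusho M v x)) \<cdot>\<^bsub>Cat M K\<^esub> leta M v x"
    and ?\<epsilon>\<^sub>l = "\<lambda>z. leps M u z \<cdot>\<^bsub>Cat M G\<^esub> pushm M u (leps M v (pullo M u z))"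
    and ?\<eta>\<^sub>r = "\<lambda>x. pushm M u (reta M v (pullo M u x)) \<cdot>\<^bsub>Cat M G\<^esub> reta M u x"
    and ?\<epsilon>\<^sub>r = "\<lambda>z. reps M v z \<cdot>\<^bsub>Cat M K\<^esub> pullm M v (reps M u (pusho M v z))"
  interpret c: ambidextrous "Cat M G" "Cat M K" ?F ?P ?\<eta>\<^sub>l ?\<epsilon>\<^sub>l ?\<eta>\<^sub>r ?\<epsilon>\<^sub>r
    using adjunction_comp[OF v.left.adjunction u.left.adjunction]
      adjunction_comp[OF u.right.adjunction v.right.adjunction]
    by (simp add: ambidextrous_def adjoint_pairI)
  have "w.transfer A B g = c.transfer A B g"
  proof (rule transfer_comparison)
    show "nat_trans (Cat M G) (Cat M K) (Pull M ?w) ?F (\<lambda>x. cid (Cat M K) (pullo M ?w x))"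
      using w.left.K.is_functor c.left.K.is_functor by (auto simp: nat_trans_def chom_iff)
    show "iso_arrow (Cat M K) (cid (Cat M K) (pullo M ?w A))"
      unfolding iso_arrow_def inverse_arrows_def chom_iff
      using obs by (intro exI[of _ "cid (Cat M K) (pullo M ?w A)"]) simp
    fix Y assume Y: "Y \<in> obj (Cat M K)"
    have "push_comp_l \<G> M u v Y = push_comp_r \<G> M u v Y"
      using Y hom by (intro push_comp_eq[OF J]) (auto simp: hom1_def)
    then show "?\<epsilon>\<^sub>l (pusho M ?w Y) \<cdot>\<^bsub>Cat M G\<^esub> fmor ?P (cid (Cat M K) (pullo M ?w (pusho M ?w Y))) \<cdot>\<^bsub>Cat M G\<^esub> fmor ?P (leta M ?w Y)
      = pushm M ?w (?\<epsilon>\<^sub>r Y) \<cdot>\<^bsub>Cat M G\<^esub> pushm M ?w (cid (Cat M K) (pullo M ?w (fob ?P Y))) \<cdot>\<^bsub>Cat M G\<^esub> reta M ?w (fob ?P Y)"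
      using Y hom1D[OF hom(1)] by (simp add: push_comp_l_def push_comp_r_def Let_def)
  qed (use obs g in \<open>auto simp: chom_iff intro: w.ambidextrous_axioms c.ambidextrous_axioms\<close>)
  also have "\<dots> = u.transfer A B (v.transfer (pullo M u A) (pullo M u B) g)"
    using obs by (simp add: c.transfer_def u.transfer_def v.transfer_def)
  finally show ?thesis
    by (simp add: transfer_eq[OF w] transfer_eq[OF J(1) hom(1)] transfer_eq[OF J(2) hom(2)])
qed

text \<open>The equality of the pseudofunctors \<open>i \<mapsto> i\<^sub>!\<close> and \<open>i \<mapsto> i\<^sub>*\<close> on 2-cells is the condition on the mates that
  the comparison of transfers requires.\<close>

lemma transfer_2cell:
  assumes J: "i \<in> J" "j \<in> J" and i: "i \<in> hom1 \<G> H G" and \<alpha>: "\<alpha> \<in> hom2 \<G> i j"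
    and obs: "A \<in> obj (Cat M G)" "B \<in> obj (Cat M G)"
    and g: "g \<in> chom (Cat M H) (pullo M i A) (pullo M i B)"
    and g': "g' \<in> chom (Cat M H) (pullo M j A) (pullo M j B)"
    and intertwined: "Pull2 M \<alpha> B \<cdot>\<^bsub>Cat M H\<^esub> g = g' \<cdot>\<^bsub>Cat M H\<^esub> Pull2 M \<alpha> A"
  shows "transfer i A B g = transfer j A B g'"
proof -
  note j = hom2_parallel[OF \<alpha> i]
  show ?thesis
    unfolding transfer_eq[OF J(1) i] transfer_eq[OF J(2) j]
  proof (rule transfer_comparison[OF push_pull[OF J(1) i] push_pull[OF J(2) j] pull2_nat[OF i \<alpha>]
        pull2_inverse(2)[OF i \<alpha> obs(1)] _ obs g g' intertwined])
    fix Y assume "Y \<in> obj (Cat M H)"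
    then have "push2_l \<G> M \<alpha> Y = push2_r \<G> M \<alpha> Y"
      using i by (intro push2_eq[OF J \<alpha>]) (auto simp: hom1_def)
    then show "leps M j (pusho M i Y) \<cdot>\<^bsub>Cat M G\<^esub> pushm M j (Pull2 M \<alpha> (pusho M i Y)) \<cdot>\<^bsub>Cat M G\<^esub> pushm M j (leta M i Y)
      = pushm M i (reps M j Y) \<cdot>\<^bsub>Cat M G\<^esub> pushm M i (Pull2 M \<alpha> (pusho M j Y)) \<cdot>\<^bsub>Cat M G\<^esub> reta M i (pusho M j Y)"
      using i \<alpha> by (simp add: push2_l_def push2_r_def Let_def hom1_def hom2_def)
  qed
qed

lemma mackey_squareD:
  assumes "mackey_square \<G> J i u p q \<gamma>"
  obtains H G K P where "i \<in> hom1 \<G> H G" "u \<in> hom1 \<G> K G" "p \<in> hom1 \<G> P H" "q \<in> hom1 \<G> P K"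
    "i \<in> J" "q \<in> J" "\<gamma> \<in> hom2 \<G> (Comp1 \<G> i p) (Comp1 \<G> u q)"
  using assms unfolding mackey_square_def pseudopullback_def hom1_def by blast

lemma transfer_mackey:
  assumes sq: "mackey_square \<G> J i u p q \<gamma>"
    and hom: "i \<in> hom1 \<G> H G" "u \<in> hom1 \<G> K G" "p \<in> hom1 \<G> P H" "q \<in> hom1 \<G> P K"
    and obs: "A \<in> obj (Cat M G)" "B \<in> obj (Cat M G)"
    and g: "g \<in> chom (Cat M H) (pullo M i A) (pullo M i B)"
    and g': "g' \<in> chom (Cat M P) (pullo M q (pullo M u A)) (pullo M q (pullo M u B))"
    and intertwined: "Pull2 M \<gamma> B \<cdot>\<^bsub>Cat M P\<^esub> pullm M p g = g' \<cdot>\<^bsub>Cat M P\<^esub> Pull2 M \<gamma> A"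
  shows "pullm M u (transfer i A B g) = transfer q (pullo M u A) (pullo M u B) g'"
proof -
  have J: "i \<in> J" "q \<in> J" and \<gamma>: "\<gamma> \<in> hom2 \<G> (Comp1 \<G> i p) (Comp1 \<G> u q)"
    using sq by (auto simp: mackey_square_def pseudopullback_def)
  note ip = comp1_hom[OF hom(1,3)] and uq = comp1_hom[OF hom(2,4)]
  note inv = inverse2[OF ip \<gamma> invertible2[OF ip \<gamma>]]
  interpret i: ambidextrous "Cat M G" "Cat M H" "Pull M i" "Push M i" "leta M i" "leps M i" "reta M i" "reps M i"
    by (rule push_pull) fact+
  interpret q: ambidextrous "Cat M K" "Cat M P" "Pull M q" "Push M q" "leta M q" "leps M q" "reta M q" "reps M q"
    by (rule push_pull) fact+
  interpret u: ftor "Cat M G" "Cat M K" "Pull M u" by (rule pull) fact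
  interpret p: ftor "Cat M H" "Cat M P" "Pull M p" by (rule pull) fact
  note [simp] = pull_comp_obj[OF hom(1,3)] pull_comp_arr[OF hom(1,3)]
    pull_comp_obj[OF hom(2,4)] pull_comp_arr[OF hom(2,4)]
  note n = nat_transD[OF pull2_nat[OF ip \<gamma>]] and n' = nat_transD[OF pull2_nat[OF uq inv(1)]]
  note [simp] = n(1-3) n'(1-3)
  have nat: "nat_trans (Cat M G) (Cat M P) (comp_ftor (Pull M p) (Pull M i)) (comp_ftor (Pull M q) (Pull M u)) (Pull2 M \<gamma>)"
    "nat_trans (Cat M G) (Cat M P) (comp_ftor (Pull M q) (Pull M u)) (comp_ftor (Pull M p) (Pull M i)) (Pull2 M (inverse2 \<G> \<gamma>))"
    using n(4) n'(4) is_functor_comp[OF i.left.K.is_functor p.is_functor]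
      is_functor_comp[OF u.is_functor q.left.K.is_functor]
    by (auto simp: nat_trans_def chom_iff)
  show ?thesis
    unfolding transfer_eq[OF J(1) hom(1)] transfer_eq[OF J(2) hom(4)]
  proof (rule transfer_base_change[OF i.ambidextrous_axioms q.ambidextrous_axioms u.is_functor p.is_functor
        nat _ _ obs g g' intertwined])
    show "Pull2 M \<gamma> A \<cdot>\<^bsub>Cat M P\<^esub> Pull2 M (inverse2 \<G> \<gamma>) A = cid (Cat M P) (pullo M q (pullo M u A))"
      using pull2_inverse(1)[OF ip \<gamma> obs(1)] obs by (simp add: inverse_arrows_def)
    fix Y assume Y: "Y \<in> obj (Cat M H)"
    have "inverse_arrows (Cat M K) (mate_l \<G> M i u p q \<gamma> Y) (mate_r \<G> M i u p q (inverse2 \<G> \<gamma>) Y)"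
      using mackey_formula[OF sq, of Y] Y hom1D[OF hom(1)] hom1D[OF hom(4)] by simp
    moreover have "ccod (Cat M K) (mate_l \<G> M i u p q \<gamma> Y) = pullo M u (pusho M i Y)"
      using Y hom1D[OF hom(4)] by (simp add: mate_l_def Let_def)
    ultimately show "(leps M q (pullo M u (pusho M i Y)) \<cdot>\<^bsub>Cat M K\<^esub> pushm M q (Pull2 M \<gamma> (pusho M i Y)) \<cdot>\<^bsub>Cat M K\<^esub>
          pushm M q (pullm M p (leta M i Y))) \<cdot>\<^bsub>Cat M K\<^esub>
        (pushm M q (pullm M p (reps M i Y)) \<cdot>\<^bsub>Cat M K\<^esub> pushm M q (Pull2 M (inverse2 \<G> \<gamma>) (pusho M i Y)) \<cdot>\<^bsub>Cat M K\<^esub>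
          reta M q (pullo M u (pusho M i Y))) = cid (Cat M K) (pullo M u (pusho M i Y))"
      using hom1D[OF hom(4)] by (simp add: mate_l_def mate_r_def Let_def inverse_arrows_def)
  qed
qed

text \<open>The inclusions form the family induced by the identity of the coproduct; they belong to \<open>J\<close> because
  the identity does.\<close>

lemma binary_coproduct_inclusions:
  assumes c: "binary_coproduct \<G> G H S i j"
  shows "i \<in> hom1 \<G> G S" "j \<in> hom1 \<G> H S" "i \<in> J" "j \<in> J"
    "category_decomposition (Cat M S) (Cat M G) (Pull M i) (Cat M H) (Pull M j)"
proof -
  let ?H = "\<lambda>l::nat. if l = 0 then G else H" and ?i = "\<lambda>l::nat. if l = 0 then i else j"
  have two: "{0, 1} = {..<2::nat}" by auto
  have c': "coproduct \<G> {..<2} ?H S ?i" using c by (simp only: binary_coproduct_def two)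
  then have S: "S \<in> Ob \<G>" by (simp add: coproduct_def)
  have h: "?i l \<in> hom1 \<G> (?H l) S" if "l < 2" for l
    using c' that by (auto simp: coproduct_def)
  show hom: "i \<in> hom1 \<G> G S" "j \<in> hom1 \<G> H S" using h[of 0] h[of 1] by auto
  have "Unit1 \<G> S \<in> J \<longleftrightarrow> (\<forall>l < 2. ?i l \<in> J)"
  proof (rule family_iff[OF c' h unit1_hom[OF S]])
    fix l :: nat assume "l < 2"
    from h[OF this] show "isomorphic1 \<G> (Comp1 \<G> (Unit1 \<G> S) (?i l)) (?i l)"
      using unit1_comp isomorphic1_refl by (auto simp: hom1_def)
  qed
  then have J: "?i l \<in> J" if "l < 2" for l using unit1_J[OF S] that by blast
  show "i \<in> J" "j \<in> J" using J[of 0] J[of 1] by auto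
  have "category_decomposition (Cat M S) (Cat M (?H 0)) (Pull M (?i 0)) (Cat M (?H 1)) (Pull M (?i 1))"
    using additivity[OF c'] hom pull_functor by (intro category_decompositionI) (auto simp: linear_functor_def)
  then show "category_decomposition (Cat M S) (Cat M G) (Pull M i) (Cat M H) (Pull M j)" by simp
qed

lemma null_exists: "G \<in> Ob \<G> \<Longrightarrow> \<exists>z. null_obj (Cat M G) z"
  using lin_category.zero_identity_null[OF linear_category] cat_in_ambient
  by (fastforce simp: in_ambient_def additive_category_def)

lemma binary_coproduct_swap: "binary_coproduct \<G> G H S i j \<Longrightarrow> category_decomposition (Cat M S) (Cat M H) (Pull M j) (Cat M G) (Pull M i)"
  using binary_coproduct_inclusions(5) category_decomposition.swap by blast

text \<open>The composite \<open>j\<^sup>* T\<^sub>i(g)\<close> factors through \<open>j\<^sup>* i\<^sub>! i\<^sup>* B\<close>, which is a zero object.\<close>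

lemma transfer_summand:
  assumes d: "category_decomposition (Cat M S) (Cat M G) (Pull M i) (Cat M H) (Pull M j)"
    and i: "i \<in> hom1 \<G> G S" "i \<in> J" and j: "j \<in> hom1 \<G> H S"
    and obs: "A \<in> obj (Cat M S)" "B \<in> obj (Cat M S)"
    and g: "g \<in> chom (Cat M G) (pullo M i A) (pullo M i B)"
  shows "pullm M i (transfer i A B g) = g"
    "pullm M j (transfer i A B g) = \<zero>\<^bsub>hmod (Cat M H) (pullo M j A) (pullo M j B)\<^esub>"
proof -
  interpret category_decomposition "Cat M S" "Cat M G" "Pull M i" "Cat M H" "Pull M j" by fact
  interpret i: ambidextrous "Cat M S" "Cat M G" "Pull M i" "Push M i" "leta M i" "leps M i" "reta M i" "reps M i"
    by (rule push_pull) fact+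
  interpret H: lin_category R "Cat M H" using hom1_obs[OF j] by (auto intro: linear_category)
  obtain z where z: "null_obj (Cat M H) z" using null_exists hom1_obs[OF j] by blast
  note un = adjoint_unit_iso[OF i.left.adjunction _ z]
  have [simp]: "g \<in> arr (Cat M G)" "cdom (Cat M G) g = pullo M i A" "ccod (Cat M G) g = pullo M i B"
    using g by (auto simp: chom_iff)
  show "pullm M i (transfer i A B g) = g"
    unfolding transfer_eq[OF i(2,1)] using un special_frobenius[OF i(2)] hom1D[OF i(1)] obs g
    by (intro i.transfer_section) auto
  have "pullm M j (i.transfer A B g) = pullm M j (leps M i B) \<cdot>\<^bsub>Cat M H\<^esub> pullm M j (pushm M i g \<cdot>\<^bsub>Cat M S\<^esub> reta M i A)"
    using obs by (simp add: i.transfer_def)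
  also have "\<dots> = \<zero>\<^bsub>hmod (Cat M H) (pullo M j A) (pullo M j B)\<^esub>"
    using obs H.through_null[OF un(2)[of "pullo M i B"], of "pullm M j (leps M i B)" "pullm M j (pushm M i g \<cdot>\<^bsub>Cat M S\<^esub> reta M i A)"]
    by simp
  finally show "pullm M j (transfer i A B g) = \<zero>\<^bsub>hmod (Cat M H) (pullo M j A) (pullo M j B)\<^esub>"
    unfolding transfer_eq[OF i(2,1)] .
qed

text \<open>Since \<open>i\<^sup>*\<close> and \<open>j\<^sup>*\<close> are jointly faithful, the last equation follows from the others.\<close>

lemma transfer_coproduct:
  assumes c: "binary_coproduct \<G> G H S i j" and obs: "A \<in> obj (Cat M S)" "B \<in> obj (Cat M S)"
  shows "g \<in> chom (Cat M G) (pullo M i A) (pullo M i B) \<Longrightarrow> pullm M i (transfer i A B g) = g"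
    "g \<in> chom (Cat M G) (pullo M i A) (pullo M i B)
      \<Longrightarrow> pullm M j (transfer i A B g) = \<zero>\<^bsub>hmod (Cat M H) (pullo M j A) (pullo M j B)\<^esub>"
    "h \<in> chom (Cat M H) (pullo M j A) (pullo M j B) \<Longrightarrow> pullm M j (transfer j A B h) = h"
    "h \<in> chom (Cat M H) (pullo M j A) (pullo M j B)
      \<Longrightarrow> pullm M i (transfer j A B h) = \<zero>\<^bsub>hmod (Cat M G) (pullo M i A) (pullo M i B)\<^esub>"
    "f \<in> chom (Cat M S) A B
      \<Longrightarrow> transfer i A B (pullm M i f) \<oplus>\<^bsub>hmod (Cat M S) A B\<^esub> transfer j A B (pullm M j f) = f"
proof -
  note b = binary_coproduct_inclusions[OF c]
  note ti = transfer_summand[OF b(5,1,3,2) obs]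
    and tj = transfer_summand[OF binary_coproduct_swap[OF c] b(2,4,1) obs]
  show "g \<in> chom (Cat M G) (pullo M i A) (pullo M i B) \<Longrightarrow> pullm M i (transfer i A B g) = g"
    "g \<in> chom (Cat M G) (pullo M i A) (pullo M i B)
      \<Longrightarrow> pullm M j (transfer i A B g) = \<zero>\<^bsub>hmod (Cat M H) (pullo M j A) (pullo M j B)\<^esub>"
    "h \<in> chom (Cat M H) (pullo M j A) (pullo M j B) \<Longrightarrow> pullm M j (transfer j A B h) = h"
    "h \<in> chom (Cat M H) (pullo M j A) (pullo M j B)
      \<Longrightarrow> pullm M i (transfer j A B h) = \<zero>\<^bsub>hmod (Cat M G) (pullo M i A) (pullo M i B)\<^esub>"
    by (rule ti tj; assumption)+
  assume f: "f \<in> chom (Cat M S) A B"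
  interpret category_decomposition "Cat M S" "Cat M G" "Pull M i" "Cat M H" "Pull M j" by (rule b)
  interpret S: lin_category R "Cat M S" using hom1_obs[OF b(1)] by (auto intro: linear_category)
  interpret G: lin_category R "Cat M G" using hom1_obs[OF b(1)] by (auto intro: linear_category)
  interpret H: lin_category R "Cat M H" using hom1_obs[OF b(2)] by (auto intro: linear_category)
  have fi: "pullm M i f \<in> chom (Cat M G) (pullo M i A) (pullo M i B)"
    and fj: "pullm M j f \<in> chom (Cat M H) (pullo M j A) (pullo M j B)"
    using f by (auto simp: chom_iff)
  let ?ti = "transfer i A B (pullm M i f)" and ?tj = "transfer j A B (pullm M j f)"
  interpret SM: module R "hmod (Cat M S) A B" using obs by (rule S.hmod_module)
  interpret GM: module R "hmod (Cat M G) (pullo M i A) (pullo M i B)" using obs by (intro G.hmod_module) auto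
  interpret HM: module R "hmod (Cat M H) (pullo M j A) (pullo M j B)" using obs by (intro H.hmod_module) auto
  have t: "?ti \<in> carrier (hmod (Cat M S) A B)" "?tj \<in> carrier (hmod (Cat M S) A B)"
    using linear_map_closed[OF transfer_linear[OF b(3,1) obs], of "pullm M i f"]
      linear_map_closed[OF transfer_linear[OF b(4,2) obs], of "pullm M j f"] fi fj obs
    by (auto simp: G.carrier_hmod H.carrier_hmod)
  have s: "?ti \<oplus>\<^bsub>hmod (Cat M S) A B\<^esub> ?tj \<in> chom (Cat M S) A B"
    using SM.M.add.m_closed[OF t] obs by (simp add: S.carrier_hmod)
  show "?ti \<oplus>\<^bsub>hmod (Cat M S) A B\<^esub> ?tj = f"
  proof (rule faithful)
    show "pullm M i (?ti \<oplus>\<^bsub>hmod (Cat M S) A B\<^esub> ?tj) = pullm M i f"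
      using linear_map_add[OF pull_linear[OF b(1) obs] t] ti(1)[OF fi] tj(2)[OF fj] fi obs
        GM.M.add.r_one[of "pullm M i f"] by (simp add: G.carrier_hmod)
    show "pullm M j (?ti \<oplus>\<^bsub>hmod (Cat M S) A B\<^esub> ?tj) = pullm M j f"
      using linear_map_add[OF pull_linear[OF b(2) obs] t] ti(2)[OF fi] tj(1)[OF fj] fj obs
        HM.M.add.l_one[of "pullm M j f"] by (simp add: H.carrier_hmod)
  qed (use s f in \<open>auto simp: chom_iff\<close>)
qed

end


context mackey_setting
begin

lemma transfer_post:
  assumes u: "u \<in> J" "u \<in> hom1 \<G> H G" and A: "A \<in> obj (Cat M G)"
    and g: "g \<in> arr (Cat M H)" "cdom (Cat M H) g = pullo M u A" "ccod (Cat M H) g = pullo M u B"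
    and f: "f \<in> arr (Cat M G)" "cdom (Cat M G) f = B" "ccod (Cat M G) f = B'"
  shows "f \<cdot>\<^bsub>Cat M G\<^esub> transfer u A B g = transfer u A B' (pullm M u f \<cdot>\<^bsub>Cat M H\<^esub> g)"
  using ambidextrous.transfer_post[OF push_pull[OF u] A g f] by (simp add: transfer_eq[OF u])

lemma transfer_pre:
  assumes u: "u \<in> J" "u \<in> hom1 \<G> H G" and B: "B \<in> obj (Cat M G)"
    and g: "g \<in> arr (Cat M H)" "cdom (Cat M H) g = pullo M u A" "ccod (Cat M H) g = pullo M u B"
    and f: "f \<in> arr (Cat M G)" "cdom (Cat M G) f = A'" "ccod (Cat M G) f = A"
  shows "transfer u A B g \<cdot>\<^bsub>Cat M G\<^esub> f = transfer u A' B (g \<cdot>\<^bsub>Cat M H\<^esub> pullm M u f)"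
  using ambidextrous.transfer_pre[OF push_pull[OF u] B g f] by (simp add: transfer_eq[OF u])

end


section \<open>Hom-decategorifications are Mackey functors\<close>

locale decategorification = mackey_setting \<AA> R \<G> J M + coherent_family \<G> M X Y lam rho
  for \<AA> :: ambient and R :: "('k, 'r) ring_scheme" and \<G> :: "('g, 'c, 'd) two_cat" and J :: "'c set"
    and M :: "('g, 'c, 'd, 'k, 'o, 'm, 'z) mackey2_scheme"
    and X Y :: "'g \<Rightarrow> 'o" and lam rho :: "'c \<Rightarrow> 'm"
begin

abbreviation "N \<equiv> hom_decat \<G> M X Y lam rho"

lemma coherence:
  assumes "u \<in> hom1 \<G> H G"
  shows "lam u \<in> arr (Cat M H)" "cdom (Cat M H) (lam u) = X H" "ccod (Cat M H) (lam u) = pullo M u (X G)"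
    "iso_arrow (Cat M H) (lam u)"
    "rho u \<in> arr (Cat M H)" "cdom (Cat M H) (rho u) = pullo M u (Y G)" "ccod (Cat M H) (rho u) = Y H"
    "iso_arrow (Cat M H) (rho u)"
    "X G \<in> obj (Cat M G)" "Y G \<in> obj (Cat M G)" "X H \<in> obj (Cat M H)" "Y H \<in> obj (Cat M H)"
  using lam_iso[OF assms] rho_iso[OF assms] hom1_obs[OF assms] X_obj Y_obj by (auto simp: chom_iff)

lemma carrier_Val: "G \<in> Ob \<G> \<Longrightarrow> carrier (Val N G) = chom (Cat M G) (X G) (Y G)"
  using lin_category.carrier_hmod[OF linear_category] X_obj Y_obj by (simp add: hom_decat_def)

text \<open>Transport of \<open>X H \<rightarrow> Y H\<close> to an arrow \<open>u\<^sup>*(X G) \<rightarrow> u\<^sup>*(Y G)\<close>. Restriction is \<open>u\<^sup>*\<close> followed by the inverse of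
  this transport, and induction is this transport followed by the transfer.\<close>

definition conjugate :: "'c \<Rightarrow> 'm \<Rightarrow> 'm"
  where "conjugate u \<psi> = cinv (Cat M (Src \<G> u)) (rho u) \<cdot>\<^bsub>Cat M (Src \<G> u)\<^esub> \<psi> \<cdot>\<^bsub>Cat M (Src \<G> u)\<^esub> cinv (Cat M (Src \<G> u)) (lam u)"

lemma conjugate_eq: "u \<in> hom1 \<G> H G
    \<Longrightarrow> conjugate u \<psi> = cinv (Cat M H) (rho u) \<cdot>\<^bsub>Cat M H\<^esub> \<psi> \<cdot>\<^bsub>Cat M H\<^esub> cinv (Cat M H) (lam u)"
  using hom1D by (simp add: conjugate_def)

lemma conjugate_hom:
  assumes "u \<in> hom1 \<G> H G" "\<psi> \<in> chom (Cat M H) (X H) (Y H)"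
  shows "conjugate u \<psi> \<in> arr (Cat M H)" "cdom (Cat M H) (conjugate u \<psi>) = pullo M u (X G)"
    "ccod (Cat M H) (conjugate u \<psi>) = pullo M u (Y G)"
proof -
  interpret ftor "Cat M G" "Cat M H" "Pull M u" by (rule pull) fact
  show "conjugate u \<psi> \<in> arr (Cat M H)" "cdom (Cat M H) (conjugate u \<psi>) = pullo M u (X G)"
    "ccod (Cat M H) (conjugate u \<psi>) = pullo M u (Y G)"
    using assms(2) coherence[OF assms(1)] by (auto simp: conjugate_eq[OF assms(1)] chom_iff)
qed

lemma Res_eq: "u \<in> hom1 \<G> H G \<Longrightarrow> Res N u \<phi> = rho u \<cdot>\<^bsub>Cat M H\<^esub> pullm M u \<phi> \<cdot>\<^bsub>Cat M H\<^esub> lam u"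
  using hom1D by (simp add: hom_decat_def Let_def)

lemma Ind_eq: "u \<in> hom1 \<G> H G \<Longrightarrow> Ind N u \<psi> = transfer u (X G) (Y G) (conjugate u \<psi>)"
  using hom1D by (simp add: hom_decat_def transfer_def conjugate_def Let_def)

lemma Res_hom:
  assumes "u \<in> hom1 \<G> H G" "\<phi> \<in> chom (Cat M G) (X G) (Y G)"
  shows "Res N u \<phi> \<in> chom (Cat M H) (X H) (Y H)"
proof -
  interpret ftor "Cat M G" "Cat M H" "Pull M u" by (rule pull) fact
  show ?thesis
    using assms(2) coherence[OF assms(1)] by (simp add: Res_eq[OF assms(1)] chom_iff)
qed

lemma Ind_hom:
  assumes "u \<in> J" "u \<in> hom1 \<G> H G" "\<psi> \<in> chom (Cat M H) (X H) (Y H)"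
  shows "Ind N u \<psi> \<in> chom (Cat M G) (X G) (Y G)"
  using conjugate_hom[OF assms(2,3)] assms coherence[OF assms(2)] by (simp add: Ind_eq[OF assms(2)] chom_iff)

lemma conjugate_Res:
  assumes "u \<in> hom1 \<G> H G" "\<phi> \<in> chom (Cat M G) (X G) (Y G)"
  shows "conjugate u (Res N u \<phi>) = pullm M u \<phi>"
proof -
  interpret ftor "Cat M G" "Cat M H" "Pull M u" by (rule pull) fact
  show ?thesis
    using assms(2) coherence[OF assms(1)] by (simp add: Res_eq[OF assms(1)] conjugate_eq[OF assms(1)] chom_iff)
qed

lemma res_linear:
  assumes u: "u \<in> hom1 \<G> H G"
  shows "linear_map R (Val N G) (Val N H) (Res N u)"
proof -
  interpret F: ftor "Cat M G" "Cat M H" "Pull M u" by (rule pull) fact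
  interpret H: lin_category R "Cat M H" using hom1_obs[OF u] by (auto intro: linear_category)
  note [simp] = coherence[OF u]
  have 1: "linear_map R (hmod (Cat M G) (X G) (Y G)) (hmod (Cat M H) (pullo M u (X G)) (pullo M u (Y G))) (pullm M u)"
    by (rule pull_linear[OF u]) auto
  have 2: "linear_map R (hmod (Cat M H) (pullo M u (X G)) (pullo M u (Y G)))
      (hmod (Cat M H) (X H) (pullo M u (Y G))) (\<lambda>f. f \<cdot>\<^bsub>Cat M H\<^esub> lam u)"
    by (rule H.pre_linear) auto
  have 3: "linear_map R (hmod (Cat M H) (X H) (pullo M u (Y G))) (hmod (Cat M H) (X H) (Y H)) (\<lambda>f. rho u \<cdot>\<^bsub>Cat M H\<^esub> f)"
    by (rule H.post_linear) auto
  show ?thesis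
    using linear_map_comp[OF linear_map_comp[OF 1 2] 3] hom1D[OF u] by (simp add: hom_decat_def Let_def)
qed

lemma ind_linear:
  assumes J: "u \<in> J" and u: "u \<in> hom1 \<G> H G"
  shows "linear_map R (Val N H) (Val N G) (Ind N u)"
proof -
  interpret F: ftor "Cat M G" "Cat M H" "Pull M u" by (rule pull) fact
  interpret H: lin_category R "Cat M H" using hom1_obs[OF u] by (auto intro: linear_category)
  note [simp] = coherence[OF u]
  have 1: "linear_map R (hmod (Cat M H) (X H) (Y H)) (hmod (Cat M H) (pullo M u (X G)) (Y H))
      (\<lambda>f. f \<cdot>\<^bsub>Cat M H\<^esub> cinv (Cat M H) (lam u))"
    by (rule H.pre_linear) auto
  have 2: "linear_map R (hmod (Cat M H) (pullo M u (X G)) (Y H)) (hmod (Cat M H) (pullo M u (X G)) (pullo M u (Y G)))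
      (\<lambda>f. cinv (Cat M H) (rho u) \<cdot>\<^bsub>Cat M H\<^esub> f)"
    by (rule H.post_linear) auto
  have 3: "linear_map R (hmod (Cat M H) (pullo M u (X G)) (pullo M u (Y G))) (hmod (Cat M G) (X G) (Y G))
      (transfer u (X G) (Y G))"
    by (rule transfer_linear[OF J u]) auto
  have "linear_map R (Val N H) (Val N G) (\<lambda>\<psi>. transfer u (X G) (Y G) (conjugate u \<psi>))"
    using linear_map_comp[OF linear_map_comp[OF 1 2] 3] by (simp add: hom_decat_def conjugate_eq[OF u])
  then show ?thesis by (simp add: Ind_eq[OF u, abs_def])
qed

lemma res_comp:
  assumes u: "u \<in> hom1 \<G> H G" and v: "v \<in> hom1 \<G> K H" and x: "x \<in> chom (Cat M G) (X G) (Y G)"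
  shows "Res N (Comp1 \<G> u v) x = Res N v (Res N u x)"
proof -
  interpret u: ftor "Cat M G" "Cat M H" "Pull M u" by (rule pull) fact
  interpret v: ftor "Cat M H" "Cat M K" "Pull M v" by (rule pull) fact
  show ?thesis
    using x coherence[OF u] coherence[OF v] lam_comp[OF u v] rho_comp[OF u v]
    by (simp add: Res_eq[OF comp1_hom[OF u v]] Res_eq[OF u] Res_eq[OF v] chom_iff pull_comp_arr[OF u v])
qed

text \<open>Conjugation for \<open>u v\<close> is conjugation for \<open>v\<close> followed by conjugation with the images of \<open>\<rho>\<close> and \<open>\<lambda>\<close> of \<open>u\<close>
  under \<open>v\<^sup>*\<close>, and the latter can be moved out of the transfer along \<open>v\<close>.\<close>

lemma ind_comp:
  assumes J: "u \<in> J" "v \<in> J" and u: "u \<in> hom1 \<G> H G" and v: "v \<in> hom1 \<G> K H"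
    and x: "x \<in> chom (Cat M K) (X K) (Y K)"
  shows "Ind N (Comp1 \<G> u v) x = Ind N u (Ind N v x)"
proof -
  note uv = comp1_hom[OF u v]
  interpret u: ftor "Cat M G" "Cat M H" "Pull M u" by (rule pull) fact
  interpret v: ftor "Cat M H" "Cat M K" "Pull M v" by (rule pull) fact
  note [simp] = coherence[OF u] coherence[OF v] conjugate_hom[OF v x]
  have x': "x \<in> arr (Cat M K)" "cdom (Cat M K) x = X K" "ccod (Cat M K) x = Y K" using x by (auto simp: chom_iff)
  have c: "conjugate (Comp1 \<G> u v) x = pullm M v (cinv (Cat M H) (rho u)) \<cdot>\<^bsub>Cat M K\<^esub> conjugate v x \<cdot>\<^bsub>Cat M K\<^esub>
      pullm M v (cinv (Cat M H) (lam u))"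
    using x' by (simp add: conjugate_eq[OF uv] conjugate_eq[OF v] lam_comp[OF u v] rho_comp[OF u v])
  have "transfer v (pullo M u (X G)) (pullo M u (Y G)) (conjugate (Comp1 \<G> u v) x)
      = cinv (Cat M H) (rho u) \<cdot>\<^bsub>Cat M H\<^esub> transfer v (X H) (Y H) (conjugate v x) \<cdot>\<^bsub>Cat M H\<^esub> cinv (Cat M H) (lam u)"
    by (simp add: c transfer_pre[OF J(2) v] transfer_post[OF J(2) v])
  moreover have "conjugate (Comp1 \<G> u v) x \<in> chom (Cat M K) (pullo M v (pullo M u (X G))) (pullo M v (pullo M u (Y G)))"
    by (simp add: c chom_iff)
  ultimately show ?thesis
    using transfer_comp[OF J u v, of "X G" "Y G"]
    by (simp add: Ind_eq[OF uv] Ind_eq[OF u] Ind_eq[OF v] conjugate_eq[OF u])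
qed

lemma res_isomorphic:
  assumes u: "u \<in> hom1 \<G> H G" and \<alpha>: "\<alpha> \<in> hom2 \<G> u v" and x: "x \<in> chom (Cat M G) (X G) (Y G)"
  shows "Res N u x = Res N v x"
proof -
  note v = hom2_parallel[OF \<alpha> u]
  interpret u: ftor "Cat M G" "Cat M H" "Pull M u" by (rule pull) fact
  interpret v: ftor "Cat M G" "Cat M H" "Pull M v" by (rule pull) fact
  note n = nat_transD[OF pull2_nat[OF u \<alpha>]]
  note [simp] = n(1-3) coherence[OF u] coherence[OF v]
  have x': "x \<in> arr (Cat M G)" "cdom (Cat M G) x = X G" "ccod (Cat M G) x = Y G" using x by (auto simp: chom_iff)
  have 1: "pullm M v x \<cdot>\<^bsub>Cat M H\<^esub> Pull2 M \<alpha> (X G) = Pull2 M \<alpha> (Y G) \<cdot>\<^bsub>Cat M H\<^esub> pullm M u x"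
    using n(4)[of x] x' by simp
  have "Res N v x = rho v \<cdot>\<^bsub>Cat M H\<^esub> pullm M v x \<cdot>\<^bsub>Cat M H\<^esub> Pull2 M \<alpha> (X G) \<cdot>\<^bsub>Cat M H\<^esub> lam u"
    by (simp add: Res_eq[OF v] lam_2cell[OF u \<alpha>])
  also have "\<dots> = Res N u x"
    using x' by (simp add: u.D.inside[OF 1] u.D.inside[OF rho_2cell[OF u \<alpha>]] Res_eq[OF u])
  finally show ?thesis by simp
qed

lemma ind_isomorphic:
  assumes J: "u \<in> J" "v \<in> J" and u: "u \<in> hom1 \<G> H G" and \<alpha>: "\<alpha> \<in> hom2 \<G> u v"
    and x: "x \<in> chom (Cat M H) (X H) (Y H)"
  shows "Ind N u x = Ind N v x"
proof -
  note v = hom2_parallel[OF \<alpha> u]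
  interpret u: ftor "Cat M G" "Cat M H" "Pull M u" by (rule pull) fact
  interpret v: ftor "Cat M G" "Cat M H" "Pull M v" by (rule pull) fact
  note n = nat_transD[OF pull2_nat[OF u \<alpha>]]
  note [simp] = n(1-3) coherence[OF u] coherence[OF v]
  have x': "x \<in> arr (Cat M H)" "cdom (Cat M H) x = X H" "ccod (Cat M H) x = Y H" using x by (auto simp: chom_iff)
  have 1: "Pull2 M \<alpha> (Y G) \<cdot>\<^bsub>Cat M H\<^esub> cinv (Cat M H) (rho u) = cinv (Cat M H) (rho v)"
    by (rule u.D.inverse_triangle(1)) (auto simp: rho_2cell[OF u \<alpha>])
  have 2: "cinv (Cat M H) (lam v) \<cdot>\<^bsub>Cat M H\<^esub> Pull2 M \<alpha> (X G) = cinv (Cat M H) (lam u)"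
    by (rule u.D.inverse_triangle(2)) (auto simp: lam_2cell[OF u \<alpha>])
  show ?thesis
    unfolding Ind_eq[OF u] Ind_eq[OF v]
  proof (rule transfer_2cell[OF J u \<alpha>])
    show "Pull2 M \<alpha> (Y G) \<cdot>\<^bsub>Cat M H\<^esub> conjugate u x = conjugate v x \<cdot>\<^bsub>Cat M H\<^esub> Pull2 M \<alpha> (X G)"
      using x' by (simp add: conjugate_eq[OF u] conjugate_eq[OF v] u.D.inside[OF 1] 2)
  qed (auto intro!: chomI simp: conjugate_hom[OF u x] conjugate_hom[OF v x])
qed

text \<open>Base change expresses the left side as a transfer along \<open>q\<close>. That the transferred arrows agree is
  the compatibility of \<open>\<lambda>\<close> and \<open>\<rho>\<close> with composition and with the 2-cell \<open>\<gamma>\<close>.\<close>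

lemma decat_mackey_formula:
  assumes sq: "mackey_square \<G> J i u p q \<gamma>"
    and hom: "i \<in> hom1 \<G> H G" "u \<in> hom1 \<G> K G" "p \<in> hom1 \<G> P H" "q \<in> hom1 \<G> P K"
    and x: "x \<in> chom (Cat M H) (X H) (Y H)"
  shows "Res N u (Ind N i x) = Ind N q (Res N p x)"
proof -
  have J: "i \<in> J" "q \<in> J" and \<gamma>: "\<gamma> \<in> hom2 \<G> (Comp1 \<G> i p) (Comp1 \<G> u q)"
    using sq by (auto simp: mackey_square_def pseudopullback_def)
  note ip = comp1_hom[OF hom(1,3)] and uq = comp1_hom[OF hom(2,4)]
  interpret i: ftor "Cat M G" "Cat M H" "Pull M i" by (rule pull) fact
  interpret u: ftor "Cat M G" "Cat M K" "Pull M u" by (rule pull) fact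
  interpret p: ftor "Cat M H" "Cat M P" "Pull M p" by (rule pull) fact
  interpret q: ftor "Cat M K" "Cat M P" "Pull M q" by (rule pull) fact
  note n = nat_transD(1-3)[OF pull2_nat[OF ip \<gamma>]]
  note [simp] = n coherence[OF hom(1)] coherence[OF hom(2)] coherence[OF hom(3)] coherence[OF hom(4)]
    pull_comp_obj[OF hom(1,3)] pull_comp_arr[OF hom(1,3)] pull_comp_obj[OF hom(2,4)] pull_comp_arr[OF hom(2,4)]
  have x': "x \<in> arr (Cat M H)" "cdom (Cat M H) x = X H" "ccod (Cat M H) x = Y H" using x by (auto simp: chom_iff)
  note r = Res_hom[OF hom(3) x]
  note [simp] = conjugate_hom[OF hom(4) r]
  \<comment> \<open>The arrow \<open>q\<^sup>*u\<^sup>*(X G) \<rightarrow> q\<^sup>*u\<^sup>*(Y G)\<close> that \<open>Res N p x\<close> corresponds to under the coherence maps of \<open>u q\<close>.\<close>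
  define g where "g = pullm M q (cinv (Cat M K) (rho u)) \<cdot>\<^bsub>Cat M P\<^esub> conjugate q (Res N p x) \<cdot>\<^bsub>Cat M P\<^esub>
    pullm M q (cinv (Cat M K) (lam u))"
  have g [simp]: "g \<in> arr (Cat M P)" "cdom (Cat M P) g = pullo M q (pullo M u (X G))"
    "ccod (Cat M P) g = pullo M q (pullo M u (Y G))"
    by (auto simp: g_def)
  have 1: "Pull2 M \<gamma> (Y G) \<cdot>\<^bsub>Cat M P\<^esub> cinv (Cat M P) (rho (Comp1 \<G> i p)) = cinv (Cat M P) (rho (Comp1 \<G> u q))"
    using coherence[OF ip] coherence[OF uq] by (intro p.D.inverse_triangle(1)) (auto simp: rho_2cell[OF ip \<gamma>])
  then have 1: "Pull2 M \<gamma> (Y G) \<cdot>\<^bsub>Cat M P\<^esub> pullm M p (cinv (Cat M H) (rho i)) \<cdot>\<^bsub>Cat M P\<^esub> cinv (Cat M P) (rho p)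
      = pullm M q (cinv (Cat M K) (rho u)) \<cdot>\<^bsub>Cat M P\<^esub> cinv (Cat M P) (rho q)"
    by (simp add: rho_comp[OF hom(1,3)] rho_comp[OF hom(2,4)])
  have 2: "cinv (Cat M P) (lam (Comp1 \<G> u q)) \<cdot>\<^bsub>Cat M P\<^esub> Pull2 M \<gamma> (X G) = cinv (Cat M P) (lam (Comp1 \<G> i p))"
    using coherence[OF ip] coherence[OF uq] by (intro p.D.inverse_triangle(2)) (auto simp: lam_2cell[OF ip \<gamma>])
  then have 2: "cinv (Cat M P) (lam q) \<cdot>\<^bsub>Cat M P\<^esub> pullm M q (cinv (Cat M K) (lam u)) \<cdot>\<^bsub>Cat M P\<^esub> Pull2 M \<gamma> (X G)
      = cinv (Cat M P) (lam p) \<cdot>\<^bsub>Cat M P\<^esub> pullm M p (cinv (Cat M H) (lam i))"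
    by (simp add: lam_comp[OF hom(1,3)] lam_comp[OF hom(2,4)])
  have key: "Pull2 M \<gamma> (Y G) \<cdot>\<^bsub>Cat M P\<^esub> pullm M p (conjugate i x) = g \<cdot>\<^bsub>Cat M P\<^esub> Pull2 M \<gamma> (X G)"
  proof -
    let ?r = "rho p \<cdot>\<^bsub>Cat M P\<^esub> pullm M p x \<cdot>\<^bsub>Cat M P\<^esub> lam p"
    have "pullm M p x = cinv (Cat M P) (rho p) \<cdot>\<^bsub>Cat M P\<^esub> ?r \<cdot>\<^bsub>Cat M P\<^esub> cinv (Cat M P) (lam p)"
      using x' by simp
    then have "Pull2 M \<gamma> (Y G) \<cdot>\<^bsub>Cat M P\<^esub> pullm M p (conjugate i x)
      = (Pull2 M \<gamma> (Y G) \<cdot>\<^bsub>Cat M P\<^esub> pullm M p (cinv (Cat M H) (rho i)) \<cdot>\<^bsub>Cat M P\<^esub> cinv (Cat M P) (rho p)) \<cdot>\<^bsub>Cat M P\<^esub>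
        ?r \<cdot>\<^bsub>Cat M P\<^esub> (cinv (Cat M P) (lam p) \<cdot>\<^bsub>Cat M P\<^esub> pullm M p (cinv (Cat M H) (lam i)))"
      using x' by (simp add: conjugate_eq[OF hom(1)])
    also have "\<dots> = g \<cdot>\<^bsub>Cat M P\<^esub> Pull2 M \<gamma> (X G)"
      unfolding 1 2[symmetric] using x' by (simp add: g_def Res_eq[OF hom(3)] conjugate_eq[OF hom(4)])
    finally show ?thesis .
  qed
  have "Res N u (Ind N i x) = rho u \<cdot>\<^bsub>Cat M K\<^esub> transfer q (pullo M u (X G)) (pullo M u (Y G)) g \<cdot>\<^bsub>Cat M K\<^esub> lam u"
    unfolding Res_eq[OF hom(2)] Ind_eq[OF hom(1)]
    by (subst transfer_mackey[OF sq hom _ _ _ _ key]) (auto intro!: chomI simp: conjugate_hom[OF hom(1) x])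
  also have "\<dots> = transfer q (X K) (Y K) (pullm M q (rho u) \<cdot>\<^bsub>Cat M P\<^esub> g \<cdot>\<^bsub>Cat M P\<^esub> pullm M q (lam u))"
    by (simp add: transfer_pre[OF J(2) hom(4)] transfer_post[OF J(2) hom(4)])
  also have "pullm M q (rho u) \<cdot>\<^bsub>Cat M P\<^esub> g \<cdot>\<^bsub>Cat M P\<^esub> pullm M q (lam u) = conjugate q (Res N p x)"
    by (simp add: g_def q.image_eq[OF u.D.inverse(5)] q.image_inside[OF u.D.inverse(6)])
  finally show ?thesis by (simp add: Ind_eq[OF hom(4)])
qed

lemma decat_coproduct:
  assumes c: "binary_coproduct \<G> G H S i j"
  shows "\<lbrakk>x \<in> carrier (Val N G); y \<in> carrier (Val N H)\<rbrakk> \<Longrightarrow>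
      Res N i (Ind N i x \<oplus>\<^bsub>Val N S\<^esub> Ind N j y) = x \<and> Res N j (Ind N i x \<oplus>\<^bsub>Val N S\<^esub> Ind N j y) = y"
    and "z \<in> carrier (Val N S) \<Longrightarrow> Ind N i (Res N i z) \<oplus>\<^bsub>Val N S\<^esub> Ind N j (Res N j z) = z"
proof -
  note b = binary_coproduct_inclusions[OF c]
  note obs = hom1_obs[OF b(1)] hom1_obs[OF b(2)]
  interpret i: ftor "Cat M S" "Cat M G" "Pull M i" by (rule pull) (rule b)
  interpret j: ftor "Cat M S" "Cat M H" "Pull M j" by (rule pull) (rule b)
  interpret G: lin_category R "Cat M G" using obs by (auto intro: linear_category)
  interpret H: lin_category R "Cat M H" using obs by (auto intro: linear_category)
  note [simp] = coherence[OF b(1)] coherence[OF b(2)]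
  note t = transfer_coproduct[OF c coherence(9,10)[OF b(1)]]
  have valG: "Val N G = hmod (Cat M G) (X G) (Y G)" and valH: "Val N H = hmod (Cat M H) (X H) (Y H)"
    and valS: "Val N S = hmod (Cat M S) (X S) (Y S)" by (simp_all add: hom_decat_def)
  interpret MG: module R "Val N G" unfolding valG by (rule G.hmod_module) auto
  interpret MH: module R "Val N H" unfolding valH by (rule H.hmod_module) auto
  have zero: "rho i \<cdot>\<^bsub>Cat M G\<^esub> \<zero>\<^bsub>hmod (Cat M G) (pullo M i (X S)) (pullo M i (Y S))\<^esub> \<cdot>\<^bsub>Cat M G\<^esub> lam i = \<zero>\<^bsub>Val N G\<^esub>"
  proof -
    have "\<zero>\<^bsub>hmod (Cat M G) (pullo M i (X S)) (pullo M i (Y S))\<^esub> \<cdot>\<^bsub>Cat M G\<^esub> lam i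
        = \<zero>\<^bsub>hmod (Cat M G) (X G) (pullo M i (Y S))\<^esub>"
      by (rule linear_map_zero[OF G.pre_linear]) auto
    moreover have "rho i \<cdot>\<^bsub>Cat M G\<^esub> \<zero>\<^bsub>hmod (Cat M G) (X G) (pullo M i (Y S))\<^esub> = \<zero>\<^bsub>hmod (Cat M G) (X G) (Y G)\<^esub>"
      by (rule linear_map_zero[OF G.post_linear]) auto
    ultimately show ?thesis using valG by simp
  qed
  have zero': "rho j \<cdot>\<^bsub>Cat M H\<^esub> \<zero>\<^bsub>hmod (Cat M H) (pullo M j (X S)) (pullo M j (Y S))\<^esub> \<cdot>\<^bsub>Cat M H\<^esub> lam j = \<zero>\<^bsub>Val N H\<^esub>"
  proof -
    have "\<zero>\<^bsub>hmod (Cat M H) (pullo M j (X S)) (pullo M j (Y S))\<^esub> \<cdot>\<^bsub>Cat M H\<^esub> lam j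
        = \<zero>\<^bsub>hmod (Cat M H) (X H) (pullo M j (Y S))\<^esub>"
      by (rule linear_map_zero[OF H.pre_linear]) auto
    moreover have "rho j \<cdot>\<^bsub>Cat M H\<^esub> \<zero>\<^bsub>hmod (Cat M H) (X H) (pullo M j (Y S))\<^esub> = \<zero>\<^bsub>hmod (Cat M H) (X H) (Y H)\<^esub>"
      by (rule linear_map_zero[OF H.post_linear]) auto
    ultimately show ?thesis using valH by simp
  qed
  show "Res N i (Ind N i x \<oplus>\<^bsub>Val N S\<^esub> Ind N j y) = x \<and> Res N j (Ind N i x \<oplus>\<^bsub>Val N S\<^esub> Ind N j y) = y"
    if xy: "x \<in> carrier (Val N G)" "y \<in> carrier (Val N H)"
  proof -
    have x: "x \<in> chom (Cat M G) (X G) (Y G)" and y: "y \<in> chom (Cat M H) (X H) (Y H)"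
      using xy obs by (auto simp: carrier_Val)
    have x': "x \<in> arr (Cat M G)" "cdom (Cat M G) x = X G" "ccod (Cat M G) x = Y G" using x by (auto simp: chom_iff)
    have y': "y \<in> arr (Cat M H)" "cdom (Cat M H) y = X H" "ccod (Cat M H) y = Y H" using y by (auto simp: chom_iff)
    have cx: "conjugate i x \<in> chom (Cat M G) (pullo M i (X S)) (pullo M i (Y S))"
      and cy: "conjugate j y \<in> chom (Cat M H) (pullo M j (X S)) (pullo M j (Y S))"
      using conjugate_hom[OF b(1) x] conjugate_hom[OF b(2) y] by (auto intro: chomI)
    have "Ind N i x \<in> carrier (Val N S)" "Ind N j y \<in> carrier (Val N S)"
      using Ind_hom[OF b(3,1) x] Ind_hom[OF b(4,2) y] obs by (auto simp: carrier_Val)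
    note add = linear_map_add[OF res_linear[OF b(1)] this] linear_map_add[OF res_linear[OF b(2)] this]
    have "Res N i (Ind N i x) = rho i \<cdot>\<^bsub>Cat M G\<^esub> conjugate i x \<cdot>\<^bsub>Cat M G\<^esub> lam i"
      "Res N j (Ind N j y) = rho j \<cdot>\<^bsub>Cat M H\<^esub> conjugate j y \<cdot>\<^bsub>Cat M H\<^esub> lam j"
      by (simp_all only: Res_eq[OF b(1)] Res_eq[OF b(2)] Ind_eq[OF b(1)] Ind_eq[OF b(2)] t(1)[OF cx] t(3)[OF cy])
    then have "Res N i (Ind N i x) = x" "Res N j (Ind N j y) = y"
      using x' y' by (simp_all add: conjugate_eq[OF b(1)] conjugate_eq[OF b(2)])
    moreover have "Res N i (Ind N j y) = \<zero>\<^bsub>Val N G\<^esub>" "Res N j (Ind N i x) = \<zero>\<^bsub>Val N H\<^esub>"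
      by (simp_all only: Res_eq[OF b(1)] Res_eq[OF b(2)] Ind_eq[OF b(1)] Ind_eq[OF b(2)] t(2)[OF cx] t(4)[OF cy] zero zero')
    ultimately show ?thesis using add xy by simp
  qed
  show "Ind N i (Res N i z) \<oplus>\<^bsub>Val N S\<^esub> Ind N j (Res N j z) = z" if "z \<in> carrier (Val N S)"
  proof -
    have z: "z \<in> chom (Cat M S) (X S) (Y S)" using that obs by (simp add: carrier_Val)
    show ?thesis
      using t(5)[OF z] by (simp add: Ind_eq[OF b(1)] Ind_eq[OF b(2)] conjugate_Res[OF b(1) z] conjugate_Res[OF b(2) z] valS)
  qed
qed

theorem mackey_functor_hom_decat: "mackey_functor R \<G> J N"
proof (rule mackey_functor.intro)
  fix G assume G: "G \<in> Ob \<G>"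
  interpret C: lin_category R "Cat M G" using G by (rule linear_category)
  note u = unit1_hom[OF G]
  show "module R (Val N G)"
    using C.hmod_module[OF X_obj[OF G] Y_obj[OF G]] by (simp add: hom_decat_def)
  fix x assume "x \<in> carrier (Val N G)"
  then have x: "x \<in> arr (Cat M G)" "cdom (Cat M G) x = X G" "ccod (Cat M G) x = Y G"
    using G by (auto simp: carrier_Val chom_iff)
  have id: "inverse_arrows (Cat M G) (cid (Cat M G) A) (cid (Cat M G) A)" if "A \<in> obj (Cat M G)" for A
    using that by (simp add: inverse_arrows_def chom_iff)
  show "Res N (Unit1 \<G> G) x = x"
    using x lam_unit[OF G] rho_unit[OF G] pull_unit_arr[OF G x(1)] by (simp add: Res_eq[OF u])
  show "Ind N (Unit1 \<G> G) x = x"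
    using x lam_unit[OF G] rho_unit[OF G] transfer_unit[OF G x(1)] X_obj[OF G] Y_obj[OF G]
    by (simp add: Ind_eq[OF u] conjugate_eq[OF u] C.cinv_eq[OF id])
next
  fix u v H G x
  assume u: "u \<in> hom1 \<G> H G" and "isomorphic1 \<G> u v"
  then obtain \<alpha> where \<alpha>: "\<alpha> \<in> hom2 \<G> u v" by (auto simp: isomorphic1_def)
  show "Res N u x = Res N v x" if "x \<in> carrier (Val N G)"
    using res_isomorphic[OF u \<alpha>] that hom1_obs[OF u] by (simp add: carrier_Val)
  show "Ind N u x = Ind N v x" if "u \<in> J" "x \<in> carrier (Val N H)"
    using ind_isomorphic[OF that(1) J_isomorphic[OF that(1) \<open>isomorphic1 \<G> u v\<close>] u \<alpha>] that hom1_obs[OF u]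
    by (simp add: carrier_Val)
next
  fix i u p q \<gamma> x assume sq: "mackey_square \<G> J i u p q \<gamma>" and x: "x \<in> carrier (Val N (Src \<G> i))"
  obtain H G K P where hom: "i \<in> hom1 \<G> H G" "u \<in> hom1 \<G> K G" "p \<in> hom1 \<G> P H" "q \<in> hom1 \<G> P K"
    using sq by (rule mackey_squareD)
  show "Res N u (Ind N i x) = Ind N q (Res N p x)"
    using decat_mackey_formula[OF sq hom] x hom1D[OF hom(1)] hom1_obs[OF hom(1)] by (simp add: carrier_Val)
qed (use res_linear ind_linear res_comp ind_comp decat_coproduct hom1_obs carrier_Val in auto)

end


section \<open>Convolution in a monoidal category\<close>

context linear_monoidal_category
begin

lemma lin_category: "lin_category R C"
  using linear_category by (simp add: lin_category_def)

lemma bifunctor: "bifunctor C (tob T) (tarr T)"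
proof -
  interpret lin_category R C by (rule lin_category)
  have arr: "f \<boxdot>\<^bsub>T\<^esub> g \<in> chom C (cdom C f \<boxtimes>\<^bsub>T\<^esub> cdom C g) (ccod C f \<boxtimes>\<^bsub>T\<^esub> ccod C g)"
    if "f \<in> arr C" "g \<in> arr C" for f g
  proof -
    have "bilinear_map R (hmod C (cdom C f) (ccod C f)) (hmod C (cdom C g) (ccod C g))
        (hmod C (cdom C f \<boxtimes>\<^bsub>T\<^esub> cdom C g) (ccod C f \<boxtimes>\<^bsub>T\<^esub> ccod C g)) (tarr T)"
      using that by (intro tensor_bilinear) auto
    then have "linear_map R (hmod C (cdom C g) (ccod C g))
        (hmod C (cdom C f \<boxtimes>\<^bsub>T\<^esub> cdom C g) (ccod C f \<boxtimes>\<^bsub>T\<^esub> ccod C g)) (tarr T f)"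
      using that by (simp add: bilinear_map_def carrier_hmod chom_iff)
    from linear_map_closed[OF this, of g]
    have "f \<boxdot>\<^bsub>T\<^esub> g \<in> carrier (hmod C (cdom C f \<boxtimes>\<^bsub>T\<^esub> cdom C g) (ccod C f \<boxtimes>\<^bsub>T\<^esub> ccod C g))"
      using that by (simp add: carrier_hmod chom_iff)
    then show ?thesis using that by (simp add: carrier_hmod tensor_obj)
  qed
  show ?thesis
  proof
    fix f f' g g'
    assume "f \<in> arr C" "f' \<in> arr C" "g \<in> arr C" "g' \<in> arr C" "cdom C f' = ccod C f" "cdom C g' = ccod C g"
    then show "(f' \<boxdot>\<^bsub>T\<^esub> g') \<cdot>\<^bsub>C\<^esub> (f \<boxdot>\<^bsub>T\<^esub> g) = (f' \<cdot>\<^bsub>C\<^esub> f) \<boxdot>\<^bsub>T\<^esub> (g' \<cdot>\<^bsub>C\<^esub> g)"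
      by (intro tensor_comp[symmetric]) (auto simp: chom_iff)
  qed (use chomD[OF arr] tensor_obj tensor_id in simp_all)
qed

text \<open>Convolutions \<open>a (x \<boxtimes> y) c\<close> with respect to an operation \<open>a\<close> and a cooperation \<open>c\<close> are as
  associative and unital as these are. Several different operations are allowed, so that one
  statement serves for algebras and for left and right modules.\<close>

lemma convolution_assoc:
  assumes hom: "x \<in> chom C X\<^sub>1 Y\<^sub>1" "y \<in> chom C X\<^sub>2 Y\<^sub>2" "z \<in> chom C X\<^sub>3 Y\<^sub>3"
    and ob: "X\<^sub>1 \<in> obj C" "X\<^sub>2 \<in> obj C" "X\<^sub>3 \<in> obj C" "Y\<^sub>1 \<in> obj C" "Y\<^sub>2 \<in> obj C" "Y\<^sub>3 \<in> obj C"
    and c: "c\<^sub>1\<^sub>2 \<in> chom C X\<^sub>1\<^sub>2 (X\<^sub>1 \<boxtimes>\<^bsub>T\<^esub> X\<^sub>2)" "c \<in> chom C X (X\<^sub>1\<^sub>2 \<boxtimes>\<^bsub>T\<^esub> X\<^sub>3)"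
      "c\<^sub>2\<^sub>3 \<in> chom C X\<^sub>2\<^sub>3 (X\<^sub>2 \<boxtimes>\<^bsub>T\<^esub> X\<^sub>3)" "c' \<in> chom C X (X\<^sub>1 \<boxtimes>\<^bsub>T\<^esub> X\<^sub>2\<^sub>3)"
    and a: "a\<^sub>1\<^sub>2 \<in> chom C (Y\<^sub>1 \<boxtimes>\<^bsub>T\<^esub> Y\<^sub>2) Y\<^sub>1\<^sub>2" "a \<in> chom C (Y\<^sub>1\<^sub>2 \<boxtimes>\<^bsub>T\<^esub> Y\<^sub>3) Y"
      "a\<^sub>2\<^sub>3 \<in> chom C (Y\<^sub>2 \<boxtimes>\<^bsub>T\<^esub> Y\<^sub>3) Y\<^sub>2\<^sub>3" "a' \<in> chom C (Y\<^sub>1 \<boxtimes>\<^bsub>T\<^esub> Y\<^sub>2\<^sub>3) Y"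
    and cooperation_coassoc: "tassoc T X\<^sub>1 X\<^sub>2 X\<^sub>3 \<cdot>\<^bsub>C\<^esub> (c\<^sub>1\<^sub>2 \<boxdot>\<^bsub>T\<^esub> cid C X\<^sub>3) \<cdot>\<^bsub>C\<^esub> c = (cid C X\<^sub>1 \<boxdot>\<^bsub>T\<^esub> c\<^sub>2\<^sub>3) \<cdot>\<^bsub>C\<^esub> c'"
    and operation_assoc: "a \<cdot>\<^bsub>C\<^esub> (a\<^sub>1\<^sub>2 \<boxdot>\<^bsub>T\<^esub> cid C Y\<^sub>3) = a' \<cdot>\<^bsub>C\<^esub> (cid C Y\<^sub>1 \<boxdot>\<^bsub>T\<^esub> a\<^sub>2\<^sub>3) \<cdot>\<^bsub>C\<^esub> tassoc T Y\<^sub>1 Y\<^sub>2 Y\<^sub>3"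
  shows "a \<cdot>\<^bsub>C\<^esub> ((a\<^sub>1\<^sub>2 \<cdot>\<^bsub>C\<^esub> (x \<boxdot>\<^bsub>T\<^esub> y) \<cdot>\<^bsub>C\<^esub> c\<^sub>1\<^sub>2) \<boxdot>\<^bsub>T\<^esub> z) \<cdot>\<^bsub>C\<^esub> c
    = a' \<cdot>\<^bsub>C\<^esub> (x \<boxdot>\<^bsub>T\<^esub> (a\<^sub>2\<^sub>3 \<cdot>\<^bsub>C\<^esub> (y \<boxdot>\<^bsub>T\<^esub> z) \<cdot>\<^bsub>C\<^esub> c\<^sub>2\<^sub>3)) \<cdot>\<^bsub>C\<^esub> c'"
proof -
  interpret lin_category R C by (rule lin_category)
  interpret B: bifunctor C "tob T" "tarr T" by (rule bifunctor)
  note h = hom[unfolded chom_iff] c[unfolded chom_iff] a[unfolded chom_iff]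
    assoc_iso[OF ob(1-3), unfolded chom_iff] assoc_iso[OF ob(4-6), unfolded chom_iff]
  note [simp] = h ob
  have [simp]: "X\<^sub>1\<^sub>2 \<in> obj C" "X\<^sub>2\<^sub>3 \<in> obj C" "X \<in> obj C" "Y\<^sub>1\<^sub>2 \<in> obj C" "Y\<^sub>2\<^sub>3 \<in> obj C" "Y \<in> obj C"
    using objs[of c\<^sub>1\<^sub>2] objs[of c\<^sub>2\<^sub>3] objs[of c] objs[of a\<^sub>1\<^sub>2] objs[of a\<^sub>2\<^sub>3] objs[of a] h by simp_all
  have "a \<cdot>\<^bsub>C\<^esub> ((a\<^sub>1\<^sub>2 \<cdot>\<^bsub>C\<^esub> (x \<boxdot>\<^bsub>T\<^esub> y) \<cdot>\<^bsub>C\<^esub> c\<^sub>1\<^sub>2) \<boxdot>\<^bsub>T\<^esub> z) \<cdot>\<^bsub>C\<^esub> c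
      = a \<cdot>\<^bsub>C\<^esub> (a\<^sub>1\<^sub>2 \<boxdot>\<^bsub>T\<^esub> cid C Y\<^sub>3) \<cdot>\<^bsub>C\<^esub> ((x \<boxdot>\<^bsub>T\<^esub> y) \<boxdot>\<^bsub>T\<^esub> z) \<cdot>\<^bsub>C\<^esub> (c\<^sub>1\<^sub>2 \<boxdot>\<^bsub>T\<^esub> cid C X\<^sub>3) \<cdot>\<^bsub>C\<^esub> c"
    by (simp add: B.merge_inside)
  also have "\<dots> = a' \<cdot>\<^bsub>C\<^esub> (cid C Y\<^sub>1 \<boxdot>\<^bsub>T\<^esub> a\<^sub>2\<^sub>3) \<cdot>\<^bsub>C\<^esub> tassoc T Y\<^sub>1 Y\<^sub>2 Y\<^sub>3 \<cdot>\<^bsub>C\<^esub>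
      ((x \<boxdot>\<^bsub>T\<^esub> y) \<boxdot>\<^bsub>T\<^esub> z) \<cdot>\<^bsub>C\<^esub> (c\<^sub>1\<^sub>2 \<boxdot>\<^bsub>T\<^esub> cid C X\<^sub>3) \<cdot>\<^bsub>C\<^esub> c"
    by (simp add: inside[OF operation_assoc])
  also have "\<dots> = a' \<cdot>\<^bsub>C\<^esub> (cid C Y\<^sub>1 \<boxdot>\<^bsub>T\<^esub> a\<^sub>2\<^sub>3) \<cdot>\<^bsub>C\<^esub> (x \<boxdot>\<^bsub>T\<^esub> (y \<boxdot>\<^bsub>T\<^esub> z)) \<cdot>\<^bsub>C\<^esub>
      tassoc T X\<^sub>1 X\<^sub>2 X\<^sub>3 \<cdot>\<^bsub>C\<^esub> (c\<^sub>1\<^sub>2 \<boxdot>\<^bsub>T\<^esub> cid C X\<^sub>3) \<cdot>\<^bsub>C\<^esub> c"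
    by (simp add: inside[OF assoc_natural[OF hom]])
  also have "\<dots> = a' \<cdot>\<^bsub>C\<^esub> (cid C Y\<^sub>1 \<boxdot>\<^bsub>T\<^esub> a\<^sub>2\<^sub>3) \<cdot>\<^bsub>C\<^esub> (x \<boxdot>\<^bsub>T\<^esub> (y \<boxdot>\<^bsub>T\<^esub> z)) \<cdot>\<^bsub>C\<^esub> (cid C X\<^sub>1 \<boxdot>\<^bsub>T\<^esub> c\<^sub>2\<^sub>3) \<cdot>\<^bsub>C\<^esub> c'"
    by (simp only: cooperation_coassoc)
  also have "\<dots> = a' \<cdot>\<^bsub>C\<^esub> (x \<boxdot>\<^bsub>T\<^esub> (a\<^sub>2\<^sub>3 \<cdot>\<^bsub>C\<^esub> (y \<boxdot>\<^bsub>T\<^esub> z) \<cdot>\<^bsub>C\<^esub> c\<^sub>2\<^sub>3)) \<cdot>\<^bsub>C\<^esub> c'"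
    by (simp add: B.merge_inside)
  finally show ?thesis .
qed

lemma convolution_left_unit:
  assumes y: "y \<in> chom C V W" and \<iota>: "\<iota> \<in> chom C (tunit T) Y" and \<epsilon>: "\<epsilon> \<in> chom C X (tunit T)"
    and c: "c \<in> chom C V (X \<boxtimes>\<^bsub>T\<^esub> V)" and a: "a \<in> chom C (Y \<boxtimes>\<^bsub>T\<^esub> W) W"
    and unit: "a \<cdot>\<^bsub>C\<^esub> (\<iota> \<boxdot>\<^bsub>T\<^esub> cid C W) = tlunit T W"
    and counit: "tlunit T V \<cdot>\<^bsub>C\<^esub> (\<epsilon> \<boxdot>\<^bsub>T\<^esub> cid C V) \<cdot>\<^bsub>C\<^esub> c = cid C V"
  shows "a \<cdot>\<^bsub>C\<^esub> ((\<iota> \<cdot>\<^bsub>C\<^esub> \<epsilon>) \<boxdot>\<^bsub>T\<^esub> y) \<cdot>\<^bsub>C\<^esub> c = y"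
proof -
  interpret lin_category R C by (rule lin_category)
  interpret B: bifunctor C "tob T" "tarr T" by (rule bifunctor)
  note h [simp] = y[unfolded chom_iff] \<iota>[unfolded chom_iff] \<epsilon>[unfolded chom_iff] c[unfolded chom_iff]
    a[unfolded chom_iff] tensor_unit
  have [simp]: "V \<in> obj C" "W \<in> obj C" using objs[of y] h by simp_all
  note [simp] = lunit_iso[of V, unfolded chom_iff] lunit_iso[of W, unfolded chom_iff]
  have "a \<cdot>\<^bsub>C\<^esub> ((\<iota> \<cdot>\<^bsub>C\<^esub> \<epsilon>) \<boxdot>\<^bsub>T\<^esub> y) \<cdot>\<^bsub>C\<^esub> c
      = a \<cdot>\<^bsub>C\<^esub> (\<iota> \<boxdot>\<^bsub>T\<^esub> cid C W) \<cdot>\<^bsub>C\<^esub> (cid C (tunit T) \<boxdot>\<^bsub>T\<^esub> y) \<cdot>\<^bsub>C\<^esub> (\<epsilon> \<boxdot>\<^bsub>T\<^esub> cid C V) \<cdot>\<^bsub>C\<^esub> c"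
    by (simp add: B.merge_inside)
  also have "\<dots> = y \<cdot>\<^bsub>C\<^esub> tlunit T V \<cdot>\<^bsub>C\<^esub> (\<epsilon> \<boxdot>\<^bsub>T\<^esub> cid C V) \<cdot>\<^bsub>C\<^esub> c"
    by (simp add: inside[OF unit] inside[OF lunit_natural[OF y]])
  also have "\<dots> = y" by (simp add: counit)
  finally show ?thesis .
qed

lemma convolution_right_unit:
  assumes y: "y \<in> chom C V W" and \<iota>: "\<iota> \<in> chom C (tunit T) Y" and \<epsilon>: "\<epsilon> \<in> chom C X (tunit T)"
    and c: "c \<in> chom C V (V \<boxtimes>\<^bsub>T\<^esub> X)" and a: "a \<in> chom C (W \<boxtimes>\<^bsub>T\<^esub> Y) W"
    and unit: "a \<cdot>\<^bsub>C\<^esub> (cid C W \<boxdot>\<^bsub>T\<^esub> \<iota>) = trunit T W"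
    and counit: "trunit T V \<cdot>\<^bsub>C\<^esub> (cid C V \<boxdot>\<^bsub>T\<^esub> \<epsilon>) \<cdot>\<^bsub>C\<^esub> c = cid C V"
  shows "a \<cdot>\<^bsub>C\<^esub> (y \<boxdot>\<^bsub>T\<^esub> (\<iota> \<cdot>\<^bsub>C\<^esub> \<epsilon>)) \<cdot>\<^bsub>C\<^esub> c = y"
proof -
  interpret lin_category R C by (rule lin_category)
  interpret B: bifunctor C "tob T" "tarr T" by (rule bifunctor)
  note h [simp] = y[unfolded chom_iff] \<iota>[unfolded chom_iff] \<epsilon>[unfolded chom_iff] c[unfolded chom_iff]
    a[unfolded chom_iff] tensor_unit
  have [simp]: "V \<in> obj C" "W \<in> obj C" using objs[of y] h by simp_all
  note [simp] = runit_iso[of V, unfolded chom_iff] runit_iso[of W, unfolded chom_iff]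
  have "a \<cdot>\<^bsub>C\<^esub> (y \<boxdot>\<^bsub>T\<^esub> (\<iota> \<cdot>\<^bsub>C\<^esub> \<epsilon>)) \<cdot>\<^bsub>C\<^esub> c
      = a \<cdot>\<^bsub>C\<^esub> (cid C W \<boxdot>\<^bsub>T\<^esub> \<iota>) \<cdot>\<^bsub>C\<^esub> (y \<boxdot>\<^bsub>T\<^esub> cid C (tunit T)) \<cdot>\<^bsub>C\<^esub> (cid C V \<boxdot>\<^bsub>T\<^esub> \<epsilon>) \<cdot>\<^bsub>C\<^esub> c"
    by (simp add: B.merge_inside)
  also have "\<dots> = y \<cdot>\<^bsub>C\<^esub> trunit T V \<cdot>\<^bsub>C\<^esub> (cid C V \<boxdot>\<^bsub>T\<^esub> \<epsilon>) \<cdot>\<^bsub>C\<^esub> c"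
    by (simp add: inside[OF unit] inside[OF runit_natural[OF y]])
  also have "\<dots> = y" by (simp add: counit)
  finally show ?thesis .
qed

lemma convolution_bilinear:
  assumes ob: "X\<^sub>1 \<in> obj C" "X\<^sub>2 \<in> obj C" "Y\<^sub>1 \<in> obj C" "Y\<^sub>2 \<in> obj C"
    and c: "c \<in> chom C X (X\<^sub>1 \<boxtimes>\<^bsub>T\<^esub> X\<^sub>2)" and a: "a \<in> chom C (Y\<^sub>1 \<boxtimes>\<^bsub>T\<^esub> Y\<^sub>2) Y"
  shows "bilinear_map R (hmod C X\<^sub>1 Y\<^sub>1) (hmod C X\<^sub>2 Y\<^sub>2) (hmod C X Y) (\<lambda>x y. a \<cdot>\<^bsub>C\<^esub> (x \<boxdot>\<^bsub>T\<^esub> y) \<cdot>\<^bsub>C\<^esub> c)"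
proof -
  interpret lin_category R C by (rule lin_category)
  note h = c[unfolded chom_iff] a[unfolded chom_iff]
  have obj: "X \<in> obj C" "Y \<in> obj C" using objs[of c] objs[of a] h by simp_all
  have 1: "linear_map R (hmod C (X\<^sub>1 \<boxtimes>\<^bsub>T\<^esub> X\<^sub>2) (Y\<^sub>1 \<boxtimes>\<^bsub>T\<^esub> Y\<^sub>2)) (hmod C X (Y\<^sub>1 \<boxtimes>\<^bsub>T\<^esub> Y\<^sub>2)) (\<lambda>f. f \<cdot>\<^bsub>C\<^esub> c)"
    using h ob by (intro pre_linear) (auto intro: tensor_obj)
  have 2: "linear_map R (hmod C X (Y\<^sub>1 \<boxtimes>\<^bsub>T\<^esub> Y\<^sub>2)) (hmod C X Y) (\<lambda>f. a \<cdot>\<^bsub>C\<^esub> f)"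
    using h obj by (intro post_linear) auto
  note 3 = linear_map_comp[OF 1 2]
  have t: "bilinear_map R (hmod C X\<^sub>1 Y\<^sub>1) (hmod C X\<^sub>2 Y\<^sub>2) (hmod C (X\<^sub>1 \<boxtimes>\<^bsub>T\<^esub> X\<^sub>2) (Y\<^sub>1 \<boxtimes>\<^bsub>T\<^esub> Y\<^sub>2)) (tarr T)"
    using ob by (intro tensor_bilinear)
  show ?thesis
    unfolding bilinear_map_def
  proof (intro conjI ballI)
    show "linear_map R (hmod C X\<^sub>2 Y\<^sub>2) (hmod C X Y) (\<lambda>y. a \<cdot>\<^bsub>C\<^esub> (x \<boxdot>\<^bsub>T\<^esub> y) \<cdot>\<^bsub>C\<^esub> c)" if "x \<in> carrier (hmod C X\<^sub>1 Y\<^sub>1)" for x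
      using t that by (intro linear_map_comp[OF _ 3]) (simp add: bilinear_map_def)
    show "linear_map R (hmod C X\<^sub>1 Y\<^sub>1) (hmod C X Y) (\<lambda>x. a \<cdot>\<^bsub>C\<^esub> (x \<boxdot>\<^bsub>T\<^esub> y) \<cdot>\<^bsub>C\<^esub> c)" if "y \<in> carrier (hmod C X\<^sub>2 Y\<^sub>2)" for y
      using t that by (intro linear_map_comp[OF _ 3]) (simp add: bilinear_map_def)
  qed
qed

end


section \<open>Restriction and induction of convolutions\<close>

locale green_setting = mackey_setting \<AA> R \<G> J M + green_2functor \<AA> R \<G> J M
  for \<AA> :: ambient and R :: "('k, 'r) ring_scheme" and \<G> :: "('g, 'c, 'd) two_cat" and J :: "'c set"
    and M :: "('g, 'c, 'd, 'k, 'o, 'm) green2"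
begin

lemma tensor_bifunctor: "G \<in> Ob \<G> \<Longrightarrow> bifunctor (Cat M G) (tob (Ten M G)) (tarr (Ten M G))"
  using monoidal by (rule linear_monoidal_category.bifunctor)

lemma pten:
  assumes "u \<in> hom1 \<G> H G" "A \<in> obj (Cat M G)" "B \<in> obj (Cat M G)"
  shows "Pten M u A B \<in> arr (Cat M H)" "cdom (Cat M H) (Pten M u A B) = pullo M u (A \<boxtimes>\<^bsub>Ten M G\<^esub> B)"
    "ccod (Cat M H) (Pten M u A B) = pullo M u A \<boxtimes>\<^bsub>Ten M H\<^esub> pullo M u B" "iso_arrow (Cat M H) (Pten M u A B)"
  using strong_monoidal_functor.tensor_iso[OF pull_monoidal[OF assms(1)] assms(2,3)] by (auto simp: chom_iff)

lemma pten_natural: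
  assumes u: "u \<in> hom1 \<G> H G" and f: "f \<in> arr (Cat M G)" "g \<in> arr (Cat M G)"
  shows "Pten M u (ccod (Cat M G) f) (ccod (Cat M G) g) \<cdot>\<^bsub>Cat M H\<^esub> pullm M u (f \<boxdot>\<^bsub>Ten M G\<^esub> g)
    = (pullm M u f \<boxdot>\<^bsub>Ten M H\<^esub> pullm M u g) \<cdot>\<^bsub>Cat M H\<^esub> Pten M u (cdom (Cat M G) f) (cdom (Cat M G) g)"
  using f by (intro strong_monoidal_functor.tensor_natural[OF pull_monoidal[OF u]]) (auto intro: chomI)

text \<open>The second formula is the first one for the reversed tensor products.\<close>

lemma transfer_tensor:
  assumes i: "i \<in> J" "i \<in> hom1 \<G> H G" and f: "f \<in> arr (Cat M G)"
    and B: "B \<in> obj (Cat M G)" "B' \<in> obj (Cat M G)" and g: "g \<in> chom (Cat M H) (pullo M i B) (pullo M i B')"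
  shows "f \<boxdot>\<^bsub>Ten M G\<^esub> transfer i B B' g
      = transfer i (cdom (Cat M G) f \<boxtimes>\<^bsub>Ten M G\<^esub> B) (ccod (Cat M G) f \<boxtimes>\<^bsub>Ten M G\<^esub> B')
          (cinv (Cat M H) (Pten M i (ccod (Cat M G) f) B') \<cdot>\<^bsub>Cat M H\<^esub> (pullm M i f \<boxdot>\<^bsub>Ten M H\<^esub> g) \<cdot>\<^bsub>Cat M H\<^esub>
            Pten M i (cdom (Cat M G) f) B)" (is ?left)
    and "transfer i B B' g \<boxdot>\<^bsub>Ten M G\<^esub> f
      = transfer i (B \<boxtimes>\<^bsub>Ten M G\<^esub> cdom (Cat M G) f) (B' \<boxtimes>\<^bsub>Ten M G\<^esub> ccod (Cat M G) f)
          (cinv (Cat M H) (Pten M i B' (ccod (Cat M G) f)) \<cdot>\<^bsub>Cat M H\<^esub> (g \<boxdot>\<^bsub>Ten M H\<^esub> pullm M i f) \<cdot>\<^bsub>Cat M H\<^esub>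
            Pten M i B (cdom (Cat M G) f))" (is ?right)
proof -
  note ob = hom1_obs[OF i(2)]
  interpret a: ambidextrous "Cat M G" "Cat M H" "Pull M i" "Push M i" "leta M i" "leps M i" "reta M i" "reps M i"
    by (rule push_pull) fact+
  interpret G: bifunctor "Cat M G" "tob (Ten M G)" "tarr (Ten M G)" by (rule tensor_bifunctor) (use ob in simp)
  interpret H: bifunctor "Cat M H" "tob (Ten M H)" "tarr (Ten M H)" by (rule tensor_bifunctor) (use ob in simp)
  note [simp] = pten[OF i(2)]
  interpret l: tensor_compatible "Cat M G" "Cat M H" "Pull M i" "Push M i" "leta M i" "leps M i" "reta M i" "reps M i"
    "tob (Ten M G)" "tarr (Ten M G)" "tob (Ten M H)" "tarr (Ten M H)" "Pten M i"
    by (intro tensor_compatible.intro tensor_compatible_axioms.intro a.ambidextrous_axioms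
        G.bifunctor_axioms H.bifunctor_axioms) (simp_all add: chom_iff pten_natural[OF i(2)])
  interpret r: tensor_compatible "Cat M G" "Cat M H" "Pull M i" "Push M i" "leta M i" "leps M i" "reta M i" "reps M i"
    "\<lambda>x y. tob (Ten M G) y x" "\<lambda>f g. tarr (Ten M G) g f" "\<lambda>x y. tob (Ten M H) y x" "\<lambda>f g. tarr (Ten M H) g f"
    "\<lambda>x y. Pten M i y x"
    by (intro tensor_compatible.intro tensor_compatible_axioms.intro a.ambidextrous_axioms G.flip H.flip)
      (simp_all add: chom_iff pten_natural[OF i(2)])
  have "Lp1 \<G> M i A Y \<cdot>\<^bsub>Cat M G\<^esub> Rp1 \<G> M i A Y = cid (Cat M G) (cdom (Cat M G) (Rp1 \<G> M i A Y))"
    "Lp2 \<G> M i Y A \<cdot>\<^bsub>Cat M G\<^esub> Rp2 \<G> M i Y A = cid (Cat M G) (cdom (Cat M G) (Rp2 \<G> M i Y A))"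
    if "A \<in> obj (Cat M G)" "Y \<in> obj (Cat M H)" for A Y
    using projection1[OF i(1), of A Y] projection2[OF i(1), of A Y] that hom1D[OF i(2)]
    by (simp_all add: inverse_arrows_def)
  moreover have "Lp1 \<G> M i A Y = l.Lproj A Y" "Rp1 \<G> M i A Y = l.Rproj A Y"
    "Lp2 \<G> M i Y A = r.Lproj A Y" "Rp2 \<G> M i Y A = r.Rproj A Y" for A Y
    using hom1D[OF i(2)]
    by (simp_all add: Lp1_def Lp2_def Rp1_def Rp2_def l.Lproj_def l.Rproj_def r.Lproj_def r.Rproj_def Let_def)
  ultimately have inv: "l.Lproj A Y \<cdot>\<^bsub>Cat M G\<^esub> l.Rproj A Y = cid (Cat M G) (A \<boxtimes>\<^bsub>Ten M G\<^esub> pusho M i Y)"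
    "r.Lproj A Y \<cdot>\<^bsub>Cat M G\<^esub> r.Rproj A Y = cid (Cat M G) (pusho M i Y \<boxtimes>\<^bsub>Ten M G\<^esub> A)"
    if "A \<in> obj (Cat M G)" "Y \<in> obj (Cat M H)" for A Y
    using that by simp_all
  show ?left ?right
    using l.transfer_projection[OF inv(1) f B g] r.transfer_projection[OF inv(2) f B g]
    by (simp_all add: transfer_eq[OF i])
qed

end

text \<open>A pairing of two coherent families into a third one: fibrewise operations and cooperations that
  are compatible with the coherence maps. The multiplication of the algebra and both kinds of
  actions are instances.\<close>

locale convolution_pairing = green_setting \<AA> R \<G> J M +
  F\<^sub>1: coherent_family \<G> M X\<^sub>1 Y\<^sub>1 lam\<^sub>1 rho\<^sub>1 + F\<^sub>2: coherent_family \<G> M X\<^sub>2 Y\<^sub>2 lam\<^sub>2 rho\<^sub>2 +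
  F\<^sub>3: coherent_family \<G> M X\<^sub>3 Y\<^sub>3 lam\<^sub>3 rho\<^sub>3
  for \<AA> :: ambient and R :: "('k, 'r) ring_scheme" and \<G> :: "('g, 'c, 'd) two_cat" and J :: "'c set"
    and M :: "('g, 'c, 'd, 'k, 'o, 'm) green2"
    and X\<^sub>1 Y\<^sub>1 lam\<^sub>1 rho\<^sub>1 X\<^sub>2 Y\<^sub>2 lam\<^sub>2 rho\<^sub>2 X\<^sub>3 Y\<^sub>3 lam\<^sub>3 rho\<^sub>3 +
  fixes c a :: "'g \<Rightarrow> 'm"
  assumes coop: "G \<in> Ob \<G> \<Longrightarrow> c G \<in> chom (Cat M G) (X\<^sub>3 G) (X\<^sub>1 G \<boxtimes>\<^bsub>Ten M G\<^esub> X\<^sub>2 G)"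
    and operation: "G \<in> Ob \<G> \<Longrightarrow> a G \<in> chom (Cat M G) (Y\<^sub>1 G \<boxtimes>\<^bsub>Ten M G\<^esub> Y\<^sub>2 G) (Y\<^sub>3 G)"
    and coop_compatible: "u \<in> hom1 \<G> H G \<Longrightarrow> pull_coop \<G> M u (X\<^sub>1 G) (X\<^sub>2 G) (c G) \<cdot>\<^bsub>Cat M H\<^esub> lam\<^sub>3 u
      = (lam\<^sub>1 u \<boxdot>\<^bsub>Ten M H\<^esub> lam\<^sub>2 u) \<cdot>\<^bsub>Cat M H\<^esub> c H"
    and op_compatible: "u \<in> hom1 \<G> H G \<Longrightarrow> rho\<^sub>3 u \<cdot>\<^bsub>Cat M H\<^esub> pull_op \<G> M u (Y\<^sub>1 G) (Y\<^sub>2 G) (a G)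
      = a H \<cdot>\<^bsub>Cat M H\<^esub> (rho\<^sub>1 u \<boxdot>\<^bsub>Ten M H\<^esub> rho\<^sub>2 u)"
begin

sublocale D\<^sub>1: decategorification \<AA> R \<G> J M X\<^sub>1 Y\<^sub>1 lam\<^sub>1 rho\<^sub>1 ..
sublocale D\<^sub>2: decategorification \<AA> R \<G> J M X\<^sub>2 Y\<^sub>2 lam\<^sub>2 rho\<^sub>2 ..
sublocale D\<^sub>3: decategorification \<AA> R \<G> J M X\<^sub>3 Y\<^sub>3 lam\<^sub>3 rho\<^sub>3 ..

abbreviation "conv \<equiv> convolution_action M c a"

lemma conv_bilinear:
  assumes "G \<in> Ob \<G>"
  shows "bilinear_map R (Val D\<^sub>1.N G) (Val D\<^sub>2.N G) (Val D\<^sub>3.N G) (conv G)"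
proof -
  interpret linear_monoidal_category R "Cat M G" "Ten M G" by (rule monoidal) fact
  show ?thesis
    using convolution_bilinear[OF _ _ _ _ coop[OF assms] operation[OF assms]]
      F\<^sub>1.X_obj F\<^sub>1.Y_obj F\<^sub>2.X_obj F\<^sub>2.Y_obj assms
    by (simp add: hom_decat_def convolution_action_def[abs_def])
qed

lemma coops:
  assumes "G \<in> Ob \<G>"
  shows "c G \<in> arr (Cat M G)" "cdom (Cat M G) (c G) = X\<^sub>3 G" "ccod (Cat M G) (c G) = X\<^sub>1 G \<boxtimes>\<^bsub>Ten M G\<^esub> X\<^sub>2 G"
    "a G \<in> arr (Cat M G)" "cdom (Cat M G) (a G) = Y\<^sub>1 G \<boxtimes>\<^bsub>Ten M G\<^esub> Y\<^sub>2 G" "ccod (Cat M G) (a G) = Y\<^sub>3 G"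
  using coop[OF assms] operation[OF assms] by (auto simp: chom_iff)

text \<open>The compatibility of operation and cooperation with the coherence maps, solved for the composites
  that occur in restrictions (the first two equations) and in conjugates (the last two).\<close>

lemma compatibility:
  assumes u: "u \<in> hom1 \<G> H G"
  shows "pullm M u (c G) \<cdot>\<^bsub>Cat M H\<^esub> lam\<^sub>3 u
      = cinv (Cat M H) (Pten M u (X\<^sub>1 G) (X\<^sub>2 G)) \<cdot>\<^bsub>Cat M H\<^esub> (lam\<^sub>1 u \<boxdot>\<^bsub>Ten M H\<^esub> lam\<^sub>2 u) \<cdot>\<^bsub>Cat M H\<^esub> c H"
    and "rho\<^sub>3 u \<cdot>\<^bsub>Cat M H\<^esub> pullm M u (a G)
      = a H \<cdot>\<^bsub>Cat M H\<^esub> (rho\<^sub>1 u \<boxdot>\<^bsub>Ten M H\<^esub> rho\<^sub>2 u) \<cdot>\<^bsub>Cat M H\<^esub> Pten M u (Y\<^sub>1 G) (Y\<^sub>2 G)"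
    and "c H \<cdot>\<^bsub>Cat M H\<^esub> cinv (Cat M H) (lam\<^sub>3 u)
      = (cinv (Cat M H) (lam\<^sub>1 u) \<boxdot>\<^bsub>Ten M H\<^esub> cinv (Cat M H) (lam\<^sub>2 u)) \<cdot>\<^bsub>Cat M H\<^esub> Pten M u (X\<^sub>1 G) (X\<^sub>2 G) \<cdot>\<^bsub>Cat M H\<^esub> pullm M u (c G)"
    and "cinv (Cat M H) (rho\<^sub>3 u) \<cdot>\<^bsub>Cat M H\<^esub> a H
      = pullm M u (a G) \<cdot>\<^bsub>Cat M H\<^esub> cinv (Cat M H) (Pten M u (Y\<^sub>1 G) (Y\<^sub>2 G)) \<cdot>\<^bsub>Cat M H\<^esub>
          (cinv (Cat M H) (rho\<^sub>1 u) \<boxdot>\<^bsub>Ten M H\<^esub> cinv (Cat M H) (rho\<^sub>2 u))"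
proof -
  note ob = hom1_obs[OF u]
  interpret F: ftor "Cat M G" "Cat M H" "Pull M u" by (rule pull) fact
  interpret G: bifunctor "Cat M G" "tob (Ten M G)" "tarr (Ten M G)" by (rule tensor_bifunctor) (use ob in simp)
  interpret H: bifunctor "Cat M H" "tob (Ten M H)" "tarr (Ten M H)" by (rule tensor_bifunctor) (use ob in simp)
  note [simp] = D\<^sub>1.coherence[OF u] D\<^sub>2.coherence[OF u] D\<^sub>3.coherence[OF u] pten[OF u]
    coops[OF ob[THEN conjunct1]] coops[OF ob[THEN conjunct2]]
  note cc = coop_compatible[OF u, unfolded pull_coop_def] and oc = op_compatible[OF u, unfolded pull_op_def]
  have 1: "Pten M u (X\<^sub>1 G) (X\<^sub>2 G) \<cdot>\<^bsub>Cat M H\<^esub> pullm M u (c G) \<cdot>\<^bsub>Cat M H\<^esub> lam\<^sub>3 u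
      = (lam\<^sub>1 u \<boxdot>\<^bsub>Ten M H\<^esub> lam\<^sub>2 u) \<cdot>\<^bsub>Cat M H\<^esub> c H"
    using cc hom1D[OF u] by simp
  have 2: "rho\<^sub>3 u \<cdot>\<^bsub>Cat M H\<^esub> pullm M u (a G) \<cdot>\<^bsub>Cat M H\<^esub> cinv (Cat M H) (Pten M u (Y\<^sub>1 G) (Y\<^sub>2 G))
      = a H \<cdot>\<^bsub>Cat M H\<^esub> (rho\<^sub>1 u \<boxdot>\<^bsub>Ten M H\<^esub> rho\<^sub>2 u)"
    using oc hom1D[OF u] by simp
  show k1: "pullm M u (c G) \<cdot>\<^bsub>Cat M H\<^esub> lam\<^sub>3 u
      = cinv (Cat M H) (Pten M u (X\<^sub>1 G) (X\<^sub>2 G)) \<cdot>\<^bsub>Cat M H\<^esub> (lam\<^sub>1 u \<boxdot>\<^bsub>Ten M H\<^esub> lam\<^sub>2 u) \<cdot>\<^bsub>Cat M H\<^esub> c H"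
    by (simp flip: 1)
  show k2: "rho\<^sub>3 u \<cdot>\<^bsub>Cat M H\<^esub> pullm M u (a G)
      = a H \<cdot>\<^bsub>Cat M H\<^esub> (rho\<^sub>1 u \<boxdot>\<^bsub>Ten M H\<^esub> rho\<^sub>2 u) \<cdot>\<^bsub>Cat M H\<^esub> Pten M u (Y\<^sub>1 G) (Y\<^sub>2 G)"
  proof -
    have "a H \<cdot>\<^bsub>Cat M H\<^esub> (rho\<^sub>1 u \<boxdot>\<^bsub>Ten M H\<^esub> rho\<^sub>2 u) \<cdot>\<^bsub>Cat M H\<^esub> Pten M u (Y\<^sub>1 G) (Y\<^sub>2 G)
        = (a H \<cdot>\<^bsub>Cat M H\<^esub> (rho\<^sub>1 u \<boxdot>\<^bsub>Ten M H\<^esub> rho\<^sub>2 u)) \<cdot>\<^bsub>Cat M H\<^esub> Pten M u (Y\<^sub>1 G) (Y\<^sub>2 G)" by simp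
    also have "\<dots> = rho\<^sub>3 u \<cdot>\<^bsub>Cat M H\<^esub> pullm M u (a G)" unfolding 2[symmetric] by simp
    finally show ?thesis by simp
  qed
  let ?l = "cinv (Cat M H) (lam\<^sub>1 u) \<boxdot>\<^bsub>Ten M H\<^esub> cinv (Cat M H) (lam\<^sub>2 u)"
  have "c H \<cdot>\<^bsub>Cat M H\<^esub> cinv (Cat M H) (lam\<^sub>3 u)
      = ?l \<cdot>\<^bsub>Cat M H\<^esub> ((lam\<^sub>1 u \<boxdot>\<^bsub>Ten M H\<^esub> lam\<^sub>2 u) \<cdot>\<^bsub>Cat M H\<^esub> c H) \<cdot>\<^bsub>Cat M H\<^esub> cinv (Cat M H) (lam\<^sub>3 u)"
    by (simp add: H.merge_inside)
  also have "\<dots> = ?l \<cdot>\<^bsub>Cat M H\<^esub> Pten M u (X\<^sub>1 G) (X\<^sub>2 G) \<cdot>\<^bsub>Cat M H\<^esub> pullm M u (c G)"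
    unfolding 1[symmetric] by simp
  finally show "c H \<cdot>\<^bsub>Cat M H\<^esub> cinv (Cat M H) (lam\<^sub>3 u) = \<dots>" .
  let ?r = "cinv (Cat M H) (rho\<^sub>1 u) \<boxdot>\<^bsub>Ten M H\<^esub> cinv (Cat M H) (rho\<^sub>2 u)"
  have "cinv (Cat M H) (rho\<^sub>3 u) \<cdot>\<^bsub>Cat M H\<^esub> a H
      = cinv (Cat M H) (rho\<^sub>3 u) \<cdot>\<^bsub>Cat M H\<^esub> (a H \<cdot>\<^bsub>Cat M H\<^esub> (rho\<^sub>1 u \<boxdot>\<^bsub>Ten M H\<^esub> rho\<^sub>2 u)) \<cdot>\<^bsub>Cat M H\<^esub> ?r"
    by (simp add: H.merge)
  also have "\<dots> = pullm M u (a G) \<cdot>\<^bsub>Cat M H\<^esub> cinv (Cat M H) (Pten M u (Y\<^sub>1 G) (Y\<^sub>2 G)) \<cdot>\<^bsub>Cat M H\<^esub> ?r"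
    unfolding 2[symmetric] by simp
  finally show "cinv (Cat M H) (rho\<^sub>3 u) \<cdot>\<^bsub>Cat M H\<^esub> a H = \<dots>" .
qed

lemma res_conv:
  assumes u: "u \<in> hom1 \<G> H G" and x: "x \<in> chom (Cat M G) (X\<^sub>1 G) (Y\<^sub>1 G)" and y: "y \<in> chom (Cat M G) (X\<^sub>2 G) (Y\<^sub>2 G)"
  shows "Res D\<^sub>3.N u (conv G x y) = conv H (Res D\<^sub>1.N u x) (Res D\<^sub>2.N u y)"
proof -
  note ob = hom1_obs[OF u]
  interpret F: ftor "Cat M G" "Cat M H" "Pull M u" by (rule pull) fact
  interpret G: bifunctor "Cat M G" "tob (Ten M G)" "tarr (Ten M G)" by (rule tensor_bifunctor) (use ob in simp)
  interpret H: bifunctor "Cat M H" "tob (Ten M H)" "tarr (Ten M H)" by (rule tensor_bifunctor) (use ob in simp)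
  note [simp] = D\<^sub>1.coherence[OF u] D\<^sub>2.coherence[OF u] D\<^sub>3.coherence[OF u] pten[OF u]
    coops[OF ob[THEN conjunct1]] coops[OF ob[THEN conjunct2]] x[unfolded chom_iff] y[unfolded chom_iff]
  have 1: "Pten M u (Y\<^sub>1 G) (Y\<^sub>2 G) \<cdot>\<^bsub>Cat M H\<^esub> pullm M u (x \<boxdot>\<^bsub>Ten M G\<^esub> y)
      = (pullm M u x \<boxdot>\<^bsub>Ten M H\<^esub> pullm M u y) \<cdot>\<^bsub>Cat M H\<^esub> Pten M u (X\<^sub>1 G) (X\<^sub>2 G)"
    using pten_natural[OF u, of x y] by simp
  have "Res D\<^sub>3.N u (conv G x y) = rho\<^sub>3 u \<cdot>\<^bsub>Cat M H\<^esub> pullm M u (a G) \<cdot>\<^bsub>Cat M H\<^esub> pullm M u (x \<boxdot>\<^bsub>Ten M G\<^esub> y) \<cdot>\<^bsub>Cat M H\<^esub>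
      pullm M u (c G) \<cdot>\<^bsub>Cat M H\<^esub> lam\<^sub>3 u"
    by (simp add: D\<^sub>3.Res_eq[OF u] convolution_action_def)
  also have "\<dots> = conv H (Res D\<^sub>1.N u x) (Res D\<^sub>2.N u y)"
    by (simp add: F.D.inside[OF compatibility(2)[OF u]] compatibility(1)[OF u] F.D.inside[OF 1] H.merge_inside
        D\<^sub>1.Res_eq[OF u] D\<^sub>2.Res_eq[OF u] convolution_action_def)
  finally show ?thesis .
qed

text \<open>By the projection formula, \<open>x \<otimes> T\<^sub>u\<close> becomes a transfer; operation and cooperation are moved inside it,
  and there compatibility turns them into those over \<open>H\<close>.\<close>

lemma conv_ind:
  assumes J: "u \<in> J" and u: "u \<in> hom1 \<G> H G"
    and x: "x \<in> chom (Cat M G) (X\<^sub>1 G) (Y\<^sub>1 G)" and y: "y \<in> chom (Cat M H) (X\<^sub>2 H) (Y\<^sub>2 H)"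
  shows "conv G x (Ind D\<^sub>2.N u y) = Ind D\<^sub>3.N u (conv H (Res D\<^sub>1.N u x) y)"
proof -
  note ob = hom1_obs[OF u]
  interpret F: ftor "Cat M G" "Cat M H" "Pull M u" by (rule pull) fact
  interpret G: bifunctor "Cat M G" "tob (Ten M G)" "tarr (Ten M G)" by (rule tensor_bifunctor) (use ob in simp)
  interpret H: bifunctor "Cat M H" "tob (Ten M H)" "tarr (Ten M H)" by (rule tensor_bifunctor) (use ob in simp)
  note [simp] = D\<^sub>1.coherence[OF u] D\<^sub>2.coherence[OF u] D\<^sub>3.coherence[OF u] pten[OF u]
    coops[OF ob[THEN conjunct1]] coops[OF ob[THEN conjunct2]] x[unfolded chom_iff] y[unfolded chom_iff]
    D\<^sub>2.conjugate_hom[OF u y]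
  let ?g = "cinv (Cat M H) (Pten M u (Y\<^sub>1 G) (Y\<^sub>2 G)) \<cdot>\<^bsub>Cat M H\<^esub> (pullm M u x \<boxdot>\<^bsub>Ten M H\<^esub> D\<^sub>2.conjugate u y) \<cdot>\<^bsub>Cat M H\<^esub>
    Pten M u (X\<^sub>1 G) (X\<^sub>2 G)"
  have "conv G x (Ind D\<^sub>2.N u y)
      = a G \<cdot>\<^bsub>Cat M G\<^esub> transfer u (X\<^sub>1 G \<boxtimes>\<^bsub>Ten M G\<^esub> X\<^sub>2 G) (Y\<^sub>1 G \<boxtimes>\<^bsub>Ten M G\<^esub> Y\<^sub>2 G) ?g \<cdot>\<^bsub>Cat M G\<^esub> c G"
    using transfer_tensor(1)[OF J u, of x "X\<^sub>2 G" "Y\<^sub>2 G" "D\<^sub>2.conjugate u y"]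
    by (simp add: convolution_action_def D\<^sub>2.Ind_eq[OF u] chom_iff)
  also have "\<dots> = transfer u (X\<^sub>3 G) (Y\<^sub>3 G) (pullm M u (a G) \<cdot>\<^bsub>Cat M H\<^esub> ?g \<cdot>\<^bsub>Cat M H\<^esub> pullm M u (c G))"
    by (simp add: transfer_pre[OF J u] transfer_post[OF J u])
  also have "pullm M u (a G) \<cdot>\<^bsub>Cat M H\<^esub> ?g \<cdot>\<^bsub>Cat M H\<^esub> pullm M u (c G) = D\<^sub>3.conjugate u (conv H (Res D\<^sub>1.N u x) y)"
    by (simp add: D\<^sub>3.conjugate_eq[OF u] D\<^sub>2.conjugate_eq[OF u] D\<^sub>1.Res_eq[OF u] convolution_action_def
        F.D.inside[OF compatibility(4)[OF u]] compatibility(3)[OF u] H.merge_inside)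
  finally show ?thesis by (simp add: D\<^sub>3.Ind_eq[OF u])
qed

lemma ind_conv:
  assumes J: "u \<in> J" and u: "u \<in> hom1 \<G> H G"
    and x: "x \<in> chom (Cat M H) (X\<^sub>1 H) (Y\<^sub>1 H)" and y: "y \<in> chom (Cat M G) (X\<^sub>2 G) (Y\<^sub>2 G)"
  shows "conv G (Ind D\<^sub>1.N u x) y = Ind D\<^sub>3.N u (conv H x (Res D\<^sub>2.N u y))"
proof -
  note ob = hom1_obs[OF u]
  interpret F: ftor "Cat M G" "Cat M H" "Pull M u" by (rule pull) fact
  interpret G: bifunctor "Cat M G" "tob (Ten M G)" "tarr (Ten M G)" by (rule tensor_bifunctor) (use ob in simp)
  interpret H: bifunctor "Cat M H" "tob (Ten M H)" "tarr (Ten M H)" by (rule tensor_bifunctor) (use ob in simp)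
  note [simp] = D\<^sub>1.coherence[OF u] D\<^sub>2.coherence[OF u] D\<^sub>3.coherence[OF u] pten[OF u]
    coops[OF ob[THEN conjunct1]] coops[OF ob[THEN conjunct2]] x[unfolded chom_iff] y[unfolded chom_iff]
    D\<^sub>1.conjugate_hom[OF u x]
  let ?g = "cinv (Cat M H) (Pten M u (Y\<^sub>1 G) (Y\<^sub>2 G)) \<cdot>\<^bsub>Cat M H\<^esub> (D\<^sub>1.conjugate u x \<boxdot>\<^bsub>Ten M H\<^esub> pullm M u y) \<cdot>\<^bsub>Cat M H\<^esub>
    Pten M u (X\<^sub>1 G) (X\<^sub>2 G)"
  have "conv G (Ind D\<^sub>1.N u x) y
      = a G \<cdot>\<^bsub>Cat M G\<^esub> transfer u (X\<^sub>1 G \<boxtimes>\<^bsub>Ten M G\<^esub> X\<^sub>2 G) (Y\<^sub>1 G \<boxtimes>\<^bsub>Ten M G\<^esub> Y\<^sub>2 G) ?g \<cdot>\<^bsub>Cat M G\<^esub> c G"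
    using transfer_tensor(2)[OF J u, of y "X\<^sub>1 G" "Y\<^sub>1 G" "D\<^sub>1.conjugate u x"]
    by (simp add: convolution_action_def D\<^sub>1.Ind_eq[OF u] chom_iff)
  also have "\<dots> = transfer u (X\<^sub>3 G) (Y\<^sub>3 G) (pullm M u (a G) \<cdot>\<^bsub>Cat M H\<^esub> ?g \<cdot>\<^bsub>Cat M H\<^esub> pullm M u (c G))"
    by (simp add: transfer_pre[OF J u] transfer_post[OF J u])
  also have "pullm M u (a G) \<cdot>\<^bsub>Cat M H\<^esub> ?g \<cdot>\<^bsub>Cat M H\<^esub> pullm M u (c G) = D\<^sub>3.conjugate u (conv H x (Res D\<^sub>2.N u y))"
    by (simp add: D\<^sub>3.conjugate_eq[OF u] D\<^sub>1.conjugate_eq[OF u] D\<^sub>2.Res_eq[OF u] convolution_action_def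
        F.D.inside[OF compatibility(4)[OF u]] compatibility(3)[OF u] H.merge_inside)
  finally show ?thesis by (simp add: D\<^sub>3.Ind_eq[OF u])
qed

lemma conv_Val:
  assumes u: "u \<in> hom1 \<G> H G"
  shows "\<lbrakk>x \<in> carrier (Val D\<^sub>1.N G); y \<in> carrier (Val D\<^sub>2.N G)\<rbrakk>
      \<Longrightarrow> Res D\<^sub>3.N u (conv G x y) = conv H (Res D\<^sub>1.N u x) (Res D\<^sub>2.N u y)"
    and "\<lbrakk>u \<in> J; x \<in> carrier (Val D\<^sub>1.N G); y \<in> carrier (Val D\<^sub>2.N H)\<rbrakk>
      \<Longrightarrow> conv G x (Ind D\<^sub>2.N u y) = Ind D\<^sub>3.N u (conv H (Res D\<^sub>1.N u x) y)"
    and "\<lbrakk>u \<in> J; x \<in> carrier (Val D\<^sub>1.N H); y \<in> carrier (Val D\<^sub>2.N G)\<rbrakk>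
      \<Longrightarrow> conv G (Ind D\<^sub>1.N u x) y = Ind D\<^sub>3.N u (conv H x (Res D\<^sub>2.N u y))"
  using res_conv[OF u] conv_ind[OF _ u] ind_conv[OF _ u] hom1_obs[OF u]
  by (simp_all add: D\<^sub>1.carrier_Val D\<^sub>2.carrier_Val)

end


section \<open>The Green functor and its modules\<close>

text \<open>Being a module, and hence being a Mackey functor, does not depend on the multiplicative fields.\<close>

lemma module_update_mult [simp]: "module R (V\<lparr>mult := m, one := e\<rparr>) = module R V"
  by (simp add: module_def module_axioms_def abelian_group_def abelian_monoid_def abelian_group_axioms_def)

lemma linear_map_update_mult [simp]:
  "linear_map R (V\<lparr>mult := m, one := e\<rparr>) W f = linear_map R V W f"
  "linear_map R V (W\<lparr>mult := m, one := e\<rparr>) f = linear_map R V W f"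
  by (simp_all add: linear_map_def)

lemma mackey_functor_update_mult:
  assumes "mackey_functor R \<G> J N"
  shows "mackey_functor R \<G> J (N\<lparr>Val := \<lambda>G. (Val N G)\<lparr>mult := m G, one := e G\<rparr>\<rparr>)"
  using assms unfolding mackey_functor_def by simp

lemma convolution_decat_simps [simp]:
  "carrier (Val (convolution_decat \<G> M X Y lam rho \<delta> \<epsilon> \<mu> \<iota>) G) = carrier (Val (hom_decat \<G> M X Y lam rho) G)"
  "Res (convolution_decat \<G> M X Y lam rho \<delta> \<epsilon> \<mu> \<iota>) = Res (hom_decat \<G> M X Y lam rho)"
  "Ind (convolution_decat \<G> M X Y lam rho \<delta> \<epsilon> \<mu> \<iota>) = Ind (hom_decat \<G> M X Y lam rho)"
  "x \<otimes>\<^bsub>Val (convolution_decat \<G> M X Y lam rho \<delta> \<epsilon> \<mu> \<iota>) G\<^esub> y = convolution_action M \<delta> \<mu> G x y"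
  "\<one>\<^bsub>Val (convolution_decat \<G> M X Y lam rho \<delta> \<epsilon> \<mu> \<iota>) G\<^esub> = \<iota> G \<cdot>\<^bsub>Cat M G\<^esub> \<epsilon> G"
  by (simp_all add: convolution_decat_def hom_decat_def convolution_action_def)

lemma convolution_decat_Val:
  "Val (convolution_decat \<G> M X Y lam rho \<delta> \<epsilon> \<mu> \<iota>) G = (Val (hom_decat \<G> M X Y lam rho) G)
    \<lparr>mult := convolution_action M \<delta> \<mu> G, one := \<iota> G \<cdot>\<^bsub>Cat M G\<^esub> \<epsilon> G\<rparr>"
  by (simp add: convolution_decat_def hom_decat_def convolution_action_def[abs_def])

lemma assoc_algebraI:
  assumes V: "module R V" and m: "bilinear_map R V V V m"
    and e: "e \<in> carrier V"
    and assoc: "\<And>x y z. \<lbrakk>x \<in> carrier V; y \<in> carrier V; z \<in> carrier V\<rbrakk> \<Longrightarrow> m (m x y) z = m x (m y z)"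
    and unit: "\<And>x. x \<in> carrier V \<Longrightarrow> m e x = x" "\<And>x. x \<in> carrier V \<Longrightarrow> m x e = x"
  shows "assoc_algebra R (V\<lparr>mult := m, one := e\<rparr>)"
proof -
  let ?A = "V\<lparr>mult := m, one := e\<rparr>"
  have l: "linear_map R V V (m x)" and r: "linear_map R V V (\<lambda>y. m y x)" if "x \<in> carrier V" for x
    using m that by (auto simp: bilinear_map_def)
  have A: "module R ?A" using V by simp
  then have "abelian_group ?A" by (rule module.axioms(2))
  moreover have "Group.monoid ?A"
    using e assoc unit linear_map_closed[OF l] by (intro monoidI) auto
  ultimately have "ring ?A"
    using linear_map_add[OF l] linear_map_add[OF r] by (intro ring.intro ring_axioms.intro) auto
  moreover have "a \<odot>\<^bsub>V\<^esub> m x y = m (a \<odot>\<^bsub>V\<^esub> x) y" "a \<odot>\<^bsub>V\<^esub> m x y = m x (a \<odot>\<^bsub>V\<^esub> y)"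
    if "a \<in> carrier R" "x \<in> carrier V" "y \<in> carrier V" for a x y
    using l[OF that(2)] r[OF that(3)] that by (auto simp: linear_map_def)
  ultimately show ?thesis using A by (auto simp: assoc_algebra_def)
qed

locale green_decategorification = green_setting \<AA> R \<G> J M + comonoid_monoid_family \<G> M X Y lam rho \<delta> \<epsilon> \<mu> \<iota>
  for \<AA> :: ambient and R :: "('k, 'r) ring_scheme" and \<G> :: "('g, 'c, 'd) two_cat" and J :: "'c set"
    and M :: "('g, 'c, 'd, 'k, 'o, 'm) green2"
    and X Y :: "'g \<Rightarrow> 'o" and lam rho :: "'c \<Rightarrow> 'm" and \<delta> \<epsilon> \<mu> \<iota> :: "'g \<Rightarrow> 'm"
begin

sublocale D: decategorification \<AA> R \<G> J M X Y lam rho ..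

sublocale P: convolution_pairing \<AA> R \<G> J M X Y lam rho X Y lam rho X Y lam rho \<delta> \<mu>
  using comonoid "monoid" lam_comonoid_map rho_monoid_map
  by unfold_locales (auto simp: is_comonoid_def is_monoid_def comonoid_map_def monoid_map_def)

abbreviation "A \<equiv> convolution_decat \<G> M X Y lam rho \<delta> \<epsilon> \<mu> \<iota>"

lemma convolution_unit_hom: "G \<in> Ob \<G> \<Longrightarrow> \<iota> G \<cdot>\<^bsub>Cat M G\<^esub> \<epsilon> G \<in> chom (Cat M G) (X G) (Y G)"
  using comonoid[of G] "monoid"[of G] lin_category.linear_category[OF linear_category, of G]
  by (auto simp: is_comonoid_def is_monoid_def linear_category_def intro: category.comp_closed)

theorem green_functor: "green_functor R \<G> J A"
proof (intro green_functor.intro green_functor_axioms.intro)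
  have "A = D.N\<lparr>Val := \<lambda>G. (Val D.N G)\<lparr>mult := convolution_action M \<delta> \<mu> G, one := \<iota> G \<cdot>\<^bsub>Cat M G\<^esub> \<epsilon> G\<rparr>\<rparr>"
    by (simp add: convolution_decat_def hom_decat_def convolution_action_def[abs_def])
  then show "mackey_functor R \<G> J A"
    using mackey_functor_update_mult[OF D.mackey_functor_hom_decat] by simp
next
  fix G assume G: "G \<in> Ob \<G>"
  interpret linear_monoidal_category R "Cat M G" "Ten M G" by (rule monoidal) fact
  note c = comonoid[OF G, unfolded is_comonoid_def] and m = "monoid"[OF G, unfolded is_monoid_def]
  note XY = X_obj[OF G] Y_obj[OF G]
  show "assoc_algebra R (Val A G)"
    unfolding convolution_decat_Val
  proof (rule assoc_algebraI)
    show "module R (Val D.N G)" using D.mackey_functor_hom_decat G by (rule mackey_functor.val_module)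
    show "bilinear_map R (Val D.N G) (Val D.N G) (Val D.N G) (convolution_action M \<delta> \<mu> G)"
      by (rule P.conv_bilinear[OF G])
    show "\<iota> G \<cdot>\<^bsub>Cat M G\<^esub> \<epsilon> G \<in> carrier (Val D.N G)"
      using convolution_unit_hom G by (simp add: D.carrier_Val)
    fix x assume "x \<in> carrier (Val D.N G)"
    then have x: "x \<in> chom (Cat M G) (X G) (Y G)" using G by (simp add: D.carrier_Val)
    show "convolution_action M \<delta> \<mu> G (\<iota> G \<cdot>\<^bsub>Cat M G\<^esub> \<epsilon> G) x = x"
      unfolding convolution_action_def by (rule convolution_left_unit[OF x]) (use c m in auto)
    show "convolution_action M \<delta> \<mu> G x (\<iota> G \<cdot>\<^bsub>Cat M G\<^esub> \<epsilon> G) = x"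
      unfolding convolution_action_def by (rule convolution_right_unit[OF x]) (use c m in auto)
    fix y z assume "y \<in> carrier (Val D.N G)" "z \<in> carrier (Val D.N G)"
    then have yz: "y \<in> chom (Cat M G) (X G) (Y G)" "z \<in> chom (Cat M G) (X G) (Y G)"
      using G by (simp_all add: D.carrier_Val)
    show "convolution_action M \<delta> \<mu> G (convolution_action M \<delta> \<mu> G x y) z
        = convolution_action M \<delta> \<mu> G x (convolution_action M \<delta> \<mu> G y z)"
      unfolding convolution_action_def
      by (rule convolution_assoc[OF x yz]) (use c m XY in auto)
  qed
qed (use P.conv_Val in simp_all)

theorem left_green_module:
  assumes "left_module_family \<G> M X Y lam rho \<delta> \<epsilon> \<mu> \<iota> V W lam' rho' c a"
  shows "left_green_module R \<G> J A (hom_decat \<G> M V W lam' rho') (convolution_action M c a)"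
proof -
  interpret F: left_module_family \<G> M X Y lam rho \<delta> \<epsilon> \<mu> \<iota> V W lam' rho' c a by fact
  interpret E: decategorification \<AA> R \<G> J M V W lam' rho' ..
  interpret Q: convolution_pairing \<AA> R \<G> J M X Y lam rho V W lam' rho' V W lam' rho' c a
    using F.left_comodule F.left_module F.lam_comodule_map F.rho_module_map
    by unfold_locales (auto simp: is_left_comodule_def is_left_module_def)
  show ?thesis
  proof (intro left_green_module.intro left_green_module_axioms.intro)
    fix G assume G: "G \<in> Ob \<G>"
    interpret linear_monoidal_category R "Cat M G" "Ten M G" by (rule monoidal) fact
    note c = comonoid[OF G, unfolded is_comonoid_def] and m = "monoid"[OF G, unfolded is_monoid_def]
      and c' = F.left_comodule[OF G, unfolded is_left_comodule_def]
      and m' = F.left_module[OF G, unfolded is_left_module_def]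
    show "bilinear_map R (Val A G) (Val E.N G) (Val E.N G) (convolution_action M c a G)"
      using Q.conv_bilinear[OF G] by (simp add: bilinear_map_def convolution_decat_Val)
    fix y assume "y \<in> carrier (Val E.N G)"
    then have y: "y \<in> chom (Cat M G) (V G) (W G)" using G by (simp add: E.carrier_Val)
    show "convolution_action M c a G \<one>\<^bsub>Val A G\<^esub> y = y"
      unfolding convolution_decat_simps convolution_action_def
      by (rule convolution_left_unit[OF y]) (use c m c' m' in auto)
    fix x x' assume "x \<in> carrier (Val A G)" "x' \<in> carrier (Val A G)"
    then have x: "x \<in> chom (Cat M G) (X G) (Y G)" "x' \<in> chom (Cat M G) (X G) (Y G)"
      using G by (simp_all add: D.carrier_Val)
    show "convolution_action M c a G (x \<otimes>\<^bsub>Val A G\<^esub> x') y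
        = convolution_action M c a G x (convolution_action M c a G x' y)"
      unfolding convolution_decat_simps convolution_action_def
      by (rule convolution_assoc[OF x y]) (use c m c' m' in auto)
  qed (use Q.conv_Val green_functor E.mackey_functor_hom_decat in simp_all)
qed

theorem right_green_module:
  assumes "right_module_family \<G> M X Y lam rho \<delta> \<epsilon> \<mu> \<iota> V W lam' rho' c a"
  shows "right_green_module R \<G> J A (hom_decat \<G> M V W lam' rho') (convolution_action M c a)"
proof -
  interpret F: right_module_family \<G> M X Y lam rho \<delta> \<epsilon> \<mu> \<iota> V W lam' rho' c a by fact
  interpret E: decategorification \<AA> R \<G> J M V W lam' rho' ..
  interpret Q: convolution_pairing \<AA> R \<G> J M V W lam' rho' X Y lam rho V W lam' rho' c a
    using F.right_comodule F.right_module F.lam_comodule_map F.rho_module_map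
    by unfold_locales (auto simp: is_right_comodule_def is_right_module_def)
  show ?thesis
  proof (intro right_green_module.intro right_green_module_axioms.intro)
    fix G assume G: "G \<in> Ob \<G>"
    interpret linear_monoidal_category R "Cat M G" "Ten M G" by (rule monoidal) fact
    note c = comonoid[OF G, unfolded is_comonoid_def] and m = "monoid"[OF G, unfolded is_monoid_def]
      and c' = F.right_comodule[OF G, unfolded is_right_comodule_def]
      and m' = F.right_module[OF G, unfolded is_right_module_def]
    show "bilinear_map R (Val E.N G) (Val A G) (Val E.N G) (convolution_action M c a G)"
      using Q.conv_bilinear[OF G] by (simp add: bilinear_map_def convolution_decat_Val)
    fix y assume "y \<in> carrier (Val E.N G)"
    then have y: "y \<in> chom (Cat M G) (V G) (W G)" using G by (simp add: E.carrier_Val)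
    show "convolution_action M c a G y \<one>\<^bsub>Val A G\<^esub> = y"
      unfolding convolution_decat_simps convolution_action_def
      by (rule convolution_right_unit[OF y]) (use c m c' m' in auto)
    fix x x' assume "x \<in> carrier (Val A G)" "x' \<in> carrier (Val A G)"
    then have x: "x \<in> chom (Cat M G) (X G) (Y G)" "x' \<in> chom (Cat M G) (X G) (Y G)"
      using G by (simp_all add: D.carrier_Val)
    show "convolution_action M c a G y (x \<otimes>\<^bsub>Val A G\<^esub> x')
        = convolution_action M c a G (convolution_action M c a G y x) x'"
      unfolding convolution_decat_simps convolution_action_def
      by (rule convolution_assoc[symmetric, OF y x]) (use c m c' m' in auto)
  qed (use Q.conv_Val green_functor E.mackey_functor_hom_decat in simp_all)
qed

end

theorem theorem12p7:
  fixes \<AA> :: ambient and R :: "('k, 'r) ring_scheme"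
    and \<G> :: "('g, 'c, 'd) two_cat" and J :: "'c set"
    and M :: "('g, 'c, 'd, 'k, 'o, 'm) green2"
    and X Y :: "'g \<Rightarrow> 'o" and lam rho :: "'c \<Rightarrow> 'm"
    and \<delta> \<epsilon> \<mu> \<iota> :: "'g \<Rightarrow> 'm"
  assumes "cring R"
    and "spannable_pair \<G> J"
    and "green_2functor \<AA> R \<G> J M"
    and "comonoid_monoid_family \<G> M X Y lam rho \<delta> \<epsilon> \<mu> \<iota>"
  shows "green_functor R \<G> J (convolution_decat \<G> M X Y lam rho \<delta> \<epsilon> \<mu> \<iota>) \<and>
    (\<forall>V W lam' rho' c a.
      left_module_family \<G> M X Y lam rho \<delta> \<epsilon> \<mu> \<iota> V W lam' rho' c a \<longrightarrow>
      left_green_module R \<G> J (convolution_decat \<G> M X Y lam rho \<delta> \<epsilon> \<mu> \<iota>)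
        (hom_decat \<G> M V W lam' rho') (convolution_action M c a)) \<and>
    (\<forall>V W lam' rho' c a.
      right_module_family \<G> M X Y lam rho \<delta> \<epsilon> \<mu> \<iota> V W lam' rho' c a \<longrightarrow>
      right_green_module R \<G> J (convolution_decat \<G> M X Y lam rho \<delta> \<epsilon> \<mu> \<iota>)
        (hom_decat \<G> M V W lam' rho') (convolution_action M c a))"
proof -
  interpret spannable_pair \<G> J by fact
  interpret green_2functor \<AA> R \<G> J M by fact
  interpret comonoid_monoid_family \<G> M X Y lam rho \<delta> \<epsilon> \<mu> \<iota> by fact
  interpret green_decategorification \<AA> R \<G> J M X Y lam rho \<delta> \<epsilon> \<mu> \<iota> ..
  show ?thesis
    using green_functor left_green_module right_green_module by blast
qed

end
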